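(* Suppose $\Omega\subset\mathbb{P}(\mathbb{R}^d)$ is a quasi-homogeneous properly convex domain and $r\ge\mathrm{r}_{\rm PES}(\Omega)$. There exist $\delta_0'>0$ and a function $\Psi:[\delta_0',\infty)\times[\delta_0',\infty)\to[0,\infty)$, non-decreasing in both coordinates, such that the following holds: if $\delta,D\ge\delta_0'$ and $(x_0,\dots,x_{r+1})\in\Omega^{r+2}$ is a $(\delta,D)$-generic tuple, then $C_{\frac{\delta}{2}}(x_0,\dots,x_{r+1})\ne\emptyset$ and $$\mathrm{diam}_{d_\Omega}\left(C_{\frac{\delta}{2}}(x_0,\dots,x_{r+1})\right)\le\Psi(\delta,D).$$
   Context: A properly convex domain is a nonempty open set $\Omega\subset\mathbb{P}(\mathbb{R}^d)$ whose closure $\overline{\Omega}$ lies in some affine chart, in which $\Omega$ is a bounded convex set; its dimension is assumed to be at least one. $\partial\Omega=\overline\Omega\setminus\Omega$, $\mathrm{Aut}(\Omega)=\{g\in \mathrm{PGL}_d(\mathbb{R}): g\Omega=\Omega\}$, and $\Omega$ is quasi-homogeneous if there is a compact $K\subset\Omega$ with $\mathrm{Aut}(\Omega)\cdot K=\Omega$. Hilbert metric: for distinct $x,y\in\Omega$ let $x_\infty,y_\infty\in\partial\Omega$ be the endpoints of the intersection of the projective line through $x,y$ with $\overline\Omega$, ordered $x_\infty,x,y,y_\infty$; then $d_\Omega(x,y)=\frac12\log\frac{|y-x_\infty||x-y_\infty|}{|x-x_\infty||y-y_\infty|}$ (and $d_\Omega(x,x)=0$). For nonempty $C\subset\Omega$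 and $\delta>0$, $\mathcal{N}_\delta(C)=\{x\in\Omega: d_\Omega(x,C)<\delta\}$, and $\mathcal{N}_0(C)=C$. Diameters are for $d_\Omega$, with $\mathrm{diam}(\emptyset)=0$. $\mathrm{CH}_\Omega(X)$ is the convex hull of $X$ in $\overline\Omega$, i.e. the intersection of all convex subsets of $\overline\Omega$ (convex in the affine chart) containing $X$. The $\delta$-centroid of $x_0,\dots,x_k\in\Omega$ is $C_\delta(x_0,\dots,x_k)=\bigcap_{i=0}^k\mathcal{N}_\delta(\mathrm{CH}_\Omega(x_0,\dots,\widehat{x_i},\dots,x_k))$. For $\delta,D\ge0$, a tuple $(v_0,\dots,v_{r+1})\in\Omega^{r+2}$ is $(\delta,D)$-generic if: whenever $I_0,\dots,I_q\subset\{0,\dots,r+1\}$ are non-empty proper subsets with $\bigcap_{i=0}^qI_i=\emptyset$ and $\mathrm{diam}\big(\bigcap_{i=0}^q\mathcal{N}_\delta(\mathrm{CH}_\Omega(v_j:j\in I_i))\big)>D$, then $|I_0|=\dots=|I_q|=r+1$. For $k\ge1$, a non-degenerate $k$-simplex is $S=\mathrm{CH}_\Omega(v_0,\dots,v_k)$ with $v_i\in\overline\Omega$ and $\dim\mathbb{P}(\mathrm{Span}\{v_0,\dots,v_k\})=k$; its facets are $F^i(S)=\mathrm{CH}_\Omega(v_0,\dots,\widehat{v_i},\dots,v_k)$. A $k$-dimensional PES in $\Omega$ is a non-degenerate $k$-simplex $S$ with vertices in $\partial\Omega$ such that $S\cap\Omega\ne\emptyset$ and $F^i(S)\subset\partial\Omega$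 for all $i$. The projective simplex rank is $\mathrm{r}_{\rm PES}(\Omega)=\sup\{\dim S: S\text{ is a PES in }\Omega\}$. *)

theory Defs
  imports "HOL-Analysis.Analysis"
begin

section \<open>Real projective space\<close>

text \<open>Points of \<open>P(R^d)\<close>, \<open>d = CARD('n)\<close>, are the lines through the origin of \<open>R^d\<close>.\<close>

typedef ('n::finite) rproj = "{L :: (real^'n) set. subspace L \<and> dim L = 1}"
  morphisms line_of rproj_of
proof -
  have "dim (span {axis undefined 1 :: real^'n}) = 1"
    by (simp add: dim_singleton axis_eq_0_iff)
  then show ?thesis
    by (intro exI[of _ "span {axis undefined 1}"]) simp
qed

definition proj_pt :: "real^'n \<Rightarrow> ('n::finite) rproj" where
  "proj_pt v = rproj_of (span {v})"

text \<open>The quotient topology of the punctured space \<open>R^d - {0}\<close>.\<close>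

instantiation rproj :: (finite) topological_space
begin

definition open_rproj :: "'a rproj set \<Rightarrow> bool" where
  "open_rproj U \<longleftrightarrow> open {v. v \<noteq> 0 \<and> proj_pt v \<in> U}"

instance
proof
  have "{v :: real^'a. v \<noteq> 0 \<and> proj_pt v \<in> UNIV} = - {0}"
    by auto
  then show "open (UNIV :: 'a rproj set)"
    unfolding open_rproj_def by (simp add: open_Compl)
next
  fix S T :: "'a rproj set"
  assume "open S" "open T"
  moreover have "{v. v \<noteq> 0 \<and> proj_pt v \<in> S \<inter> T}
      = {v. v \<noteq> 0 \<and> proj_pt v \<in> S} \<inter> {v. v \<noteq> 0 \<and> proj_pt v \<in> T}"
    by auto
  ultimately show "open (S \<inter> T)"
    unfolding open_rproj_def by (simp add: open_Int)
next
  fix K :: "'a rproj set set"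
  assume "\<forall>S\<in>K. open S"
  moreover have "{v. v \<noteq> 0 \<and> proj_pt v \<in> \<Union>K} = (\<Union>S\<in>K. {v. v \<noteq> 0 \<and> proj_pt v \<in> S})"
    by auto
  ultimately show "open (\<Union>K)"
    unfolding open_rproj_def by (simp add: open_UN)
qed

end

text \<open>
  The affine chart of \<open>a \<noteq> 0\<close> is the complement of the projective hyperplane \<open>a\<^sup>\<bottom>\<close>. It is
  identified with the affine hyperplane \<open>{v. a \<bullet> v = 1}\<close>, from which it takes its notions of
  convexity, segment, boundedness and length.
\<close>

definition affine_chart :: "real^'n \<Rightarrow> ('n::finite) rproj set" where
  "affine_chart a = {L. \<exists>v\<in>line_of L. a \<bullet> v \<noteq> 0}"

definition chart_coord :: "real^'n \<Rightarrow> ('n::finite) rproj \<Rightarrow> real^'n" where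
  "chart_coord a L = (THE v. v \<in> line_of L \<and> a \<bullet> v = 1)"

definition proj_line :: "('n::finite) rproj \<Rightarrow> 'n rproj \<Rightarrow> 'n rproj set" where
  "proj_line x y = {z. line_of z \<subseteq> span (line_of x \<union> line_of y)}"

text \<open>
  \<open>PGL_d(R)\<close> acts faithfully on \<open>P(R^d)\<close>; its elements are represented by the
  transformations they induce.
\<close>

definition pgl_action :: "real^'n^'n \<Rightarrow> ('n::finite) rproj \<Rightarrow> 'n rproj" where
  "pgl_action M L = rproj_of ((*v) M ` line_of L)"

definition PGL :: "(('n::finite) rproj \<Rightarrow> 'n rproj) set" where
  "PGL = {pgl_action M | M. invertible M}"


section \<open>Properly convex domains\<close>

text \<open>
  A domain is open and non-empty in \<open>P(R^d)\<close>, so its dimension is \<open>d - 1\<close>.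
\<close>

definition properly_convex_domain :: "('n::finite) rproj set \<Rightarrow> bool" where
  "properly_convex_domain \<Omega> \<longleftrightarrow>
     open \<Omega> \<and> \<Omega> \<noteq> {} \<and> CARD('n) - 1 \<ge> 1 \<and>
     (\<exists>a. closure \<Omega> \<subseteq> affine_chart a \<and> bounded (chart_coord a ` \<Omega>) \<and> convex (chart_coord a ` \<Omega>))"

definition ideal_bd :: "('n::finite) rproj set \<Rightarrow> 'n rproj set" where
  "ideal_bd \<Omega> = closure \<Omega> - \<Omega>"

definition Aut :: "('n::finite) rproj set \<Rightarrow> ('n rproj \<Rightarrow> 'n rproj) set" where
  "Aut \<Omega> = {g \<in> PGL. g ` \<Omega> = \<Omega>}"

definition quasi_homogeneous :: "('n::finite) rproj set \<Rightarrow> bool" where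
  "quasi_homogeneous \<Omega> \<longleftrightarrow> (\<exists>K. compact K \<and> K \<subseteq> \<Omega> \<and> (\<Union>g\<in>Aut \<Omega>. g ` K) = \<Omega>)"

text \<open>
  For a properly convex \<open>\<Omega>\<close>, convexity of subsets of \<open>closure \<Omega>\<close> does not depend on the affine
  chart containing \<open>closure \<Omega>\<close>, so any such chart is admitted.
\<close>

definition convex_in :: "('n::finite) rproj set \<Rightarrow> 'n rproj set \<Rightarrow> bool" where
  "convex_in \<Omega> A \<longleftrightarrow>
     A \<subseteq> closure \<Omega> \<and> (\<exists>a. closure \<Omega> \<subseteq> affine_chart a \<and> convex (chart_coord a ` A))"

definition CH :: "('n::finite) rproj set \<Rightarrow> 'n rproj set \<Rightarrow> 'n rproj set" where
  "CH \<Omega> X = \<Inter>{A. convex_in \<Omega> A \<and> X \<subseteq> A}"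


section \<open>The Hilbert metric\<close>

text \<open>
  In the chart of \<open>a\<close>, the line through \<open>x\<close> and \<open>y\<close> meets \<open>closure \<Omega>\<close> in the segment from
  \<open>p\<close> to \<open>q\<close>, and the four points are ordered \<open>p, x, y, q\<close>.
\<close>

definition hilbert_endpoints ::
  "('n::finite) rproj set \<Rightarrow> real^'n \<Rightarrow> 'n rproj \<Rightarrow> 'n rproj \<Rightarrow> 'n rproj \<Rightarrow> 'n rproj \<Rightarrow> bool" where
  "hilbert_endpoints \<Omega> a x y p q \<longleftrightarrow>
     closure \<Omega> \<subseteq> affine_chart a \<and> p \<in> ideal_bd \<Omega> \<and> q \<in> ideal_bd \<Omega> \<and>
     chart_coord a ` (proj_line x y \<inter> closure \<Omega>) = closed_segment (chart_coord a p) (chart_coord a q) \<and>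
     chart_coord a x \<in> closed_segment (chart_coord a p) (chart_coord a y) \<and>
     chart_coord a y \<in> closed_segment (chart_coord a x) (chart_coord a q)"

text \<open>
  The endpoints \<open>p\<close>, \<open>q\<close> and, being a cross-ratio, the argument of the logarithm do not depend
  on the chart, so for distinct points of a properly convex \<open>\<Omega>\<close> the description below
  determines a unique number.
\<close>

definition hilbert_dist :: "('n::finite) rproj set \<Rightarrow> 'n rproj \<Rightarrow> 'n rproj \<Rightarrow> real" where
  "hilbert_dist \<Omega> x y =
     (if x = y then 0
      else THE t. \<exists>a p q. hilbert_endpoints \<Omega> a x y p q \<and>
        t = 1/2 * ln ((norm (chart_coord a y - chart_coord a p) * norm (chart_coord a x - chart_coord a q)) /
                      (norm (chart_coord a x - chart_coord a p) * norm (chart_coord a y - chart_coord a q))))"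

text \<open>The supremum of the empty set is \<open>0\<close> in \<^typ>\<open>ennreal\<close>.\<close>

definition hilbert_diam :: "('n::finite) rproj set \<Rightarrow> 'n rproj set \<Rightarrow> ennreal" where
  "hilbert_diam \<Omega> A = (SUP x\<in>A. SUP y\<in>A. ennreal (hilbert_dist \<Omega> x y))"

text \<open>Only meant for \<open>\<delta> \<ge> 0\<close> and non-empty \<open>C \<subseteq> \<Omega>\<close>.\<close>

definition nbhd :: "('n::finite) rproj set \<Rightarrow> real \<Rightarrow> 'n rproj set \<Rightarrow> 'n rproj set" where
  "nbhd \<Omega> \<delta> C = (if \<delta> = 0 then C else {x\<in>\<Omega>. (INF c\<in>C. hilbert_dist \<Omega> x c) < \<delta>})"


section \<open>Centroids, generic tuples and properly embedded simplices\<close>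

text \<open>A tuple \<open>(x_0, \<dots>, x_k)\<close> is given by the values of \<open>x :: nat \<Rightarrow> _\<close> on \<open>{0..k}\<close>.\<close>

definition centroid ::
  "('n::finite) rproj set \<Rightarrow> real \<Rightarrow> nat \<Rightarrow> (nat \<Rightarrow> 'n rproj) \<Rightarrow> 'n rproj set" where
  "centroid \<Omega> \<delta> k x = (\<Inter>i\<in>{0..k}. nbhd \<Omega> \<delta> (CH \<Omega> (x ` ({0..k} - {i}))))"

definition generic_tuple ::
  "('n::finite) rproj set \<Rightarrow> real \<Rightarrow> real \<Rightarrow> nat \<Rightarrow> (nat \<Rightarrow> 'n rproj) \<Rightarrow> bool" where
  "generic_tuple \<Omega> \<delta> D r v \<longleftrightarrow>
     (\<forall>i\<in>{0..r+1}. v i \<in> \<Omega>) \<and>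
     (\<forall>(q::nat) (I :: nat \<Rightarrow> nat set).
        (\<forall>i\<in>{0..q}. I i \<noteq> {} \<and> I i \<subset> {0..r+1}) \<and>
        (\<Inter>i\<in>{0..q}. I i) = {} \<and>
        hilbert_diam \<Omega> (\<Inter>i\<in>{0..q}. nbhd \<Omega> \<delta> (CH \<Omega> (v ` I i))) > ennreal D
        \<longrightarrow> (\<forall>i\<in>{0..q}. card (I i) = r + 1))"

definition nondegenerate_simplex ::
  "('n::finite) rproj set \<Rightarrow> nat \<Rightarrow> (nat \<Rightarrow> 'n rproj) \<Rightarrow> bool" where
  "nondegenerate_simplex \<Omega> k v \<longleftrightarrow>
     k \<ge> 1 \<and> (\<forall>i\<in>{0..k}. v i \<in> closure \<Omega>) \<and> dim (span (\<Union>i\<in>{0..k}. line_of (v i))) = k + 1"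

definition is_PES :: "('n::finite) rproj set \<Rightarrow> nat \<Rightarrow> 'n rproj set \<Rightarrow> bool" where
  "is_PES \<Omega> k S \<longleftrightarrow>
     (\<exists>v. nondegenerate_simplex \<Omega> k v \<and> S = CH \<Omega> (v ` {0..k}) \<and>
          (\<forall>i\<in>{0..k}. v i \<in> ideal_bd \<Omega>) \<and> S \<inter> \<Omega> \<noteq> {} \<and>
          (\<forall>i\<in>{0..k}. CH \<Omega> (v ` ({0..k} - {i})) \<subseteq> ideal_bd \<Omega>))"

text \<open>
  For a properly convex domain the set below is non-empty and bounded by \<open>CARD('n) - 1\<close>, so the
  supremum may be taken in \<^typ>\<open>nat\<close>.
\<close>

definition r_PES :: "('n::finite) rproj set \<Rightarrow> nat" where
  "r_PES \<Omega> = Sup {k. \<exists>S. is_PES \<Omega> k S}"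

end

theory Submission
  imports Defs
begin

text \<open>
  Everything is read off in the open convex cone \<open>C\<close> over \<open>\<Omega>\<close>: \<open>d(x, y) \<le> \<delta>\<close> holds iff the lifts can be
  scaled so that \<open>Y \<le> X \<le> e\<^sup>2\<^sup>\<delta> Y\<close> in the order of the closed cone, which makes neighbourhoods of
  convex sets visibly convex.

  A simplex with \<open>r + 2\<close> vertices and points arbitrarily far from all its facets would, after moving
  these points into a compact set, converge to a properly embedded simplex of dimension \<open>r + 1\<close>. So
  the neighbourhoods of the facets of a uniform size cover the simplex; being convex with convex
  union, and any \<open>r + 1\<close> of them sharing a vertex, they have a common point by Klee's theorem.

  If the centroids were unbounded, they would contain longer and longer segments, which converge
  to a line with endpoints \<open>P, Q\<close> in the boundary. Choosing supporting functionals there, one finds a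
  vertex needed only near \<open>P\<close> and a vertex needed only near \<open>Q\<close>; the face of codimension two
  opposite to both still approximates the line, and together with the facets this contradicts
  genericity.
\<close>

text \<open>Lifts to the cone matter most in the limits. Vertices and endpoints drift to the
  boundary, where the Hilbert metric blows up, but the order relation \<open>near\<close> is a
  closed condition that survives there and turns back into a distance as soon as the limiting points
  lie in \<open>C\<close>. A limit only yields the limiting factor, which must be enlarged strictly
  before it holds along the sequence. Halving the radius of the centroid pays for this: radius
  \<delta>/2 means the factor exp \<delta>, genericity tests the factor exp (2 * \<delta>), and exp
  (3/2 * \<delta>) is reached in between. An automorphism controls only one point of a long segment.
  The lifts of the endpoints are therefore scaled so that their sum is roughly the midpoint; once
  this sum is moved into \<open>K\<close>, both endpoints must escape to the boundary. Such limits
  need \<delta> in a bounded interval, so the bound obtained is uniform only below a given \<delta>.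
  This is why \<Psi> is a supremum over all smaller parameters, which also makes it monotone by
  construction.\<close>

lemma subsequence_family:
  fixes f :: "'i \<Rightarrow> nat \<Rightarrow> 'a::heine_borel"
  assumes "finite I" "\<And>i. i \<in> I \<Longrightarrow> bounded (range (f i))"
  shows "\<exists>l \<rho>. strict_mono (\<rho> :: nat \<Rightarrow> nat) \<and> (\<forall>i\<in>I. (\<lambda>n. f i (\<rho> n)) \<longlonglongrightarrow> l i)"
  using assms
proof (induction I rule: finite_induct)
  case empty
  show ?case by (rule exI, rule exI[of _ id]) (auto simp: strict_mono_def)
next
  case (insert j I)
  then obtain l \<rho> where \<rho>: "strict_mono (\<rho> :: nat \<Rightarrow> nat)"
      and l: "\<And>i. i \<in> I \<Longrightarrow> (\<lambda>n. f i (\<rho> n)) \<longlonglongrightarrow> l i"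
    by auto
  have "bounded (range (f j \<circ> \<rho>))"
    by (rule bounded_subset[of "range (f j)"]) (use insert.prems in auto)
  then obtain b \<sigma> where \<sigma>: "strict_mono (\<sigma> :: nat \<Rightarrow> nat)" and b: "((f j \<circ> \<rho>) \<circ> \<sigma>) \<longlonglongrightarrow> b"
    using bounded_imp_convergent_subsequence[of "f j \<circ> \<rho>"] by blast
  have "(\<lambda>n. f i ((\<rho> \<circ> \<sigma>) n)) \<longlonglongrightarrow> (l(j := b)) i" if "i \<in> insert j I" for i
    using that b LIMSEQ_subseq_LIMSEQ[OF l \<sigma>] by (cases "i = j") (auto simp: comp_def)
  moreover have "strict_mono (\<rho> \<circ> \<sigma>)"
    using \<rho> \<sigma> by (rule strict_mono_o)
  ultimately show ?case by blast
qed

text \<open>Induction: separate one of the sets strictly from the intersection of the others and cut the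
  others with the separating hyperplane.\<close>

lemma klee_intersection:
  fixes A :: "'i \<Rightarrow> 'a::euclidean_space set"
  assumes "finite I" "I \<noteq> {}"
    and "\<And>i. i \<in> I \<Longrightarrow> compact (A i)" "\<And>i. i \<in> I \<Longrightarrow> convex (A i)"
    and "convex (\<Union>i\<in>I. A i)"
    and "\<And>j. j \<in> I \<Longrightarrow> (\<Union>i\<in>I. A i) \<inter> (\<Inter>i\<in>I - {j}. A i) \<noteq> {}"
  shows "(\<Inter>i\<in>I. A i) \<noteq> {}"
  using assms
proof (induction "card I" arbitrary: I A)
  case 0
  then show ?case by simp
next
  case (Suc n)
  show ?case
  proof (cases "n = 0")
    case True
    then obtain i where "I = {i}"
      using Suc.hyps(2) by (metis One_nat_def card_1_singletonE)
    then show ?thesis using Suc.prems(6)[of i] by auto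
  next
    case False
    obtain k where k: "k \<in> I" using Suc.prems(2) by blast
    define J where "J = I - {k}"
    have cardJ: "card J = n" using Suc.hyps(2) k Suc.prems(1) by (simp add: J_def)
    have finJ: "finite J" using Suc.prems(1) by (simp add: J_def)
    have neJ: "J \<noteq> {}" using cardJ False by force
    define B where "B = (\<Inter>i\<in>J. A i)"
    have IJ: "I = insert k J" "k \<notin> J" using k by (auto simp: J_def)
    show ?thesis
    proof (rule ccontr)
      assume "\<not> ?thesis"
      then have disj: "A k \<inter> B = {}" by (auto simp: IJ B_def)
      obtain j0 where j0: "j0 \<in> J" using neJ by blast
      have neAk: "A k \<noteq> {}"
        using Suc.prems(6)[of j0] j0 \<open>k \<notin> J\<close> by (auto simp: \<open>I = insert k J\<close>)
      have neB: "B \<noteq> {}"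
        using Suc.prems(6)[of k] by (auto simp: IJ B_def)
      have compB: "compact B" unfolding B_def
        using Suc.prems(3) neJ by (intro compact_Inter) (auto simp: IJ)
      have convB: "convex B" unfolding B_def
        using Suc.prems(4) by (intro convex_INT) (auto simp: IJ)
      obtain h b where hb: "\<And>x. x \<in> A k \<Longrightarrow> h \<bullet> x < b" "\<And>x. x \<in> B \<Longrightarrow> h \<bullet> x > b"
        using separating_hyperplane_compact_closed[OF Suc.prems(4)[OF k] Suc.prems(3)[OF k] neAk convB
            compact_imp_closed[OF compB] disj] by blast
      define H where "H = {x. h \<bullet> x = b}"
      have convH: "convex H" and closedH: "closed H"
        unfolding H_def by (simp_all add: convex_hyperplane closed_hyperplane)
      have "(\<Inter>i\<in>J. A i \<inter> H) \<noteq> {}"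
      proof (rule Suc.hyps(1))
        show "n = card J" "finite J" "J \<noteq> {}" using cardJ finJ neJ by auto
        show "compact (A i \<inter> H)" if "i \<in> J" for i
          using that Suc.prems(3) closedH by (auto simp: IJ intro: compact_Int_closed)
        show "convex (A i \<inter> H)" if "i \<in> J" for i
          using that Suc.prems(4) convH by (auto simp: IJ intro: convex_Int)
        have "(\<Union>i\<in>J. A i \<inter> H) = (\<Union>i\<in>I. A i) \<inter> H"
        proof -
          have "A k \<inter> H = {}" using hb(1) by (force simp: H_def)
          then show ?thesis unfolding IJ(1) by blast
        qed
        then show "convex (\<Union>i\<in>J. A i \<inter> H)"
          using Suc.prems(5) convH by (simp add: convex_Int)
        show "(\<Union>i\<in>J. A i \<inter> H) \<inter> (\<Inter>i\<in>J - {j}. A i \<inter> H) \<noteq> {}" if j: "j \<in> J" for j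
        proof -
          \<comment> \<open>A segment in the convex set \<open>W\<close> from a point of
            \<open>A k\<close> to a point of \<open>B\<close> crosses \<open>H\<close>. As
            \<open>A k\<close> misses \<open>H\<close>, the crossing point lies in some
            \<open>A i\<close> with \<open>i\<close> in \<open>J\<close>, which is what the
            induction hypothesis asks for.\<close>
          define W where "W = (\<Union>i\<in>I. A i) \<inter> (\<Inter>i\<in>J - {j}. A i)"
          have convW: "convex W" unfolding W_def
            using Suc.prems(4,5) by (intro convex_Int convex_INT) (auto simp: IJ)
          obtain y where y: "y \<in> B" using neB by blast
          then have yW: "y \<in> W" using j by (auto simp: B_def W_def IJ)
          obtain z where z: "z \<in> (\<Inter>i\<in>I - {j}. A i)" using Suc.prems(6)[of j] j by (auto simp: IJ)
          have "k \<in> I - {j}" using IJ j by auto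
          with z have zk: "z \<in> A k" by blast
          have zW: "z \<in> W" using z zk by (auto simp: W_def IJ)
          have seg: "closed_segment z y \<subseteq> W"
            using convW zW yW by (simp add: closed_segment_subset)
          have "\<exists>u\<in>closed_segment z y. h \<bullet> u = b"
          proof -
            have "connected (closed_segment z y)" by simp
            moreover have "z \<in> closed_segment z y" "y \<in> closed_segment z y" by auto
            ultimately show ?thesis
              using connected_ivt_hyperplane[of "closed_segment z y" z y h b] hb(1)[OF zk] hb(2)[OF y] by auto
          qed
          then obtain u where u: "u \<in> closed_segment z y" "h \<bullet> u = b" by blast
          then have uW: "u \<in> W" using seg by auto
          then obtain i where i: "i \<in> I" "u \<in> A i" by (auto simp: W_def)
          have "i \<noteq> k" using i u(2) hb(1)[of u] by auto
          then have "i \<in> J" using i(1) by (simp add: J_def)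
          moreover have "u \<in> H" using u(2) by (simp add: H_def)
          moreover have "u \<in> A l" if "l \<in> J - {j}" for l using uW that by (auto simp: W_def)
          ultimately have "u \<in> (\<Union>i\<in>J. A i \<inter> H)" "u \<in> (\<Inter>i\<in>J - {j}. A i \<inter> H)"
            using i(2) by auto
          then show ?thesis by blast
        qed
      qed
      then obtain u where u: "\<And>i. i \<in> J \<Longrightarrow> u \<in> A i" "\<And>i. i \<in> J \<Longrightarrow> u \<in> H" by blast
      then have "u \<in> B" "u \<in> H" using j0 by (auto simp: B_def)
      then show False using hb(2)[of u] by (simp add: H_def)
    qed
  qed
qed

text \<open>Caratheodory's reduction: the weights move along the linear relation until the first of
  them reaches zero, and that index is dropped.\<close>

lemma nonneg_comb_drop_vertex:
  fixes V :: "'i \<Rightarrow> 'a::real_vector"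
  assumes "finite I" "\<And>k. k \<in> I \<Longrightarrow> 0 \<le> l k"
    and "(\<Sum>k\<in>I. m k *\<^sub>R V k) = 0" "k0 \<in> I" "m k0 \<noteq> (0::real)"
  shows "\<exists>i\<in>I. \<exists>l'. (\<forall>k\<in>I - {i}. 0 \<le> l' k) \<and> (\<Sum>k\<in>I - {i}. l' k *\<^sub>R V k) = (\<Sum>k\<in>I. l k *\<^sub>R V k)"
proof -
  \<comment> \<open>The sign makes some coefficient of the relation positive, so that the minimum of
    the ratios below is taken over a nonempty set.\<close>
  define e where "e = (if m k0 > 0 then 1 else (-1::real))"
  define m' where "m' k = e * m k" for k
  have m0: "(\<Sum>k\<in>I. m' k *\<^sub>R V k) = 0"
    using assms(3) by (simp add: m'_def flip: scaleR_scaleR scaleR_sum_right)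
  have pos: "m' k0 > 0" using assms(5) by (auto simp: m'_def e_def)
  define J where "J = {k\<in>I. m' k > 0}"
  have finJ: "finite J" and neJ: "J \<noteq> {}" using assms(1,4) pos by (auto simp: J_def)
  define t where "t = Min ((\<lambda>k. l k / m' k) ` J)"
  have "t \<in> (\<lambda>k. l k / m' k) ` J" unfolding t_def using finJ neJ by (intro Min_in) auto
  then obtain i where i: "i \<in> J" "t = l i / m' i" by blast
  have tmin: "t \<le> l k / m' k" if "k \<in> J" for k
    unfolding t_def using finJ that by (intro Min_le) auto
  have t0: "t \<ge> 0" using i assms(2) by (auto simp: J_def)
  define l' where "l' k = l k - t * m' k" for k
  have l'0: "l' k \<ge> 0" if "k \<in> I" for k
  proof (cases "m' k > 0")
    case True
    then have "t \<le> l k / m' k" using that by (intro tmin) (auto simp: J_def)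
    then show ?thesis using True by (simp add: l'_def field_simps)
  next
    case False
    then have "t * m' k \<le> 0" using t0 by (simp add: mult_nonneg_nonpos)
    then show ?thesis using assms(2)[OF that] by (simp add: l'_def)
  qed
  have "l' i = 0" using i by (simp add: l'_def J_def)
  have iI: "i \<in> I" using i by (simp add: J_def)
  have "(\<Sum>k\<in>I. l' k *\<^sub>R V k) = (\<Sum>k\<in>I. l k *\<^sub>R V k) - t *\<^sub>R (\<Sum>k\<in>I. m' k *\<^sub>R V k)"
    by (simp add: l'_def scaleR_diff_left sum_subtractf scaleR_sum_right)
  then have "(\<Sum>k\<in>I. l' k *\<^sub>R V k) = (\<Sum>k\<in>I. l k *\<^sub>R V k)" using m0 by simp
  moreover have "(\<Sum>k\<in>I. l' k *\<^sub>R V k) = (\<Sum>k\<in>I - {i}. l' k *\<^sub>R V k)"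
    using \<open>l' i = 0\<close> iI assms(1) by (subst sum.remove[of _ i]) auto
  ultimately show ?thesis using iI l'0 by (intro bexI[of _ i] exI[of _ l']) auto
qed

section \<open>Cones spanned by finite families\<close>

text \<open>Generators are an indexed family instead of a set, so that facets keep their index when
  vertices converge and possibly collide in a limit.\<close>

definition nonneg_hull :: "'i set \<Rightarrow> ('i \<Rightarrow> 'a::real_vector) \<Rightarrow> 'a set" where
  "nonneg_hull I v = {\<Sum>k\<in>I. l k *\<^sub>R v k | l. \<forall>k\<in>I. 0 \<le> (l k :: real)}"

lemma nonneg_hullI: "(\<And>k. k \<in> I \<Longrightarrow> 0 \<le> l k) \<Longrightarrow> (\<Sum>k\<in>I. l k *\<^sub>R v k) \<in> nonneg_hull I v"
  by (auto simp: nonneg_hull_def)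

lemma nonneg_hullE:
  assumes "X \<in> nonneg_hull I v"
  obtains l where "\<And>k. k \<in> I \<Longrightarrow> 0 \<le> l k" "X = (\<Sum>k\<in>I. l k *\<^sub>R v k)"
  using assms by (auto simp: nonneg_hull_def)

lemma nonneg_hull_add:
  assumes "X \<in> nonneg_hull I v" "Y \<in> nonneg_hull I v"
  shows "X + Y \<in> nonneg_hull I v"
proof -
  obtain l where l: "\<And>k. k \<in> I \<Longrightarrow> 0 \<le> l k" "X = (\<Sum>k\<in>I. l k *\<^sub>R v k)"
    using assms(1) by (rule nonneg_hullE) blast
  obtain m where m: "\<And>k. k \<in> I \<Longrightarrow> 0 \<le> m k" "Y = (\<Sum>k\<in>I. m k *\<^sub>R v k)"
    using assms(2) by (rule nonneg_hullE) blast
  have "X + Y = (\<Sum>k\<in>I. (l k + m k) *\<^sub>R v k)"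
    by (simp add: l m scaleR_add_left sum.distrib)
  then show ?thesis using l m by (auto intro!: nonneg_hullI)
qed

lemma nonneg_hull_scaleR:
  assumes "X \<in> nonneg_hull I v" "0 \<le> t"
  shows "t *\<^sub>R X \<in> nonneg_hull I v"
proof -
  obtain l where l: "\<And>k. k \<in> I \<Longrightarrow> 0 \<le> l k" "X = (\<Sum>k\<in>I. l k *\<^sub>R v k)"
    using assms(1) by (rule nonneg_hullE) blast
  have "t *\<^sub>R X = (\<Sum>k\<in>I. (t * l k) *\<^sub>R v k)"
    by (simp add: l scaleR_sum_right)
  then show ?thesis using l assms(2) by (auto intro!: nonneg_hullI)
qed

lemma nonneg_hull_vertex:
  assumes "finite I" "k \<in> I"
  shows "v k \<in> nonneg_hull I v"
proof -
  have "v k = (\<Sum>j\<in>I. (if j = k then 1 else 0) *\<^sub>R v j)"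
    using assms by (simp add: if_distrib[of "\<lambda>x. x *\<^sub>R _"] cong: if_cong)
  then show ?thesis by (auto intro!: nonneg_hullI)
qed

lemma nonneg_hull_rescale:
  assumes "\<And>k. k \<in> I \<Longrightarrow> 0 < c k" "\<And>k. k \<in> I \<Longrightarrow> w k = c k *\<^sub>R v k"
  shows "nonneg_hull I w = nonneg_hull I v"
proof (intro equalityI subsetI)
  fix X assume "X \<in> nonneg_hull I w"
  then obtain l where l: "\<And>k. k \<in> I \<Longrightarrow> 0 \<le> l k" "X = (\<Sum>k\<in>I. l k *\<^sub>R w k)"
    by (rule nonneg_hullE) blast
  have "X = (\<Sum>k\<in>I. (l k * c k) *\<^sub>R v k)" unfolding l(2) by (intro sum.cong) (auto simp: assms)
  then show "X \<in> nonneg_hull I v"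
    using l(1) assms(1) by (auto intro!: nonneg_hullI simp: less_imp_le)
next
  fix X assume "X \<in> nonneg_hull I v"
  then obtain l where l: "\<And>k. k \<in> I \<Longrightarrow> 0 \<le> l k" "X = (\<Sum>k\<in>I. l k *\<^sub>R v k)"
    by (rule nonneg_hullE) blast
  have "l k *\<^sub>R v k = (l k / c k) *\<^sub>R w k" if "k \<in> I" for k
    using assms(1)[OF that] by (simp add: assms(2)[OF that])
  then have "X = (\<Sum>k\<in>I. (l k / c k) *\<^sub>R w k)" unfolding l(2) by (intro sum.cong) auto
  then show "X \<in> nonneg_hull I w"
    using l(1) assms(1) by (auto intro!: nonneg_hullI simp: less_imp_le)
qed

lemma linear_image_nonneg_hull:
  assumes "linear L"
  shows "L ` nonneg_hull I v = nonneg_hull I (\<lambda>k. L (v k))"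
proof -
  have L: "L (\<Sum>k\<in>I. l k *\<^sub>R v k) = (\<Sum>k\<in>I. l k *\<^sub>R L (v k))" for l
    by (simp add: linear_sum[OF assms] linear_scale[OF assms])
  show ?thesis
  proof (intro equalityI subsetI)
    fix Y assume "Y \<in> L ` nonneg_hull I v"
    then obtain X where X: "X \<in> nonneg_hull I v" "Y = L X" by blast
    obtain l where "\<And>k. k \<in> I \<Longrightarrow> 0 \<le> l k" "X = (\<Sum>k\<in>I. l k *\<^sub>R v k)"
      using X(1) by (rule nonneg_hullE) blast
    then show "Y \<in> nonneg_hull I (\<lambda>k. L (v k))" by (simp add: X(2) L nonneg_hullI)
  next
    fix Y assume "Y \<in> nonneg_hull I (\<lambda>k. L (v k))"
    then obtain l where "\<And>k. k \<in> I \<Longrightarrow> 0 \<le> l k" "Y = (\<Sum>k\<in>I. l k *\<^sub>R L (v k))"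
      by (rule nonneg_hullE) blast
    then show "Y \<in> L ` nonneg_hull I v"
      by (intro image_eqI[of _ _ "\<Sum>k\<in>I. l k *\<^sub>R v k"]) (simp_all add: L nonneg_hullI)
  qed
qed

section \<open>Proper convex cones\<close>

text \<open>\<open>C_bound\<close> carries proper convexity: the slice of height
  \<open>a \<bullet> X = 1\<close> lies in a ball of radius \<open>B\<close>. Bounded height thus
  means bounded norm, the source of every convergent subsequence below.\<close>

locale proper_cone =
  fixes C :: "'a::euclidean_space set" and a :: 'a and B :: real
  assumes open_C: "open C"
    and C_add: "X \<in> C \<Longrightarrow> Y \<in> C \<Longrightarrow> X + Y \<in> C"
    and C_scaleR: "X \<in> C \<Longrightarrow> 0 < t \<Longrightarrow> t *\<^sub>R X \<in> C"
    and C_pos: "X \<in> C \<Longrightarrow> 0 < a \<bullet> X"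
    and C_bound: "X \<in> C \<Longrightarrow> norm X \<le> B * (a \<bullet> X)"
    and C_nonempty: "C \<noteq> {}"
begin

lemma zero_notin_C: "0 \<notin> C"
  using C_pos[of 0] by auto

lemma C_subset_closure: "X \<in> C \<Longrightarrow> X \<in> closure C"
  using closure_subset by blast

lemma convex_C: "convex C"
proof (rule convexI)
  fix x y u v assume *: "x \<in> C" "y \<in> C" "0 \<le> u" "0 \<le> v" "u + v = (1::real)"
  show "u *\<^sub>R x + v *\<^sub>R y \<in> C"
  proof (cases "u = 0 \<or> v = 0")
    case True
    then show ?thesis using * by auto
  next
    case False
    then show ?thesis using * by (intro C_add C_scaleR) auto
  qed
qed

lemma closure_add: assumes "X \<in> closure C" "Y \<in> closure C" shows "X + Y \<in> closure C"
proof -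
  obtain f g where "\<And>n. f n \<in> C" "f \<longlonglongrightarrow> X" "\<And>n. g n \<in> C" "g \<longlonglongrightarrow> Y"
    using assms by (auto simp: closure_sequential)
  then show ?thesis
    unfolding closure_sequential by (intro exI[of _ "\<lambda>n. f n + g n"]) (auto intro: C_add tendsto_add)
qed

lemma closure_scaleR_pos: assumes "X \<in> closure C" "0 < t" shows "t *\<^sub>R X \<in> closure C"
proof -
  obtain f where "\<And>n. f n \<in> C" "f \<longlonglongrightarrow> X"
    using assms by (auto simp: closure_sequential)
  then show ?thesis
    unfolding closure_sequential using assms(2)
    by (intro exI[of _ "\<lambda>n. t *\<^sub>R f n"]) (auto intro: C_scaleR tendsto_intros)
qed

lemma zero_in_closure: "0 \<in> closure C"
proof -
  obtain X where X: "X \<in> C" using C_nonempty by auto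
  have "(\<lambda>n. (1 / real (Suc n)) *\<^sub>R X) \<longlonglongrightarrow> 0 *\<^sub>R X"
    by (intro tendsto_scaleR tendsto_const) (use LIMSEQ_inverse_real_of_nat in \<open>simp add: inverse_eq_divide\<close>)
  then show ?thesis
    unfolding closure_sequential
    by (intro exI[of _ "\<lambda>n. (1 / real (Suc n)) *\<^sub>R X"]) (auto intro!: C_scaleR X)
qed

lemma closure_scaleR: "X \<in> closure C \<Longrightarrow> 0 \<le> t \<Longrightarrow> t *\<^sub>R X \<in> closure C"
  using closure_scaleR_pos zero_in_closure by (cases "t = 0") auto

lemma closure_sum: "(\<And>k. k \<in> I \<Longrightarrow> f k \<in> closure C) \<Longrightarrow> (\<Sum>k\<in>I. f k) \<in> closure C"
  by (induction I rule: infinite_finite_induct) (auto simp: zero_in_closure closure_add)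

lemma convex_closure_C: "convex (closure C)"
  using convex_C by (rule convex_closure)

lemma closure_bound: assumes "X \<in> closure C" shows "norm X \<le> B * (a \<bullet> X)"
proof -
  have "closed {X. norm X \<le> B * (a \<bullet> X)}"
    by (intro closed_Collect_le continuous_intros)
  then have "closure C \<subseteq> {X. norm X \<le> B * (a \<bullet> X)}"
    using C_bound by (intro closure_minimal) auto
  then show ?thesis using assms by auto
qed

lemma B_pos: "0 < B"
proof -
  obtain X where X: "X \<in> C" using C_nonempty by auto
  have "0 < norm X" using X zero_notin_C by auto
  then have "0 < B * (a \<bullet> X)" using C_bound[OF X] by linarith
  then show ?thesis using C_pos[OF X] by (simp add: zero_less_mult_iff)
qed

lemma closure_pos: assumes "X \<in> closure C" "X \<noteq> 0" shows "0 < a \<bullet> X"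
proof -
  have "0 < norm X" using assms by simp
  then have "0 < B * (a \<bullet> X)" using closure_bound[OF assms(1)] by linarith
  then show ?thesis using B_pos by (simp add: zero_less_mult_iff)
qed

lemma closure_nonneg: "X \<in> closure C \<Longrightarrow> 0 \<le> a \<bullet> X"
  using closure_pos[of X] by (cases "X = 0") auto

text \<open>Openness absorbs the error: \<open>X\<close> is replaced by a nearby point of
  \<open>C\<close> and the difference is charged to \<open>Y\<close>. This is the standard way back
  from the closed cone to the open one.\<close>

lemma closure_add_C: assumes "X \<in> closure C" "Y \<in> C" shows "X + Y \<in> C"
proof -
  obtain e where e: "e > 0" "ball Y e \<subseteq> C" using open_C assms(2) open_contains_ball by blast
  obtain X' where X': "X' \<in> C" "dist X' X < e" using assms(1) e(1) closure_approachable by blast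
  have "Y + (X - X') \<in> ball Y e" using X'(2) by (simp add: dist_norm norm_minus_commute)
  then have "X' + (Y + (X - X')) \<in> C" by (rule C_add[OF X'(1) subsetD[OF e(2)]])
  then show ?thesis by (simp add: algebra_simps)
qed

lemma uminus_notin_closure: "X \<in> C \<Longrightarrow> - X \<notin> closure C"
  using closure_nonneg[of "- X"] C_pos[of X] by auto

text \<open>A separating hyperplane can be pushed to the origin because \<open>C\<close> is
  invariant under scaling; strict positivity on \<open>C\<close> comes from openness. For a boundary
  point \<open>Q\<close> the functional vanishes at \<open>Q\<close>.\<close>

lemma support_functional:
  assumes "Q \<notin> C"
  obtains f where "\<And>X. X \<in> C \<Longrightarrow> 0 < f \<bullet> X" "\<And>X. X \<in> closure C \<Longrightarrow> 0 \<le> f \<bullet> X" "f \<bullet> Q \<le> 0"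
proof -
  obtain f b where f: "f \<noteq> 0" "f \<bullet> Q \<le> b" "\<And>X. X \<in> C \<Longrightarrow> b \<le> f \<bullet> X"
    using separating_hyperplane_sets[of "{Q}" C] convex_C C_nonempty assms by auto
  obtain Z where Z: "Z \<in> C" using C_nonempty by auto
  have clb: "b \<le> f \<bullet> X" if "X \<in> closure C" for X
  proof -
    have "closed {X. b \<le> f \<bullet> X}" by (intro closed_Collect_le continuous_intros)
    then have "closure C \<subseteq> {X. b \<le> f \<bullet> X}" using f by (intro closure_minimal) auto
    then show ?thesis using that by auto
  qed
  then have b0: "b \<le> 0" using zero_in_closure by fastforce
  have nonneg: "0 \<le> f \<bullet> X" if X: "X \<in> closure C" for X
  proof (rule ccontr)
    assume neg: "\<not> ?thesis"
    define t where "t = (b - 1) / (f \<bullet> X)"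
    have "t \<ge> 0" using neg b0 by (simp add: t_def divide_nonpos_neg)
    then have "b \<le> f \<bullet> (t *\<^sub>R X)" using X by (intro clb closure_scaleR)
    also have "f \<bullet> (t *\<^sub>R X) = b - 1" using neg by (simp add: t_def)
    finally show False by simp
  qed
  have pos: "0 < f \<bullet> X" if X: "X \<in> C" for X
  proof -
    obtain e where e: "e > 0" "cball X e \<subseteq> C" using open_C X open_contains_cball by blast
    have "X - (e / norm f) *\<^sub>R f \<in> cball X e" using e(1) f(1) by (simp add: dist_norm)
    then have "0 \<le> f \<bullet> (X - (e / norm f) *\<^sub>R f)" using e C_subset_closure nonneg by blast
    moreover have "f \<bullet> ((e / norm f) *\<^sub>R f) > 0" using e(1) f(1) by simp
    ultimately show ?thesis by (simp add: inner_diff_right)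
  qed
  show ?thesis by (rule that[of f]) (use pos nonneg f(2) b0 in auto)
qed

section \<open>The order relation that encodes the Hilbert metric\<close>

text \<open>For points of \<open>C\<close> the least admissible \<open>T\<close> is the exponential
  of twice the Hilbert distance. The free scalar \<open>s\<close> makes the relation depend only on
  rays, and the closed cone keeps it meaningful for boundary points.\<close>

definition near :: "real \<Rightarrow> 'a \<Rightarrow> 'a \<Rightarrow> bool" where
  "near T X Y \<longleftrightarrow> (\<exists>s>0. X - s *\<^sub>R Y \<in> closure C \<and> (T * s) *\<^sub>R Y - X \<in> closure C)"

lemma nearI: "0 < s \<Longrightarrow> X - s *\<^sub>R Y \<in> closure C \<Longrightarrow> (T * s) *\<^sub>R Y - X \<in> closure C \<Longrightarrow> near T X Y"
  by (auto simp: near_def)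

lemma near_scale_right:
  assumes "near T X Y" "0 < t" shows "near T X (t *\<^sub>R Y)"
proof -
  obtain s where "s > 0" "X - s *\<^sub>R Y \<in> closure C" "(T * s) *\<^sub>R Y - X \<in> closure C"
    using assms(1) by (auto simp: near_def)
  then show ?thesis using assms(2) by (intro nearI[of "s / t"]) auto
qed

lemma near_scale_left:
  assumes "near T X Y" "0 < t" shows "near T (t *\<^sub>R X) Y"
proof -
  obtain s where s: "s > 0" "X - s *\<^sub>R Y \<in> closure C" "(T * s) *\<^sub>R Y - X \<in> closure C"
    using assms(1) by (auto simp: near_def)
  have "t *\<^sub>R (X - s *\<^sub>R Y) \<in> closure C" "t *\<^sub>R ((T * s) *\<^sub>R Y - X) \<in> closure C"
    using s assms(2) by (auto intro: closure_scaleR_pos)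
  then show ?thesis using assms(2) s(1)
    by (intro nearI[of "s * t"]) (simp_all add: algebra_simps)
qed

lemma near_scale_iff:
  assumes "0 < s" "0 < t" shows "near T (s *\<^sub>R X) (t *\<^sub>R Y) \<longleftrightarrow> near T X Y"
proof
  assume "near T (s *\<^sub>R X) (t *\<^sub>R Y)"
  then have "near T ((1/s) *\<^sub>R s *\<^sub>R X) ((1/t) *\<^sub>R t *\<^sub>R Y)"
    by (rule near_scale_right[OF near_scale_left]) (use assms in auto)
  moreover have "(1/s) *\<^sub>R s *\<^sub>R X = X" "(1/t) *\<^sub>R t *\<^sub>R Y = Y"
    using assms unfolding scaleR_scaleR by auto
  ultimately show "near T X Y" by simp
qed (auto intro!: near_scale_left near_scale_right assms)

lemma near_factor_ge_1: assumes "near T X Y" "Y \<in> C" shows "1 \<le> T"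
proof (rule ccontr)
  assume T: "\<not> ?thesis"
  obtain s where s: "s > 0" "X - s *\<^sub>R Y \<in> closure C" "(T * s) *\<^sub>R Y - X \<in> closure C"
    using assms(1) by (auto simp: near_def)
  have "- (((1 - T) * s) *\<^sub>R Y) \<in> closure C"
    using closure_add[OF s(2,3)] by (simp add: algebra_simps)
  moreover have "((1 - T) * s) *\<^sub>R Y \<in> C" using T s(1) assms(2) by (intro C_scaleR) auto
  ultimately show False using uminus_notin_closure by blast
qed

lemma near_mono: assumes "near T X Y" "Y \<in> closure C" "T \<le> T'" shows "near T' X Y"
proof -
  obtain s where s: "s > 0" "X - s *\<^sub>R Y \<in> closure C" "(T * s) *\<^sub>R Y - X \<in> closure C"
    using assms(1) by (auto simp: near_def)
  have "((T * s) *\<^sub>R Y - X) + ((T' - T) * s) *\<^sub>R Y \<in> closure C"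
    using s assms by (intro closure_add closure_scaleR) auto
  then show ?thesis using s by (intro nearI[of s]) (auto simp: algebra_simps)
qed

text \<open>A multiple of \<open>Y\<close> dominates a point of the open cone. Hence an approximant
  built from boundary vertices still lies in \<open>C\<close> when the approximated point
  does.\<close>

lemma near_imp_C: assumes "near T X Y" "X \<in> C" "0 < T" shows "Y \<in> C"
proof -
  obtain s where s: "s > 0" "(T * s) *\<^sub>R Y - X \<in> closure C"
    using assms(1) by (auto simp: near_def)
  then have "(T * s) *\<^sub>R Y \<in> C" using closure_add_C[OF s(2) assms(2)] by simp
  then have "(1 / (T * s)) *\<^sub>R (T * s) *\<^sub>R Y \<in> C" by (rule C_scaleR) (use s assms(3) in auto)
  moreover have "(1 / (T * s)) *\<^sub>R (T * s) *\<^sub>R Y = Y" using s assms(3) unfolding scaleR_scaleR by simp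
  ultimately show ?thesis by simp
qed

text \<open>Only a strictly larger factor turns both cone memberships into open conditions, which
  then pass from the limit to the sequence.\<close>

lemma eventually_near:
  assumes "near T X Y" "Y \<in> C" "T < T'" "x \<longlonglongrightarrow> X" "y \<longlonglongrightarrow> Y"
  shows "\<forall>\<^sub>F n in sequentially. near T' (x n) (y n)"
proof -
  obtain s where s: "s > 0" "X - s *\<^sub>R Y \<in> closure C" "(T * s) *\<^sub>R Y - X \<in> closure C"
    using assms(1) by (auto simp: near_def)
  have T: "1 \<le> T" using near_factor_ge_1 assms(1,2) by blast
  \<comment> \<open>Any scalar strictly between \<open>T * s / T'\<close> and \<open>s\<close> gives
    slack in both inequalities; this is one such choice.\<close>
  define s' where "s' = s * (2 * T / (T + T'))"
  have s': "0 < s'" "s' < s" "T * s < T' * s'"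
    using s(1) T assms(3) by (auto simp: s'_def field_simps)
  have "(X - s *\<^sub>R Y) + (s - s') *\<^sub>R Y \<in> C"
    using s s' assms(2) by (intro closure_add_C C_scaleR) auto
  then have 1: "X - s' *\<^sub>R Y \<in> C" by (simp add: algebra_simps)
  have "((T * s) *\<^sub>R Y - X) + (T' * s' - T * s) *\<^sub>R Y \<in> C"
    using s s' assms(2) by (intro closure_add_C C_scaleR) auto
  then have 2: "(T' * s') *\<^sub>R Y - X \<in> C" by (simp add: algebra_simps)
  have "(\<lambda>n. x n - s' *\<^sub>R y n) \<longlonglongrightarrow> X - s' *\<^sub>R Y" "(\<lambda>n. (T' * s') *\<^sub>R y n - x n) \<longlonglongrightarrow> (T' * s') *\<^sub>R Y - X"
    by (intro tendsto_intros assms)+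
  then have "\<forall>\<^sub>F n in sequentially. x n - s' *\<^sub>R y n \<in> C"
    "\<forall>\<^sub>F n in sequentially. (T' * s') *\<^sub>R y n - x n \<in> C"
    using 1 2 open_C topological_tendstoD by blast+
  then show ?thesis
    by eventually_elim (use s' C_subset_closure in \<open>auto intro: nearI[of s']\<close>)
qed

lemma C_absorbs: assumes "X \<in> C" shows "\<exists>s>0. X - s *\<^sub>R Y \<in> C"
proof -
  obtain e where e: "e > 0" "cball X e \<subseteq> C" using open_C assms open_contains_cball by blast
  define s where "s = e / (1 + norm Y)"
  have n: "1 + norm Y > 0" by (simp add: add_pos_nonneg)
  have "s * norm Y \<le> e" using e(1) n by (simp add: s_def field_simps)
  moreover have "s > 0" using e n by (simp add: s_def)
  ultimately show ?thesis using e by (intro exI[of _ s]) (auto simp: dist_norm)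
qed

lemma near_exists: assumes "X \<in> C" "Y \<in> C" shows "\<exists>T. near T X Y"
proof -
  obtain s where s: "s > 0" "X - s *\<^sub>R Y \<in> C" using C_absorbs assms by blast
  obtain t where t: "t > 0" "Y - t *\<^sub>R X \<in> C" using C_absorbs assms by blast
  have "(1/t) *\<^sub>R (Y - t *\<^sub>R X) \<in> C" using t by (intro C_scaleR) auto
  then show ?thesis using s t C_subset_closure
    by (intro exI[of _ "1 / (t * s)"] nearI[of s]) (auto simp: algebra_simps)
qed

lemma nonneg_hull_closure:
  "X \<in> nonneg_hull I v \<Longrightarrow> (\<And>k. k \<in> I \<Longrightarrow> v k \<in> closure C) \<Longrightarrow> X \<in> closure C"
  by (elim nonneg_hullE) (auto intro!: closure_sum closure_scaleR)

lemma nonneg_hull_C: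
  assumes "X \<in> nonneg_hull I v" "finite I" "\<And>k. k \<in> I \<Longrightarrow> v k \<in> C" "X \<noteq> 0"
  shows "X \<in> C"
proof -
  obtain l where l: "\<And>k. k \<in> I \<Longrightarrow> 0 \<le> l k" "X = (\<Sum>k\<in>I. l k *\<^sub>R v k)"
    using assms(1) by (rule nonneg_hullE) blast
  obtain j where j: "j \<in> I" "l j \<noteq> 0" using assms(4) l(2) sum.neutral[of I "\<lambda>k. l k *\<^sub>R v k"] by fastforce
  have "X = (\<Sum>k\<in>I - {j}. l k *\<^sub>R v k) + l j *\<^sub>R v j"
    unfolding l(2) using j assms(2) by (subst sum.remove[of _ j]) auto
  moreover have "(\<Sum>k\<in>I - {j}. l k *\<^sub>R v k) \<in> closure C"
    using l assms(3) C_subset_closure by (intro closure_sum closure_scaleR) auto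
  moreover have "l j *\<^sub>R v j \<in> C" using l(1)[OF j(1)] j assms(3) by (intro C_scaleR) auto
  ultimately show ?thesis using closure_add_C by metis
qed

text \<open>This is the convexity of neighbourhoods: with a common factor \<open>T\<close> the two
  pairs of inequalities simply add, and the scalars \<open>s1\<close>, \<open>s2\<close> disappear
  into the hull.\<close>

lemma near_hull_add:
  assumes "\<exists>Y\<in>nonneg_hull I v. near T X1 Y" "\<exists>Y\<in>nonneg_hull I v. near T X2 Y"
  shows "\<exists>Y\<in>nonneg_hull I v. near T (X1 + X2) Y"
proof -
  obtain Y1 s1 where 1: "Y1 \<in> nonneg_hull I v" "s1 > 0" "X1 - s1 *\<^sub>R Y1 \<in> closure C" "(T * s1) *\<^sub>R Y1 - X1 \<in> closure C"
    using assms(1) by (auto simp: near_def)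
  obtain Y2 s2 where 2: "Y2 \<in> nonneg_hull I v" "s2 > 0" "X2 - s2 *\<^sub>R Y2 \<in> closure C" "(T * s2) *\<^sub>R Y2 - X2 \<in> closure C"
    using assms(2) by (auto simp: near_def)
  have "near T (X1 + X2) (s1 *\<^sub>R Y1 + s2 *\<^sub>R Y2)"
    using closure_add[OF 1(3) 2(3)] closure_add[OF 1(4) 2(4)]
    by (intro nearI[of 1]) (simp_all add: algebra_simps)
  moreover have "s1 *\<^sub>R Y1 + s2 *\<^sub>R Y2 \<in> nonneg_hull I v"
    using nonneg_hull_add[OF nonneg_hull_scaleR[OF 1(1)] nonneg_hull_scaleR[OF 2(1)]] 1(2) 2(2) by simp
  ultimately show ?thesis by (rule bexI)
qed

lemma near_hull_scale:
  assumes "\<exists>Y\<in>nonneg_hull I v. near T X Y" "0 < t"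
  shows "\<exists>Y\<in>nonneg_hull I v. near T (t *\<^sub>R X) Y"
proof -
  obtain Y where "Y \<in> nonneg_hull I v" "near T X Y" using assms(1) by (rule bexE)
  then show ?thesis using near_scale_left[OF _ assms(2)] by (intro bexI[of _ Y])
qed

section \<open>Automorphisms, limits and closed hulls\<close>

definition automorphism :: "('a \<Rightarrow> 'a) \<Rightarrow> bool" where
  "automorphism L \<longleftrightarrow> linear L \<and> inj L \<and> L ` C = C"

lemma automorphism_C: "automorphism L \<Longrightarrow> L X \<in> C \<longleftrightarrow> X \<in> C"
  using inj_image_mem_iff[of L X C] by (simp add: automorphism_def)

lemma automorphism_closure: assumes "automorphism L" shows "L X \<in> closure C \<longleftrightarrow> X \<in> closure C"
proof -
  have "L ` closure C = closure C"
    using closure_injective_linear_image[of L C] assms by (simp add: automorphism_def)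
  then show ?thesis using inj_image_mem_iff[of L X "closure C"] assms by (simp add: automorphism_def)
qed

lemma automorphism_near: assumes "automorphism L" shows "near T (L X) (L Y) \<longleftrightarrow> near T X Y"
proof -
  have lin: "linear L" using assms by (simp add: automorphism_def)
  have "L X - s *\<^sub>R L Y = L (X - s *\<^sub>R Y)" "t *\<^sub>R L Y - L X = L (t *\<^sub>R Y - X)" for s t
    by (simp_all add: linear_diff[OF lin] linear_scale[OF lin])
  then show ?thesis by (simp add: near_def automorphism_closure[OF assms])
qed

lemma eventually_in_C: "x \<longlonglongrightarrow> X \<Longrightarrow> X \<in> C \<Longrightarrow> \<forall>\<^sub>F n in sequentially. x n \<in> C"
  using open_C topological_tendstoD by blast

lemma closure_limit: "x \<longlonglongrightarrow> X \<Longrightarrow> (\<And>n. x n \<in> closure C) \<Longrightarrow> X \<in> closure C"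
  using closed_sequentially[of "closure C"] by auto

text \<open>All terms have nonnegative height, so none exceeds the sum. For vertices of height 1 a
  bound on the combination therefore bounds every weight.\<close>

lemma weight_le_height:
  assumes "finite I" "\<And>k. k \<in> I \<Longrightarrow> 0 \<le> l k" "\<And>k. k \<in> I \<Longrightarrow> v k \<in> closure C" "j \<in> I"
  shows "l j * (a \<bullet> v j) \<le> a \<bullet> (\<Sum>k\<in>I. l k *\<^sub>R v k)"
proof -
  have "l j * (a \<bullet> v j) \<le> (\<Sum>k\<in>I. l k * (a \<bullet> v k))"
    using assms by (intro member_le_sum) (auto intro!: mult_nonneg_nonneg closure_nonneg)
  then show ?thesis by (simp add: inner_sum_right)
qed

text \<open>Vertices in the open cone have positive height, so the weights of a convergent sequence
  are bounded and converge along a subsequence.\<close>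

lemma closed_nonneg_hull:
  assumes "finite I" "\<And>k. k \<in> I \<Longrightarrow> v k \<in> C"
  shows "closed (nonneg_hull I v)"
  unfolding closed_sequential_limits
proof (intro allI impI, elim conjE)
  fix x X assume x: "\<forall>n. x n \<in> nonneg_hull I v" "x \<longlonglongrightarrow> X"
  have "\<exists>l. (\<forall>k\<in>I. 0 \<le> l k) \<and> x n = (\<Sum>k\<in>I. l k *\<^sub>R v k)" for n
    using x(1) by (auto simp: nonneg_hull_def)
  then obtain l where l: "\<And>n k. k \<in> I \<Longrightarrow> 0 \<le> l n k" "\<And>n. x n = (\<Sum>k\<in>I. l n k *\<^sub>R v k)"
    by metis
  have "bounded (range x)" using x(2) by (rule convergent_imp_bounded)
  then obtain R where R: "\<And>n. norm (x n) \<le> R" by (auto simp: bounded_iff)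
  have bnd: "bounded (range (\<lambda>n. l n k))" if k: "k \<in> I" for k
  proof -
    have "norm (l n k) \<le> norm a * R / (a \<bullet> v k)" for n
    proof -
      have "l n k * (a \<bullet> v k) \<le> a \<bullet> x n"
        unfolding l(2) using assms l(1) k C_subset_closure by (intro weight_le_height) auto
      also have "\<dots> \<le> norm a * norm (x n)" by (rule norm_cauchy_schwarz)
      also have "\<dots> \<le> norm a * R" using R by (intro mult_left_mono) auto
      finally show ?thesis using C_pos[OF assms(2)[OF k]] l(1)[OF k] by (simp add: field_simps)
    qed
    then show ?thesis by (auto simp: bounded_iff)
  qed
  obtain l' \<rho> where \<rho>: "strict_mono (\<rho> :: nat \<Rightarrow> nat)" and l': "\<And>k. k \<in> I \<Longrightarrow> (\<lambda>n. l (\<rho> n) k) \<longlonglongrightarrow> l' k"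
    using subsequence_family[of I "\<lambda>k n. l n k", OF assms(1) bnd] by blast
  have "(\<lambda>n. x (\<rho> n)) \<longlonglongrightarrow> (\<Sum>k\<in>I. l' k *\<^sub>R v k)"
    unfolding l(2) by (intro tendsto_sum tendsto_scaleR l' tendsto_const)
  moreover have "(\<lambda>n. x (\<rho> n)) \<longlonglongrightarrow> X"
    using LIMSEQ_subseq_LIMSEQ[OF x(2) \<rho>] by (simp add: comp_def)
  ultimately have "X = (\<Sum>k\<in>I. l' k *\<^sub>R v k)" using LIMSEQ_unique by blast
  moreover have "0 \<le> l' k" if "k \<in> I" for k
    by (rule LIMSEQ_le_const[OF l'[OF that]]) (use l(1)[OF that] in auto)
  ultimately show "X \<in> nonneg_hull I v" by (auto intro: nonneg_hullI)
qed

text \<open>On the slice of height 1 the points near a given facet form a compact convex set. The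
  vertex \<open>v j\<close> lies in every facet except the one opposite to it, which supplies the
  partial intersections for Klee's theorem.\<close>

lemma common_near_point:
  fixes m :: nat
  assumes v: "\<And>k. k \<le> m \<Longrightarrow> v k \<in> C" and T: "1 \<le> T"
    and cover: "\<And>X. X \<in> nonneg_hull {..m} v \<Longrightarrow> X \<in> C \<Longrightarrow>
      \<exists>i\<le>m. \<exists>Y\<in>nonneg_hull ({..m} - {i}) v. near T X Y"
  shows "\<exists>X\<in>C. \<forall>i\<le>m. \<exists>Y\<in>nonneg_hull ({..m} - {i}) v. near T X Y"
proof -
  define H where "H = {X \<in> nonneg_hull {..m} v. a \<bullet> X = 1}"
  define A where "A i = {X \<in> H. \<exists>Y\<in>nonneg_hull ({..m} - {i}) v. near T X Y}" for i
  have HC: "X \<in> C" if "X \<in> H" for X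
    using that v by (intro nonneg_hull_C[of X "{..m}" v]) (auto simp: H_def)
  have convH: "convex H"
  proof (rule convexI)
    fix x y s t assume *: "x \<in> H" "y \<in> H" "0 \<le> s" "0 \<le> t" "s + t = (1::real)"
    have "s *\<^sub>R x + t *\<^sub>R y \<in> nonneg_hull {..m} v"
      using * by (auto simp: H_def intro!: nonneg_hull_add nonneg_hull_scaleR)
    then show "s *\<^sub>R x + t *\<^sub>R y \<in> H" using * by (simp add: H_def inner_add_right)
  qed
  have UA: "(\<Union>i\<in>{..m}. A i) = H"
  proof (intro equalityI subsetI)
    fix X assume X: "X \<in> H"
    then have "X \<in> nonneg_hull {..m} v" by (simp add: H_def)
    from cover[OF this HC[OF X]] show "X \<in> (\<Union>i\<in>{..m}. A i)" using X by (auto simp: A_def)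
  qed (auto simp: A_def)
  have convA: "convex (A i)" for i
  proof (rule convexI)
    fix x y s t assume *: "x \<in> A i" "y \<in> A i" "0 \<le> s" "0 \<le> t" "s + t = (1::real)"
    have xH: "s *\<^sub>R x + t *\<^sub>R y \<in> H" using convexD[OF convH] * by (simp add: A_def)
    show "s *\<^sub>R x + t *\<^sub>R y \<in> A i"
    proof (cases "s = 0 \<or> t = 0")
      case True
      then show ?thesis using * by auto
    next
      case False
      then have "s > 0" "t > 0" using * by auto
      moreover have "\<exists>Y\<in>nonneg_hull ({..m} - {i}) v. near T x Y" "\<exists>Y\<in>nonneg_hull ({..m} - {i}) v. near T y Y"
        using * by (auto simp: A_def)
      ultimately have "\<exists>Y\<in>nonneg_hull ({..m} - {i}) v. near T (s *\<^sub>R x + t *\<^sub>R y) Y"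
        by (intro near_hull_add near_hull_scale)
      then show ?thesis using xH by (simp add: A_def)
    qed
  qed
  have compA: "compact (A i)" for i
  proof -
    \<comment> \<open>Compactness of \<open>A i\<close> is obtained by projecting pairs. Absorbing
      the scalar of \<open>near\<close> into the second component leaves closed conditions, and
      \<open>X - Y\<close> in the closed cone bounds the height of \<open>Y\<close> by 1.\<close>
    define S where "S = (nonneg_hull {..m} v \<times> nonneg_hull ({..m} - {i}) v) \<inter> {p. a \<bullet> fst p = 1}
      \<inter> (\<lambda>p. fst p - snd p) -` closure C \<inter> (\<lambda>p. T *\<^sub>R snd p - fst p) -` closure C"
    have "closed (nonneg_hull {..m} v)" "closed (nonneg_hull ({..m} - {i}) v)"
      using v by (auto intro!: closed_nonneg_hull)
    then have "closed S" unfolding S_def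
      by (intro closed_Int closed_Times closed_vimage closed_closure closed_Collect_eq continuous_intros)
    moreover have "bounded S"
    proof (rule bounded_subset)
      show "S \<subseteq> cball 0 B \<times> cball 0 B"
      proof clarify
        fix X Y assume "(X, Y) \<in> S"
        then have *: "X \<in> nonneg_hull {..m} v" "Y \<in> nonneg_hull ({..m} - {i}) v" "a \<bullet> X = 1" "X - Y \<in> closure C"
          by (auto simp: S_def)
        have cl: "X \<in> closure C" "Y \<in> closure C"
          using nonneg_hull_closure[OF *(1)] nonneg_hull_closure[OF *(2)] v C_subset_closure by auto
        have "a \<bullet> Y \<le> 1" using closure_nonneg[OF *(4)] *(3) by (simp add: inner_diff_right)
        then have "B * (a \<bullet> Y) \<le> B * 1" using B_pos by (intro mult_left_mono) auto
        then show "X \<in> cball 0 B \<and> Y \<in> cball 0 B"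
          using closure_bound[OF cl(1)] closure_bound[OF cl(2)] *(3) by simp
      qed
      show "bounded (cball (0::'a) B \<times> cball (0::'a) B)" by (intro bounded_Times bounded_cball)
    qed
    ultimately have "compact S" by (simp add: compact_eq_bounded_closed)
    moreover have "A i = fst ` S"
    proof (intro equalityI subsetI)
      fix X assume "X \<in> A i"
      then obtain Y s where Y: "X \<in> H" "Y \<in> nonneg_hull ({..m} - {i}) v" "s > 0"
        "X - s *\<^sub>R Y \<in> closure C" "(T * s) *\<^sub>R Y - X \<in> closure C"
        by (auto simp: A_def near_def)
      have "s *\<^sub>R Y \<in> nonneg_hull ({..m} - {i}) v" using Y by (intro nonneg_hull_scaleR) auto
      then have "(X, s *\<^sub>R Y) \<in> S" using Y by (auto simp: S_def H_def)
      then show "X \<in> fst ` S" by force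
    next
      fix X assume "X \<in> fst ` S"
      then obtain Y where Y: "(X, Y) \<in> S" by force
      then have "near T X Y" by (intro nearI[of 1]) (auto simp: S_def)
      then show "X \<in> A i" using Y by (auto simp: A_def H_def S_def)
    qed
    ultimately show ?thesis by (simp add: compact_continuous_image continuous_on_fst)
  qed
  have "(\<Inter>i\<in>{..m}. A i) \<noteq> {}"
  proof (rule klee_intersection)
    show "convex (\<Union>i\<in>{..m}. A i)" using UA convH by simp
    show "(\<Union>i\<in>{..m}. A i) \<inter> (\<Inter>i\<in>{..m} - {j}. A i) \<noteq> {}" if j: "j \<in> {..m}" for j
    proof -
      define X where "X = (1 / (a \<bullet> v j)) *\<^sub>R v j"
      have vj: "v j \<in> C" using v j by auto
      have XH: "X \<in> H"
        unfolding H_def X_def using j C_pos[OF vj]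
        by (auto intro!: nonneg_hull_scaleR nonneg_hull_vertex)
      have XC: "X \<in> C" using HC XH by blast
      have "X \<in> A i" if "i \<in> {..m} - {j}" for i
      proof -
        have "X \<in> nonneg_hull ({..m} - {i}) v"
          unfolding X_def using that j C_pos[OF vj]
          by (auto intro!: nonneg_hull_scaleR nonneg_hull_vertex)
        moreover have "near T X X"
          using closure_scaleR[of X "T - 1"] C_subset_closure[OF XC] T
          by (intro nearI[of 1]) (auto simp: zero_in_closure algebra_simps)
        ultimately show ?thesis using XH by (auto simp: A_def)
      qed
      then show ?thesis using XH UA by auto
    qed
  qed (use compA convA in auto)
  then obtain X where "\<And>i. i \<le> m \<Longrightarrow> X \<in> A i" by blast
  then show ?thesis using HC by (auto simp: A_def)
qed

text \<open>With \<open>s0\<close> the largest scalar for which \<open>s0 *\<^sub>R Q\<close> stays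
  below \<open>P\<close>, failure of nearness means that even \<open>n * n * s0\<close> does not
  bring the multiple of \<open>Q\<close> above \<open>P\<close>. The geometric mean
  \<open>n * s0\<close> leaves a gap of order \<open>n\<close> on both sides, so
  \<open>P + c *\<^sub>R Q\<close> is roughly a midpoint.\<close>

lemma balance_scale:
  assumes "P \<in> C" "Q \<in> C" "0 < n" "\<not> near (n * n) P Q"
  shows "\<exists>c>0. n *\<^sub>R (c *\<^sub>R Q) - P \<notin> closure C \<and> (n / 2) *\<^sub>R P - c *\<^sub>R Q \<notin> closure C"
proof -
  define S where "S = {0..} \<inter> (\<lambda>s. P - s *\<^sub>R Q) -` closure C"
  have "closed S" unfolding S_def by (intro closed_Int closed_vimage closed_closure continuous_intros closed_atLeast)
  moreover have le: "s \<le> (a \<bullet> P) / (a \<bullet> Q)" if "s \<in> S" for s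
  proof -
    have "0 \<le> a \<bullet> (P - s *\<^sub>R Q)" using that by (intro closure_nonneg) (auto simp: S_def)
    then show ?thesis using C_pos[OF assms(2)] by (simp add: field_simps inner_diff_right)
  qed
  moreover have "S \<subseteq> {0..(a \<bullet> P) / (a \<bullet> Q)}" using le by (auto simp: S_def)
  ultimately have "compact S" by (metis bounded_closed_interval bounded_subset compact_eq_bounded_closed)
  obtain s1 where s1: "s1 > 0" "P - s1 *\<^sub>R Q \<in> C" using C_absorbs[OF assms(1)] by blast
  then have s1S: "s1 \<in> S" using C_subset_closure by (auto simp: S_def)
  obtain s0 where s0: "s0 \<in> S" "\<And>s. s \<in> S \<Longrightarrow> s \<le> s0"
    using compact_attains_sup[OF \<open>compact S\<close>] s1S by blast
  have s0pos: "s0 > 0" using s0(2)[OF s1S] s1 by simp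
  have Pcl: "P - s0 *\<^sub>R Q \<in> closure C" using s0(1) by (simp add: S_def)
  have "(n * n * s0) *\<^sub>R Q - P \<notin> closure C"
    using assms(4) nearI[OF s0pos Pcl] by blast
  \<comment> \<open>The factor 1/2 makes the contradiction strict: membership would admit the scalar
    \<open>2 * s0\<close>, beyond the maximum.\<close>
  moreover have "(n / 2) *\<^sub>R P - (n * s0) *\<^sub>R Q \<notin> closure C"
  proof
    assume "(n / 2) *\<^sub>R P - (n * s0) *\<^sub>R Q \<in> closure C"
    then have "(2 / n) *\<^sub>R ((n / 2) *\<^sub>R P - (n * s0) *\<^sub>R Q) \<in> closure C"
      using assms(3) by (intro closure_scaleR) auto
    also have "(2 / n) *\<^sub>R ((n / 2) *\<^sub>R P - (n * s0) *\<^sub>R Q) = P - (2 * s0) *\<^sub>R Q"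
      using assms(3) by (simp add: scaleR_diff_right)
    finally have "2 * s0 \<in> S" using s0pos by (simp add: S_def)
    then show False using s0(2)[of "2 * s0"] s0pos by simp
  qed
  ultimately show ?thesis using s0pos assms(3) by (intro exI[of _ "n * s0"]) (auto simp: mult.assoc)
qed

end

section \<open>Compactness arguments modulo automorphisms\<close>

locale cocompact_cone = proper_cone +
  fixes K :: "'a set"
  assumes compact_K: "compact K" and K_subset: "K \<subseteq> C"
    and cocompact: "X \<in> C \<Longrightarrow> \<exists>L. automorphism L \<and> L X \<in> K"
begin

lemma K_height_bound: "\<exists>R>0. \<forall>X\<in>K. a \<bullet> X \<le> R"
proof -
  obtain R where R: "\<And>X. X \<in> K \<Longrightarrow> norm X \<le> R" using compact_imp_bounded[OF compact_K] by (auto simp: bounded_iff)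
  have "a \<bullet> X \<le> \<bar>norm a * R\<bar> + 1" if "X \<in> K" for X
  proof -
    have "a \<bullet> X \<le> norm a * norm X" by (rule norm_cauchy_schwarz)
    also have "\<dots> \<le> norm a * R" using R[OF that] by (intro mult_left_mono) auto
    finally show ?thesis by linarith
  qed
  then show ?thesis by (intro exI[of _ "\<bar>norm a * R\<bar> + 1"]) auto
qed

lemma normalized_image:
  assumes "automorphism L" "\<And>k. k \<in> I \<Longrightarrow> v k \<in> C"
    and w: "\<And>k. w k = (1 / (a \<bullet> L (v k))) *\<^sub>R L (v k)"
  shows "\<And>k. k \<in> I \<Longrightarrow> w k \<in> C" "\<And>k. k \<in> I \<Longrightarrow> a \<bullet> w k = 1"
    "\<And>J. J \<subseteq> I \<Longrightarrow> nonneg_hull J w = L ` nonneg_hull J v"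
proof -
  have LC: "L (v k) \<in> C" if "k \<in> I" for k using assms automorphism_C that by blast
  note pos = C_pos[OF LC]
  show "w k \<in> C" if "k \<in> I" for k unfolding w using LC[OF that] pos[OF that] by (intro C_scaleR) auto
  show "a \<bullet> w k = 1" if "k \<in> I" for k unfolding w using pos[OF that] by simp
  show "nonneg_hull J w = L ` nonneg_hull J v" if "J \<subseteq> I" for J
  proof -
    have "nonneg_hull J w = nonneg_hull J (\<lambda>k. L (v k))"
      using that pos by (intro nonneg_hull_rescale[of J "\<lambda>k. 1 / (a \<bullet> L (v k))"]) (auto simp: w)
    then show ?thesis using assms(1) by (simp add: linear_image_nonneg_hull automorphism_def)
  qed
qed

text \<open>The hypothesis \<open>simplex\<close> excludes properly embedded simplices in the form
  in which a limit would produce them, with vertices anywhere in the closed cone. If no uniform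
  \<open>T\<close> existed, counterexamples for \<open>T = n\<close> would have such a
  limit.\<close>

lemma near_some_facet:
  fixes m :: nat
  assumes simplex: "\<And>V. (\<And>k. k \<le> m \<Longrightarrow> V k \<in> closure C \<and> V k \<noteq> 0) \<Longrightarrow>
      nonneg_hull {..m} V \<inter> C \<noteq> {} \<Longrightarrow> \<exists>i\<le>m. nonneg_hull ({..m} - {i}) V \<inter> C \<noteq> {}"
  shows "\<exists>T. \<forall>v X. (\<forall>k\<le>m. v k \<in> C) \<longrightarrow> X \<in> nonneg_hull {..m} v \<longrightarrow> X \<in> C \<longrightarrow>
      (\<exists>i\<le>m. \<exists>Y\<in>nonneg_hull ({..m} - {i}) v. near T X Y)"
proof (rule ccontr)
  assume "\<not> ?thesis"
  then have "\<forall>n::nat. \<exists>v X. (\<forall>k\<le>m. v k \<in> C) \<and> X \<in> nonneg_hull {..m} v \<and> X \<in> C \<and>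
      (\<forall>i\<le>m. \<forall>Y\<in>nonneg_hull ({..m} - {i}) v. \<not> near (real n) X Y)"
    by metis
  then obtain v X where v: "\<And>n k. k \<le> m \<Longrightarrow> v n k \<in> C" and X: "\<And>n. X n \<in> nonneg_hull {..m} (v n)"
      and XC: "\<And>n. X n \<in> C"
      and far: "\<And>n i Y. i \<le> m \<Longrightarrow> Y \<in> nonneg_hull ({..m} - {i}) (v n) \<Longrightarrow> \<not> near (real n) (X n) Y"
    by metis
  have "\<forall>n. \<exists>L. automorphism L \<and> L (X n) \<in> K" using cocompact XC by blast
  then obtain L where L: "\<And>n. automorphism (L n)" and LK: "\<And>n. L n (X n) \<in> K" by metis
  define x where "x n = L n (X n)" for n
  define w where "w n k = (1 / (a \<bullet> L n (v n k))) *\<^sub>R L n (v n k)" for n k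
  have vI: "\<And>k. k \<in> {..m} \<Longrightarrow> v n k \<in> C" for n using v by auto
  note norm_im = normalized_image[of "L n" "{..m}" "v n" "w n" for n, OF L vI w_def]
  have wC: "w n k \<in> C" and aw: "a \<bullet> w n k = 1" if "k \<le> m" for n k
    using norm_im(1,2) that by auto
  have "x n \<in> nonneg_hull {..m} (w n)" for n using norm_im(3)[of "{..m}"] X by (auto simp: x_def)
  then have "\<exists>l. (\<forall>k\<le>m. 0 \<le> l k) \<and> x n = (\<Sum>k\<le>m. l k *\<^sub>R w n k)" for n
    unfolding nonneg_hull_def by blast
  then obtain l where l: "\<And>n k. k \<le> m \<Longrightarrow> 0 \<le> l n k" "\<And>n. x n = (\<Sum>k\<le>m. l n k *\<^sub>R w n k)"
    by metis
  obtain R where R: "\<And>Z. Z \<in> K \<Longrightarrow> a \<bullet> Z \<le> R" using K_height_bound by blast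
  have bw: "bounded (range (\<lambda>n. w n k))" if "k \<in> {..m}" for k
    using C_bound[OF wC] aw that by (auto simp: bounded_iff intro!: exI[of _ B])
  obtain V \<rho>1 where \<rho>1: "strict_mono (\<rho>1 :: nat \<Rightarrow> nat)" and V1: "\<And>k. k \<le> m \<Longrightarrow> (\<lambda>n. w (\<rho>1 n) k) \<longlonglongrightarrow> V k"
    using subsequence_family[of "{..m}" "\<lambda>k n. w n k", OF _ bw] by auto
  have bl: "bounded (range (\<lambda>n. l (\<rho>1 n) k))" if k: "k \<in> {..m}" for k
  proof -
    have "\<bar>l n k\<bar> \<le> R" for n
    proof -
      have "l n k * (a \<bullet> w n k) \<le> a \<bullet> (\<Sum>k\<le>m. l n k *\<^sub>R w n k)"
        using k l wC C_subset_closure by (intro weight_le_height) auto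
      also have "\<dots> = a \<bullet> x n" by (simp add: l)
      also have "\<dots> \<le> R" using R LK by (simp add: x_def)
      finally show ?thesis using l(1)[of k n] aw[of k n] k by simp
    qed
    then show ?thesis by (auto simp: bounded_iff)
  qed
  obtain l' \<rho>2 where \<rho>2: "strict_mono (\<rho>2 :: nat \<Rightarrow> nat)" and l2: "\<And>k. k \<le> m \<Longrightarrow> (\<lambda>n. l (\<rho>1 (\<rho>2 n)) k) \<longlonglongrightarrow> l' k"
    using subsequence_family[of "{..m}" "\<lambda>k n. l (\<rho>1 n) k", OF _ bl] by auto
  define \<rho> where "\<rho> n = \<rho>1 (\<rho>2 n)" for n
  have \<rho>: "strict_mono \<rho>" using strict_mono_o[OF \<rho>1 \<rho>2] by (simp add: \<rho>_def[abs_def] comp_def)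
  have limw: "(\<lambda>n. w (\<rho> n) k) \<longlonglongrightarrow> V k" if "k \<le> m" for k
    using LIMSEQ_subseq_LIMSEQ[OF V1[OF that] \<rho>2] by (simp add: \<rho>_def comp_def)
  have liml: "(\<lambda>n. l (\<rho> n) k) \<longlonglongrightarrow> l' k" if "k \<le> m" for k
    using l2[OF that] by (simp add: \<rho>_def)
  have l'0: "0 \<le> l' k" if "k \<le> m" for k
    by (rule LIMSEQ_le_const[OF liml[OF that]]) (use l(1)[OF that] in auto)
  define x' where "x' = (\<Sum>k\<le>m. l' k *\<^sub>R V k)"
  have limx: "(\<lambda>n. x (\<rho> n)) \<longlonglongrightarrow> x'"
    unfolding l(2) x'_def by (intro tendsto_sum tendsto_scaleR limw liml) auto
  have "x' \<in> K"
    by (rule closed_sequentially[OF compact_imp_closed[OF compact_K] _ limx]) (simp add: x_def LK)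
  then have x'C: "x' \<in> C" using K_subset by blast
  have V: "V k \<in> closure C \<and> V k \<noteq> 0" if k: "k \<le> m" for k
  proof
    show "V k \<in> closure C" using closure_limit[OF limw[OF k]] wC[OF k] C_subset_closure by blast
    have "(\<lambda>n. a \<bullet> w (\<rho> n) k) \<longlonglongrightarrow> a \<bullet> V k" by (intro tendsto_inner tendsto_const limw k)
    then have "a \<bullet> V k = 1" using aw[OF k] LIMSEQ_unique by (simp add: LIMSEQ_const_iff)
    then show "V k \<noteq> 0" by auto
  qed
  have "x' \<in> nonneg_hull {..m} V" unfolding x'_def using l'0 by (intro nonneg_hullI) auto
  then obtain i Y where i: "i \<le> m" and Y: "Y \<in> nonneg_hull ({..m} - {i}) V" "Y \<in> C"
    using simplex[of V, OF V] x'C by blast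
  obtain u where u: "\<And>k. k \<in> {..m} - {i} \<Longrightarrow> 0 \<le> u k" "Y = (\<Sum>k\<in>{..m} - {i}. u k *\<^sub>R V k)"
    using Y(1) by (rule nonneg_hullE) blast
  obtain T where T: "near T x' Y" using near_exists[OF x'C Y(2)] by blast
  \<comment> \<open>The weights of the limiting facet point are reused on the moving vertices; the
    resulting points lie on the facets of the sequence and converge to \<open>Y\<close>.\<close>
  define y where "y n = (\<Sum>k\<in>{..m} - {i}. u k *\<^sub>R w n k)" for n
  have limy: "(\<lambda>n. y (\<rho> n)) \<longlonglongrightarrow> Y"
    unfolding y_def u(2) by (intro tendsto_sum tendsto_scaleR limw tendsto_const) auto
  have "\<forall>\<^sub>F n in sequentially. near (T + 1) (x (\<rho> n)) (y (\<rho> n))"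
    using eventually_near[OF T Y(2) _ limx limy] by simp
  moreover have "\<forall>\<^sub>F n in sequentially. T + 1 \<le> real n"
    using filterlim_real_sequentially by (simp add: filterlim_at_top)
  ultimately obtain n where n: "near (T + 1) (x (\<rho> n)) (y (\<rho> n))" "T + 1 \<le> real n"
    using eventually_happens'[OF _ eventually_conj] by (metis (no_types, lifting) sequentially_bot)
  have "real n \<le> real (\<rho> n)" using seq_suble[OF \<rho>, of n] by simp
  then have Tn: "T + 1 \<le> real (\<rho> n)" using n(2) by linarith
  have yh: "y (\<rho> n) \<in> nonneg_hull ({..m} - {i}) (w (\<rho> n))" unfolding y_def using u(1) by (intro nonneg_hullI) auto
  then have "y (\<rho> n) \<in> closure C" by (rule nonneg_hull_closure) (use wC C_subset_closure in auto)
  then have "near (real (\<rho> n)) (x (\<rho> n)) (y (\<rho> n))" using n(1) Tn near_mono by blast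
  moreover obtain z where z: "z \<in> nonneg_hull ({..m} - {i}) (v (\<rho> n))" "y (\<rho> n) = L (\<rho> n) z"
    using yh norm_im(3)[of "{..m} - {i}" "\<rho> n"] by auto
  ultimately have "near (real (\<rho> n)) (X (\<rho> n)) z"
    using automorphism_near[OF L] by (simp add: x_def)
  then show False using far[OF i z(1)] by blast
qed

text \<open>Let \<open>P\<close> and \<open>Q\<close> be the limits of the endpoints of ever longer segments in the centroids,
  normalised so that \<open>P + Q\<close> stays in \<open>K\<close>, and let \<open>f\<close> and \<open>g\<close> support the cone at \<open>Q\<close> and \<open>P\<close>.
  A vertex \<open>i\<close> with \<open>g = 0 < f\<close> is not needed to approximate \<open>Q\<close>, and a vertex \<open>j\<close> with
  \<open>f = 0 < g\<close> is not needed to approximate \<open>P\<close>, so that the face opposite to the edge \<open>{i, j}\<close>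
  approximates long subsegments.\<close>

lemma long_segment_limit:
  fixes m :: nat and p q :: "nat \<Rightarrow> 'a" and w :: "nat \<Rightarrow> nat \<Rightarrow> 'a"
  assumes w: "\<And>n k. k \<le> m \<Longrightarrow> w n k \<in> C" and aw: "\<And>n k. k \<le> m \<Longrightarrow> a \<bullet> w n k = 1"
    and d0: "0 < d0" and \<delta>: "\<And>n. d0 \<le> \<delta> n" "\<And>n. \<delta> n \<le> d1"
    and p: "\<And>n. p n \<in> C" and q: "\<And>n. q n \<in> C" and pqK: "\<And>n. p n + q n \<in> K"
    and nearp: "\<And>n i. i \<le> m \<Longrightarrow> \<exists>Y\<in>nonneg_hull ({..m} - {i}) (w n). near (exp (\<delta> n)) (p n) Y"
    and nearq: "\<And>n i. i \<le> m \<Longrightarrow> \<exists>Y\<in>nonneg_hull ({..m} - {i}) (w n). near (exp (\<delta> n)) (q n) Y"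
    and far1: "\<And>n. real n *\<^sub>R q n - p n \<notin> closure C"
    and far2: "\<And>n. (real n / 2) *\<^sub>R p n - q n \<notin> closure C"
    and S: "0 < (S::real)"
  shows "\<exists>n i j t. i \<le> m \<and> j \<le> m \<and> i \<noteq> j \<and> 0 < t \<and>
    (\<exists>Y\<in>nonneg_hull ({..m} - {i, j}) (w n). near (exp (3/2 * \<delta> n)) (t *\<^sub>R p n + q n) Y) \<and>
    (\<exists>Y\<in>nonneg_hull ({..m} - {i, j}) (w n). near (exp (3/2 * \<delta> n)) (p n + t *\<^sub>R q n) Y) \<and>
    \<not> near S (t *\<^sub>R p n + q n) (p n + t *\<^sub>R q n)"
proof -
  note cl = C_subset_closure
  have approx: "\<exists>l. (\<forall>k\<le>m. 0 \<le> l k) \<and> x - (\<Sum>k\<in>{..m} - {i}. l k *\<^sub>R w n k) \<in> closure C \<and>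
      exp (\<delta> n) *\<^sub>R (\<Sum>k\<in>{..m} - {i}. l k *\<^sub>R w n k) - x \<in> closure C"
    if ex: "\<exists>Y\<in>nonneg_hull ({..m} - {i}) (w n). near (exp (\<delta> n)) x Y" for n i x
  proof -
    obtain Y s where Y: "Y \<in> nonneg_hull ({..m} - {i}) (w n)" "s > 0"
      "x - s *\<^sub>R Y \<in> closure C" "(exp (\<delta> n) * s) *\<^sub>R Y - x \<in> closure C"
      using ex by (auto simp: near_def)
    have "s *\<^sub>R Y \<in> nonneg_hull ({..m} - {i}) (w n)" using Y by (intro nonneg_hull_scaleR) auto
    then obtain l where l: "\<And>k. k \<in> {..m} - {i} \<Longrightarrow> 0 \<le> l k" "s *\<^sub>R Y = (\<Sum>k\<in>{..m} - {i}. l k *\<^sub>R w n k)"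
      by (rule nonneg_hullE) blast
    have sum_eq: "(\<Sum>k\<in>{..m} - {i}. (l(i := 0)) k *\<^sub>R w n k) = s *\<^sub>R Y"
      unfolding l(2) by (intro sum.cong) auto
    show ?thesis
      using Y(3,4) l(1) unfolding scaleR_scaleR[symmetric] sum_eq[symmetric]
      by (intro exI[of _ "l(i := 0)"]) auto
  qed
  define \<Phi> where "\<Phi> x n i l \<longleftrightarrow> (\<forall>k\<le>m. 0 \<le> l k) \<and> x n - (\<Sum>k\<in>{..m} - {i}. l k *\<^sub>R w n k) \<in> closure C \<and>
      exp (\<delta> n) *\<^sub>R (\<Sum>k\<in>{..m} - {i}. l k *\<^sub>R w n k) - x n \<in> closure C" for x n i l
  have weights: "\<exists>l. \<forall>n i. i \<le> m \<longrightarrow> \<Phi> x n i (l n i)"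
    if ex: "\<And>n i. i \<le> m \<Longrightarrow> \<exists>Y\<in>nonneg_hull ({..m} - {i}) (w n). near (exp (\<delta> n)) (x n) Y" for x
  proof -
    have "\<forall>n i. \<exists>l. i \<le> m \<longrightarrow> \<Phi> x n i l" using approx[OF ex] unfolding \<Phi>_def by blast
    then show ?thesis by metis
  qed
  obtain \<nu> where "\<forall>n i. i \<le> m \<longrightarrow> \<Phi> p n i (\<nu> n i)" using weights[OF nearp] by blast
  then have \<nu>0: "\<And>n i k. i \<le> m \<Longrightarrow> k \<le> m \<Longrightarrow> 0 \<le> \<nu> n i k"
    and \<nu>lo: "\<And>n i. i \<le> m \<Longrightarrow> p n - (\<Sum>k\<in>{..m} - {i}. \<nu> n i k *\<^sub>R w n k) \<in> closure C"
    and \<nu>hi: "\<And>n i. i \<le> m \<Longrightarrow> exp (\<delta> n) *\<^sub>R (\<Sum>k\<in>{..m} - {i}. \<nu> n i k *\<^sub>R w n k) - p n \<in> closure C"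
    unfolding \<Phi>_def by blast+
  obtain \<mu> where "\<forall>n i. i \<le> m \<longrightarrow> \<Phi> q n i (\<mu> n i)" using weights[OF nearq] by blast
  then have \<mu>0: "\<And>n i k. i \<le> m \<Longrightarrow> k \<le> m \<Longrightarrow> 0 \<le> \<mu> n i k"
    and \<mu>lo: "\<And>n i. i \<le> m \<Longrightarrow> q n - (\<Sum>k\<in>{..m} - {i}. \<mu> n i k *\<^sub>R w n k) \<in> closure C"
    and \<mu>hi: "\<And>n i. i \<le> m \<Longrightarrow> exp (\<delta> n) *\<^sub>R (\<Sum>k\<in>{..m} - {i}. \<mu> n i k *\<^sub>R w n k) - q n \<in> closure C"
    unfolding \<Phi>_def by blast+
  obtain R where R: "0 < R" "\<And>Z. Z \<in> K \<Longrightarrow> a \<bullet> Z \<le> R" using K_height_bound by blast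
  have ap: "a \<bullet> p n \<le> R" and aq: "a \<bullet> q n \<le> R" for n
    using R(2)[OF pqK[of n]] C_pos[OF p[of n]] C_pos[OF q[of n]] by (auto simp: inner_add_right)
  have bX: "bounded (range x)" if "\<And>n. x n \<in> C" "\<And>n. a \<bullet> x n \<le> R" for x :: "nat \<Rightarrow> 'a"
  proof -
    have "norm (x n) \<le> B * R" for n
      using C_bound[OF that(1)[of n]] mult_left_mono[OF that(2)[of n], of B] B_pos by linarith
    then show ?thesis by (auto simp: bounded_iff)
  qed
  have bL: "bounded (range (\<lambda>n. l n k))"
    if l: "\<And>n k. k \<le> m \<Longrightarrow> 0 \<le> l n k" and x: "\<And>n. a \<bullet> x n \<le> R" and k: "k \<le> m" "k \<noteq> i"
      and lo: "\<And>n. x n - (\<Sum>k\<in>{..m} - {i}. l n k *\<^sub>R w n k) \<in> closure C"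
    for l :: "nat \<Rightarrow> nat \<Rightarrow> real" and x i k
  proof -
    have "\<bar>l n k\<bar> \<le> R" for n
    proof -
      have "l n k * (a \<bullet> w n k) \<le> a \<bullet> (\<Sum>k\<in>{..m} - {i}. l n k *\<^sub>R w n k)"
        using k l w cl by (intro weight_le_height) auto
      also have "\<dots> \<le> a \<bullet> x n" using closure_nonneg[OF lo[of n]] by (simp add: inner_diff_right)
      also have "\<dots> \<le> R" by (rule x)
      finally show ?thesis using l[OF k(1), of n] aw[OF k(1), of n] by simp
    qed
    then show ?thesis by (auto simp: bounded_iff)
  qed
  define F where "F k n = (if k \<le> m then w n k else if k = m + 1 then p n else q n)" for k n
  have bF: "bounded (range (F k))" if "k \<in> {..m + 2}" for k
  proof (cases "k \<le> m")
    case True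
    have "norm (w n k) \<le> B" for n using C_bound[OF w[OF True, of n]] aw[OF True, of n] by simp
    then show ?thesis using True by (auto simp: F_def bounded_iff)
  next
    case False
    then show ?thesis using bX[of p] bX[of q] p q ap aq by (auto simp: F_def)
  qed
  obtain F' \<rho>1 where \<rho>1: "strict_mono (\<rho>1 :: nat \<Rightarrow> nat)"
      and F': "\<And>k. k \<in> {..m + 2} \<Longrightarrow> (\<lambda>n. F k (\<rho>1 n)) \<longlonglongrightarrow> F' k"
    using subsequence_family[of "{..m + 2}" F, OF _ bF] by auto
  \<comment> \<open>One finite family collects all scalar sequences: the first index 0 stands for
    \<delta>, 1 for the weights \<nu> and 2 for \<mu>. The diagonal weights belong to the omitted
    vertex and have no upper bound, so they are replaced by 0.\<close>
  define G where "G z n = (case z of (b :: nat, i, k) \<Rightarrow>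
      if b = 0 then \<delta> n else if i = k then 0 else if b = 1 then \<nu> n i k else \<mu> n i k)" for z n
  have bG: "bounded (range (\<lambda>n. G z (\<rho>1 n)))" if z: "z \<in> {..2} \<times> {..m} \<times> {..m}" for z
  proof -
    obtain b i k where zz: "z = (b, i, k)" "i \<le> m" "k \<le> m" using z by auto
    have "\<bar>\<delta> n\<bar> \<le> d1" for n using \<delta>[of n] d0 by linarith
    then have b\<delta>: "bounded (range \<delta>)" by (auto simp: bounded_iff)
    have "bounded (range (G z))"
      using b\<delta> bL[of "\<lambda>n. \<nu> n i" p k i] bL[of "\<lambda>n. \<mu> n i" q k i] zz(2,3) \<nu>0 \<mu>0 \<nu>lo \<mu>lo ap aq
      unfolding zz(1) G_def by (cases "b = 0"; cases "i = k"; cases "b = 1") auto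
    then show ?thesis by (rule bounded_subset) auto
  qed
  obtain G' \<rho>2 where \<rho>2: "strict_mono (\<rho>2 :: nat \<Rightarrow> nat)"
      and G': "\<And>z. z \<in> {..2} \<times> {..m} \<times> {..m} \<Longrightarrow> (\<lambda>n. G z (\<rho>1 (\<rho>2 n))) \<longlonglongrightarrow> G' z"
    using subsequence_family[of "{..2} \<times> {..m} \<times> {..m}" "\<lambda>z n. G z (\<rho>1 n)", OF _ bG] by blast
  define \<rho> where "\<rho> n = \<rho>1 (\<rho>2 n)" for n
  have \<rho>: "strict_mono \<rho>" using strict_mono_o[OF \<rho>1 \<rho>2] by (simp add: \<rho>_def[abs_def] comp_def)
  have limF: "(\<lambda>n. F k (\<rho> n)) \<longlonglongrightarrow> F' k" if "k \<in> {..m + 2}" for k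
    using LIMSEQ_subseq_LIMSEQ[OF F'[OF that] \<rho>2] by (simp add: \<rho>_def comp_def)
  define W P Q D where "W k = F' k" and "P = F' (m + 1)" and "Q = F' (m + 2)" and "D = G' (0, 0, 0)" for k
  define \<Lambda> M where "\<Lambda> i k = G' (1, i, k)" and "M i k = G' (2, i, k)" for i k
  have limw: "(\<lambda>n. w (\<rho> n) k) \<longlonglongrightarrow> W k" if "k \<le> m" for k
    using limF[of k] that by (simp add: F_def W_def)
  have limp: "(\<lambda>n. p (\<rho> n)) \<longlonglongrightarrow> P" and limq: "(\<lambda>n. q (\<rho> n)) \<longlonglongrightarrow> Q"
    using limF[of "m + 1"] limF[of "m + 2"] by (simp_all add: F_def P_def Q_def)
  have lim\<delta>: "(\<lambda>n. \<delta> (\<rho> n)) \<longlonglongrightarrow> D"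
    using G'[of "(0, 0, 0)"] by (simp add: G_def D_def \<rho>_def)
  have lim\<nu>: "(\<lambda>n. \<nu> (\<rho> n) i k) \<longlonglongrightarrow> \<Lambda> i k" and lim\<mu>: "(\<lambda>n. \<mu> (\<rho> n) i k) \<longlonglongrightarrow> M i k"
    if "i \<le> m" "k \<le> m" "i \<noteq> k" for i k
    using G'[of "(1, i, k)"] G'[of "(2, i, k)"] that by (simp_all add: G_def \<Lambda>_def M_def \<rho>_def)
  have \<Lambda>0: "0 \<le> \<Lambda> i k" and M0: "0 \<le> M i k" if "i \<le> m" "k \<le> m" "i \<noteq> k" for i k
    using that \<nu>0 \<mu>0 by (auto intro!: LIMSEQ_le_const[OF lim\<nu>] LIMSEQ_le_const[OF lim\<mu>])
  have D: "d0 \<le> D" by (rule LIMSEQ_le_const[OF lim\<delta>]) (use \<delta> in auto)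
  have Wcl: "W k \<in> closure C" if "k \<le> m" for k
    using closure_limit[OF limw[OF that]] w[OF that] cl by blast
  have Pcl: "P \<in> closure C" and Qcl: "Q \<in> closure C"
    using closure_limit[OF limp] closure_limit[OF limq] p q cl by blast+
  have "P + Q \<in> K"
    by (rule closed_sequentially[OF compact_imp_closed[OF compact_K] _ tendsto_add[OF limp limq]]) (simp add: pqK)
  then have PQ: "P + Q \<in> C" using K_subset by blast
  have large: "\<forall>\<^sub>F n in sequentially. c \<le> real (\<rho> n)" for c :: real
  proof -
    have "filterlim (\<lambda>n. real (\<rho> n)) at_top sequentially"
      using filterlim_compose[OF filterlim_real_sequentially filterlim_subseq[OF \<rho>]] .
    then show ?thesis by (simp add: filterlim_at_top)
  qed
  \<comment> \<open>A limit in the open cone would dominate a positive multiple of the other limit,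
    and then so would late members of the sequence, against a gap that grows with the index.\<close>
  have notC: "X \<notin> C" if lim: "(\<lambda>n. x (\<rho> n)) \<longlonglongrightarrow> X" "(\<lambda>n. y (\<rho> n)) \<longlonglongrightarrow> Y"
      and xC: "\<And>n. x n \<in> C" and far: "\<And>n. (real n / 2) *\<^sub>R x n - y n \<notin> closure C"
    for x y :: "nat \<Rightarrow> 'a" and X Y
  proof
    assume "X \<in> C"
    then obtain s where s: "s > 0" "X - s *\<^sub>R Y \<in> C" using C_absorbs by blast
    have "(\<lambda>n. x (\<rho> n) - s *\<^sub>R y (\<rho> n)) \<longlonglongrightarrow> X - s *\<^sub>R Y" by (intro tendsto_intros lim)
    then have "\<forall>\<^sub>F n in sequentially. x (\<rho> n) - s *\<^sub>R y (\<rho> n) \<in> C \<and> 2 / s \<le> real (\<rho> n)"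
      using eventually_conj[OF eventually_in_C large] s(2) by blast
    then obtain n where n: "x (\<rho> n) - s *\<^sub>R y (\<rho> n) \<in> C" "2 / s \<le> real (\<rho> n)"
      using eventually_happens'[OF sequentially_bot] by blast
    have "(1 / s) *\<^sub>R (x (\<rho> n) - s *\<^sub>R y (\<rho> n)) + (real (\<rho> n) / 2 - 1 / s) *\<^sub>R x (\<rho> n) \<in> closure C"
      using n s(1) xC cl by (intro closure_add closure_scaleR) auto
    also have "(1 / s) *\<^sub>R (x (\<rho> n) - s *\<^sub>R y (\<rho> n)) + (real (\<rho> n) / 2 - 1 / s) *\<^sub>R x (\<rho> n)
        = (real (\<rho> n) / 2) *\<^sub>R x (\<rho> n) - y (\<rho> n)"
      using s(1) by (simp add: scaleR_diff_right scaleR_diff_left)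
    finally show False using far by blast
  qed
  have PC: "P \<notin> C" by (rule notC[OF limp limq p far2])
  have far1': "(real n / 2) *\<^sub>R q n - p n \<notin> closure C" for n
  proof
    assume "(real n / 2) *\<^sub>R q n - p n \<in> closure C"
    then have "(real n / 2) *\<^sub>R q n - p n + (real n / 2) *\<^sub>R q n \<in> closure C"
      using q cl by (intro closure_add closure_scaleR) auto
    also have "(real n / 2) *\<^sub>R q n - p n + (real n / 2) *\<^sub>R q n = real n *\<^sub>R q n - p n"
      by (simp add: algebra_simps flip: scaleR_add_left)
    finally show False using far1 by blast
  qed
  have QC: "Q \<notin> C" by (rule notC[OF limq limp q far1'])
  obtain f where f: "\<And>X. X \<in> C \<Longrightarrow> 0 < f \<bullet> X" "\<And>X. X \<in> closure C \<Longrightarrow> 0 \<le> f \<bullet> X" "f \<bullet> Q \<le> 0"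
    using support_functional[OF QC] by blast
  obtain g where g: "\<And>X. X \<in> C \<Longrightarrow> 0 < g \<bullet> X" "\<And>X. X \<in> closure C \<Longrightarrow> 0 \<le> g \<bullet> X" "g \<bullet> P \<le> 0"
    using support_functional[OF PC] by blast
  have fQ: "f \<bullet> Q = 0" and gP: "g \<bullet> P = 0" using f(2)[OF Qcl] f(3) g(2)[OF Pcl] g(3) by auto
  have fP: "0 < f \<bullet> P" and gQ: "0 < g \<bullet> Q"
    using f(1)[OF PQ] g(1)[OF PQ] fQ gP by (auto simp: inner_add_right)
  define A where "A i = (\<Sum>k\<in>{..m} - {i}. \<Lambda> i k *\<^sub>R W k)" for i
  define E where "E i = (\<Sum>k\<in>{..m} - {i}. M i k *\<^sub>R W k)" for i
  have limA: "(\<lambda>n. \<Sum>k\<in>{..m} - {i}. \<nu> (\<rho> n) i k *\<^sub>R w (\<rho> n) k) \<longlonglongrightarrow> A i"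
    and limE: "(\<lambda>n. \<Sum>k\<in>{..m} - {i}. \<mu> (\<rho> n) i k *\<^sub>R w (\<rho> n) k) \<longlonglongrightarrow> E i" if "i \<le> m" for i
    unfolding A_def E_def using that by (auto intro!: tendsto_sum tendsto_scaleR limw lim\<nu> lim\<mu>)
  have limexp: "(\<lambda>n. exp (\<delta> (\<rho> n))) \<longlonglongrightarrow> exp D" by (intro tendsto_exp lim\<delta>)
  have Alo: "P - A i \<in> closure C" and Ahi: "exp D *\<^sub>R A i - P \<in> closure C"
    and Elo: "Q - E i \<in> closure C" and Ehi: "exp D *\<^sub>R E i - Q \<in> closure C" if i: "i \<le> m" for i
    using closure_limit[OF tendsto_diff[OF limp limA[OF i]]] closure_limit[OF tendsto_diff[OF tendsto_scaleR[OF limexp limA[OF i]] limp]]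
      closure_limit[OF tendsto_diff[OF limq limE[OF i]]] closure_limit[OF tendsto_diff[OF tendsto_scaleR[OF limexp limE[OF i]] limq]]
      \<nu>lo[OF i] \<nu>hi[OF i] \<mu>lo[OF i] \<mu>hi[OF i] by blast+
  \<comment> \<open>The approximating combination dominates a multiple of \<open>X\<close>, so a
    functional that is positive at \<open>X\<close> must be positive at a vertex of positive
    weight.\<close>
  have pos_vertex: "\<exists>k\<le>m. k \<noteq> 0 \<and> 0 < l k \<and> 0 < h \<bullet> W k"
    if "0 < h \<bullet> X" and "exp D *\<^sub>R (\<Sum>k\<in>{..m} - {0}. l k *\<^sub>R W k) - X \<in> closure C"
      and h: "\<And>X. X \<in> closure C \<Longrightarrow> 0 \<le> h \<bullet> X" and l: "\<And>k. k \<le> m \<Longrightarrow> k \<noteq> 0 \<Longrightarrow> 0 \<le> l k"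
    for h X and l :: "nat \<Rightarrow> real"
  proof (rule ccontr)
    assume contra: "\<not> (\<exists>k\<le>m. k \<noteq> 0 \<and> 0 < l k \<and> 0 < h \<bullet> W k)"
    have *: "l k * (h \<bullet> W k) \<le> 0" if "k \<in> {..m} - {0}" for k
    proof -
      have "0 \<le> l k" "0 \<le> h \<bullet> W k" using that l[of k] h[OF Wcl[of k]] by auto
      moreover have "\<not> (0 < l k \<and> 0 < h \<bullet> W k)" using that contra by blast
      ultimately have "l k = 0 \<or> h \<bullet> W k = 0" by linarith
      then show ?thesis by auto
    qed
    have "h \<bullet> (\<Sum>k\<in>{..m} - {0}. l k *\<^sub>R W k) \<le> 0"
      unfolding inner_sum_right inner_scaleR_right using * by (intro sum_nonpos)
    then have "exp D * (h \<bullet> (\<Sum>k\<in>{..m} - {0}. l k *\<^sub>R W k)) \<le> 0" by (simp add: mult_nonneg_nonpos)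
    then show False using h[OF that(2)] that(1) by (simp add: inner_diff_right)
  qed
  \<comment> \<open>A combination below \<open>X\<close> has nonnegative terms under
    \<open>h\<close>, and their sum is at most \<open>h \<bullet> X = 0\<close>; hence each term is
    zero.\<close>
  have vanish: "l k * (h \<bullet> W k) = 0"
    if "h \<bullet> X = 0" and "X - (\<Sum>k\<in>{..m} - {i}. l k *\<^sub>R W k) \<in> closure C"
      and h: "\<And>X. X \<in> closure C \<Longrightarrow> 0 \<le> h \<bullet> X" and l: "\<And>k. k \<le> m \<Longrightarrow> k \<noteq> i \<Longrightarrow> 0 \<le> l k"
      and k: "k \<le> m" "k \<noteq> i"
    for h X i k and l :: "nat \<Rightarrow> real"
  proof -
    have nn: "0 \<le> l k * (h \<bullet> W k)" if "k \<in> {..m} - {i}" for k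
      using that l[of k] h[OF Wcl[of k]] by (intro mult_nonneg_nonneg) auto
    have "h \<bullet> (\<Sum>k\<in>{..m} - {i}. l k *\<^sub>R W k) \<le> 0" using h[OF that(2)] that(1) by (simp add: inner_diff_right)
    then have "(\<Sum>k\<in>{..m} - {i}. l k * (h \<bullet> W k)) \<le> 0" by (simp add: inner_sum_right)
    moreover have "l k * (h \<bullet> W k) \<le> (\<Sum>k\<in>{..m} - {i}. l k * (h \<bullet> W k))"
      using k nn by (intro member_le_sum) auto
    ultimately have "l k * (h \<bullet> W k) \<le> 0" by linarith
    moreover have "0 \<le> l k * (h \<bullet> W k)" using nn k by blast
    ultimately show ?thesis by linarith
  qed
  \<comment> \<open>The facet opposite vertex 0 is an arbitrary choice, made to find
    \<open>i\<close> and \<open>j\<close>. Approximating \<open>P\<close> there forces a used vertex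
    with \<open>f\<close> positive and \<open>g\<close> zero; approximating \<open>Q\<close> gives
    the opposite signs.\<close>
  have "\<exists>k\<le>m. k \<noteq> 0 \<and> 0 < \<Lambda> 0 k \<and> 0 < f \<bullet> W k"
    by (rule pos_vertex[OF fP Ahi[of 0, unfolded A_def] f(2)]) (simp_all add: \<Lambda>0)
  then obtain i where i: "i \<le> m" "i \<noteq> 0" "0 < \<Lambda> 0 i" "0 < f \<bullet> W i" by blast
  have "\<exists>k\<le>m. k \<noteq> 0 \<and> 0 < M 0 k \<and> 0 < g \<bullet> W k"
    by (rule pos_vertex[OF gQ Ehi[of 0, unfolded E_def] g(2)]) (simp_all add: M0)
  then obtain j where j: "j \<le> m" "j \<noteq> 0" "0 < M 0 j" "0 < g \<bullet> W j" by blast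
  have "\<Lambda> 0 i * (g \<bullet> W i) = 0"
    by (rule vanish[OF gP Alo[of 0, unfolded A_def] g(2)]) (use \<Lambda>0 i in simp_all)
  then have gWi: "g \<bullet> W i = 0" using i(3) by simp
  have "M 0 j * (f \<bullet> W j) = 0"
    by (rule vanish[OF fQ Elo[of 0, unfolded E_def] f(2)]) (use M0 j in simp_all)
  then have fWj: "f \<bullet> W j = 0" using j(3) by simp
  have ij: "i \<noteq> j" using i(4) fWj by auto
  \<comment> \<open>From here \<open>P\<close> is approximated from the facet opposite
    \<open>i\<close> and \<open>Q\<close> from the one opposite \<open>j\<close>. The weight at the
    other of the two vertices vanishes by its sign, so both approximants live on the common face
    \<open>J\<close>.\<close>
  have "\<Lambda> i j * (g \<bullet> W j) = 0"
    by (rule vanish[OF gP Alo[OF i(1), unfolded A_def] g(2)]) (use \<Lambda>0 i(1) j(1) ij in simp_all)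
  then have \<Lambda>ij: "\<Lambda> i j = 0" using j(4) by simp
  have "M j i * (f \<bullet> W i) = 0"
    by (rule vanish[OF fQ Elo[OF j(1), unfolded E_def] f(2)]) (use M0 i(1) j(1) ij in simp_all)
  then have Mji: "M j i = 0" using i(4) by simp
  define J where "J = {..m} - {i, j}"
  have AJ: "A i = (\<Sum>k\<in>J. \<Lambda> i k *\<^sub>R W k)" unfolding A_def J_def
    using \<Lambda>ij by (intro sum.mono_neutral_right) auto
  have EJ: "E j = (\<Sum>k\<in>J. M j k *\<^sub>R W k)" unfolding E_def J_def
    using Mji by (intro sum.mono_neutral_right) auto
  \<comment> \<open>As \<open>f\<close> kills \<open>Q\<close> and \<open>g\<close> kills
    \<open>P\<close>, the cross-ratio of \<open>t *\<^sub>R P + Q\<close> and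
    \<open>P + t *\<^sub>R Q\<close> measured by \<open>f\<close> and \<open>g\<close> equals
    \<open>t * t\<close>, which this \<open>t\<close> lifts above \<open>S\<close>.\<close>
  define t where "t = S + 1"
  have t: "1 \<le> t" "S < t * t" using S by (auto simp: t_def algebra_simps add_pos_nonneg)
  \<comment> \<open>Coefficients of at least 1 keep the combination above \<open>P + Q\<close>,
    hence inside \<open>C\<close>. There \<open>near_imp_C\<close> also pulls the sum of the two
    boundary approximants into \<open>C\<close>, and nearness can return to the sequence.\<close>
  have step: "\<forall>\<^sub>F n in sequentially. \<exists>Y\<in>nonneg_hull J (w (\<rho> n)).
      near (exp (3/2 * \<delta> (\<rho> n))) (c *\<^sub>R p (\<rho> n) + e *\<^sub>R q (\<rho> n)) Y"
    if ce: "1 \<le> c" "1 \<le> e" for c e :: real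
  proof -
    define y where "y = c *\<^sub>R P + e *\<^sub>R Q"
    have "((c - 1) *\<^sub>R P + (e - 1) *\<^sub>R Q) + (P + Q) \<in> C"
      using ce Pcl Qcl by (intro closure_add_C[OF _ PQ] closure_add closure_scaleR) auto
    then have yC: "y \<in> C" by (simp add: y_def algebra_simps)
    define b where "b k = c * \<Lambda> i k + e * M j k" for k
    have b0: "0 \<le> b k" if "k \<in> J" for k
      using that ce \<Lambda>0[of i k] M0[of j k] i(1) j(1) by (auto simp: b_def J_def)
    have Y: "(\<Sum>k\<in>J. b k *\<^sub>R W k) = c *\<^sub>R A i + e *\<^sub>R E j"
      by (simp add: AJ EJ b_def scaleR_add_left sum.distrib scaleR_sum_right)
    have "c *\<^sub>R (P - A i) + e *\<^sub>R (Q - E j) \<in> closure C"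
      "c *\<^sub>R (exp D *\<^sub>R A i - P) + e *\<^sub>R (exp D *\<^sub>R E j - Q) \<in> closure C"
      using ce Alo[OF i(1)] Ahi[OF i(1)] Elo[OF j(1)] Ehi[OF j(1)]
      by (auto intro!: closure_add closure_scaleR)
    then have near_y: "near (exp D) y (\<Sum>k\<in>J. b k *\<^sub>R W k)"
      unfolding Y y_def by (intro nearI[of 1]) (simp_all add: algebra_simps)
    have YC: "(\<Sum>k\<in>J. b k *\<^sub>R W k) \<in> C" using near_imp_C[OF near_y yC] by simp
    have "(\<lambda>n. \<Sum>k\<in>J. b k *\<^sub>R w (\<rho> n) k) \<longlonglongrightarrow> (\<Sum>k\<in>J. b k *\<^sub>R W k)"
      by (intro tendsto_sum tendsto_scaleR tendsto_const limw) (auto simp: J_def)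
    moreover have "(\<lambda>n. c *\<^sub>R p (\<rho> n) + e *\<^sub>R q (\<rho> n)) \<longlonglongrightarrow> y"
      unfolding y_def by (intro tendsto_intros limp limq)
    \<comment> \<open>Two strict losses are paid here: leaving the limit enlarges exp D, and the
      radii only tend to \<open>D\<close>. The lower bound \<open>0 < d0 \<le> D\<close> makes room
      for both below 3/2 times the radius.\<close>
    moreover have "exp D < exp (5/4 * D)" using D d0 by simp
    ultimately have "\<forall>\<^sub>F n in sequentially. near (exp (5/4 * D)) (c *\<^sub>R p (\<rho> n) + e *\<^sub>R q (\<rho> n))
        (\<Sum>k\<in>J. b k *\<^sub>R w (\<rho> n) k)"
      using eventually_near[OF near_y YC] by blast
    moreover have "\<forall>\<^sub>F n in sequentially. 5/4 * D < 3/2 * \<delta> (\<rho> n)"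
      by (rule order_tendstoD(1)[OF tendsto_mult[OF tendsto_const lim\<delta>]]) (use D d0 in simp)
    ultimately show ?thesis
    proof eventually_elim
      case (elim n)
      have h: "(\<Sum>k\<in>J. b k *\<^sub>R w (\<rho> n) k) \<in> nonneg_hull J (w (\<rho> n))" using b0 by (rule nonneg_hullI)
      then have "(\<Sum>k\<in>J. b k *\<^sub>R w (\<rho> n) k) \<in> closure C"
        using nonneg_hull_closure[of _ J "w (\<rho> n)"] w cl by (auto simp: J_def)
      then show ?case using near_mono[OF elim(1), of "exp (3/2 * \<delta> (\<rho> n))"] elim(2) h by auto
    qed
  qed
  have "\<forall>\<^sub>F n in sequentially. \<not> near S (t *\<^sub>R p (\<rho> n) + 1 *\<^sub>R q (\<rho> n)) (1 *\<^sub>R p (\<rho> n) + t *\<^sub>R q (\<rho> n))"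
  proof -
    define y where "y n = t *\<^sub>R p (\<rho> n) + 1 *\<^sub>R q (\<rho> n)" for n
    define z where "z n = 1 *\<^sub>R p (\<rho> n) + t *\<^sub>R q (\<rho> n)" for n
    have lim: "y \<longlonglongrightarrow> t *\<^sub>R P + 1 *\<^sub>R Q" "z \<longlonglongrightarrow> 1 *\<^sub>R P + t *\<^sub>R Q"
      unfolding y_def z_def by (intro tendsto_intros limp limq)+
    \<comment> \<open>Applying \<open>g\<close> to the lower and \<open>f\<close> to the upper
      inequality of \<open>near\<close> with factor \<open>S\<close> would make this difference
      nonpositive, whereas its limit is positive.\<close>
    have "(\<lambda>n. (f \<bullet> y n) * (g \<bullet> z n) - S * ((g \<bullet> y n) * (f \<bullet> z n)))
        \<longlonglongrightarrow> (f \<bullet> (t *\<^sub>R P + 1 *\<^sub>R Q)) * (g \<bullet> (1 *\<^sub>R P + t *\<^sub>R Q)) - S * ((g \<bullet> (t *\<^sub>R P + 1 *\<^sub>R Q)) * (f \<bullet> (1 *\<^sub>R P + t *\<^sub>R Q)))"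
      by (intro tendsto_intros lim)
    moreover have "0 < (f \<bullet> (t *\<^sub>R P + 1 *\<^sub>R Q)) * (g \<bullet> (1 *\<^sub>R P + t *\<^sub>R Q)) - S * ((g \<bullet> (t *\<^sub>R P + 1 *\<^sub>R Q)) * (f \<bullet> (1 *\<^sub>R P + t *\<^sub>R Q)))"
    proof -
      have "(t * (f \<bullet> P)) * (t * (g \<bullet> Q)) - S * ((g \<bullet> Q) * (f \<bullet> P)) = (t * t - S) * ((f \<bullet> P) * (g \<bullet> Q))"
        by (simp add: algebra_simps)
      moreover have "0 < \<dots>" using t fP gQ by simp
      ultimately show ?thesis by (simp add: inner_add_right fQ gP)
    qed
    ultimately have "\<forall>\<^sub>F n in sequentially. 0 < (f \<bullet> y n) * (g \<bullet> z n) - S * ((g \<bullet> y n) * (f \<bullet> z n))"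
      by (rule order_tendstoD(1))
    then show ?thesis
    proof eventually_elim
      case (elim n)
      show ?case
      proof
        assume "near S (t *\<^sub>R p (\<rho> n) + 1 *\<^sub>R q (\<rho> n)) (1 *\<^sub>R p (\<rho> n) + t *\<^sub>R q (\<rho> n))"
        then obtain s where s: "s > 0" "y n - s *\<^sub>R z n \<in> closure C" "(S * s) *\<^sub>R z n - y n \<in> closure C"
          unfolding near_def y_def z_def by blast
        have zcl: "z n \<in> closure C" unfolding z_def
          using t p q cl by (intro closure_add closure_scaleR) auto
        have 1: "s * (g \<bullet> z n) \<le> g \<bullet> y n" using g(2)[OF s(2)] by (simp add: inner_diff_right)
        have 2: "f \<bullet> y n \<le> S * s * (f \<bullet> z n)" using f(2)[OF s(3)] by (simp add: inner_diff_right)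
        have "(f \<bullet> y n) * (g \<bullet> z n) \<le> (S * s * (f \<bullet> z n)) * (g \<bullet> z n)"
          using 2 g(2)[OF zcl] by (rule mult_right_mono)
        also have "\<dots> = (S * (f \<bullet> z n)) * (s * (g \<bullet> z n))" by (simp add: ac_simps)
        also have "\<dots> \<le> (S * (f \<bullet> z n)) * (g \<bullet> y n)"
          using 1 S f(2)[OF zcl] by (intro mult_left_mono) auto
        finally show False using elim by (simp add: ac_simps)
      qed
    qed
  qed
  then have "\<forall>\<^sub>F n in sequentially. \<not> near S (t *\<^sub>R p (\<rho> n) + 1 *\<^sub>R q (\<rho> n)) (1 *\<^sub>R p (\<rho> n) + t *\<^sub>R q (\<rho> n)) \<and>
      (\<exists>Y\<in>nonneg_hull J (w (\<rho> n)). near (exp (3/2 * \<delta> (\<rho> n))) (t *\<^sub>R p (\<rho> n) + 1 *\<^sub>R q (\<rho> n)) Y) \<and>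
      (\<exists>Y\<in>nonneg_hull J (w (\<rho> n)). near (exp (3/2 * \<delta> (\<rho> n))) (1 *\<^sub>R p (\<rho> n) + t *\<^sub>R q (\<rho> n)) Y)"
    using step[OF t(1) order.refl] step[OF order.refl t(1)] by eventually_elim blast
  then obtain n where "\<not> near S (t *\<^sub>R p (\<rho> n) + 1 *\<^sub>R q (\<rho> n)) (1 *\<^sub>R p (\<rho> n) + t *\<^sub>R q (\<rho> n)) \<and>
      (\<exists>Y\<in>nonneg_hull J (w (\<rho> n)). near (exp (3/2 * \<delta> (\<rho> n))) (t *\<^sub>R p (\<rho> n) + 1 *\<^sub>R q (\<rho> n)) Y) \<and>
      (\<exists>Y\<in>nonneg_hull J (w (\<rho> n)). near (exp (3/2 * \<delta> (\<rho> n))) (1 *\<^sub>R p (\<rho> n) + t *\<^sub>R q (\<rho> n)) Y)"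
    using eventually_happens'[OF sequentially_bot] by blast
  then show ?thesis
    using i(1) j(1) ij t(1) unfolding J_def scaleR_one
    by (intro exI[of _ "\<rho> n"] exI[of _ i] exI[of _ j] exI[of _ t]) auto
qed

text \<open>A uniform \<open>N\<close> follows by contradiction from the limit of longer and longer
  segments. The upper bound \<open>d1\<close> keeps the radii in a compact interval, so that they
  converge too.\<close>

lemma long_segment_near_edge_opposite_face:
  fixes m :: nat
  assumes "0 < d0" "0 < (S::real)"
  shows "\<exists>N. \<forall>v \<delta> P Q. (\<forall>k\<le>m. v k \<in> C) \<longrightarrow> d0 \<le> \<delta> \<longrightarrow> \<delta> \<le> d1 \<longrightarrow> P \<in> C \<longrightarrow> Q \<in> C \<longrightarrow>
    (\<forall>i\<le>m. \<exists>Y\<in>nonneg_hull ({..m} - {i}) v. near (exp \<delta>) P Y) \<longrightarrow>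
    (\<forall>i\<le>m. \<exists>Y\<in>nonneg_hull ({..m} - {i}) v. near (exp \<delta>) Q Y) \<longrightarrow> \<not> near N P Q \<longrightarrow>
    (\<exists>i j s t. i \<le> m \<and> j \<le> m \<and> i \<noteq> j \<and> 0 < s \<and> 0 < t \<and>
      (\<exists>Y\<in>nonneg_hull ({..m} - {i, j}) v. near (exp (3/2 * \<delta>)) (s *\<^sub>R P + Q) Y) \<and>
      (\<exists>Y\<in>nonneg_hull ({..m} - {i, j}) v. near (exp (3/2 * \<delta>)) (P + t *\<^sub>R Q) Y) \<and>
      \<not> near S (s *\<^sub>R P + Q) (P + t *\<^sub>R Q))"
proof (rule ccontr)
  let ?concl = "\<lambda>v \<delta> P Q. \<exists>i j s t. i \<le> m \<and> j \<le> m \<and> i \<noteq> j \<and> 0 < s \<and> 0 < t \<and>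
      (\<exists>Y\<in>nonneg_hull ({..m} - {i, j}) v. near (exp (3/2 * \<delta>)) (s *\<^sub>R P + Q) Y) \<and>
      (\<exists>Y\<in>nonneg_hull ({..m} - {i, j}) v. near (exp (3/2 * \<delta>)) (P + t *\<^sub>R Q) Y) \<and>
      \<not> near S (s *\<^sub>R P + Q) (P + t *\<^sub>R Q)"
  \<comment> \<open>The length is a square because \<open>balance_scale\<close> splits it evenly
    between the endpoints, and \<open>Suc n\<close> makes its factor positive.\<close>
  define bad where "bad n v \<delta> P Q \<longleftrightarrow> (\<forall>k\<le>m. v k \<in> C) \<and> d0 \<le> \<delta> \<and> \<delta> \<le> d1 \<and> P \<in> C \<and> Q \<in> C \<and>
    (\<forall>i\<le>m. \<exists>Y\<in>nonneg_hull ({..m} - {i}) v. near (exp \<delta>) P Y) \<and>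
    (\<forall>i\<le>m. \<exists>Y\<in>nonneg_hull ({..m} - {i}) v. near (exp \<delta>) Q Y) \<and>
    \<not> near (real (Suc n) * real (Suc n)) P Q \<and> \<not> ?concl v \<delta> P Q" for n v \<delta> P Q
  assume contr: "\<not> ?thesis"
  have "\<exists>v \<delta> P Q. bad n v \<delta> P Q" for n
  proof (rule ccontr)
    assume none: "\<not> ?thesis"
    show False
    proof (rule notE[OF contr], intro exI[of _ "real (Suc n) * real (Suc n)"] allI impI)
      fix v \<delta> P Q
      assume "\<forall>k\<le>m. v k \<in> C" "d0 \<le> \<delta>" "\<delta> \<le> d1" "P \<in> C" "Q \<in> C"
        "\<forall>i\<le>m. \<exists>Y\<in>nonneg_hull ({..m} - {i}) v. near (exp \<delta>) P Y"
        "\<forall>i\<le>m. \<exists>Y\<in>nonneg_hull ({..m} - {i}) v. near (exp \<delta>) Q Y"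
        "\<not> near (real (Suc n) * real (Suc n)) P Q"
      note hyps = this
      show "?concl v \<delta> P Q"
      proof (rule ccontr)
        assume "\<not> ?concl v \<delta> P Q"
        with hyps have "bad n v \<delta> P Q" unfolding bad_def by (intro conjI)
        then show False using none by blast
      qed
    qed
  qed
  then have "\<forall>n. \<exists>v \<delta> P Q. bad n v \<delta> P Q" by blast
  then obtain v \<delta> P Q where bad: "\<And>n. bad n (v n) (\<delta> n) (P n) (Q n)" by metis
  then have v: "\<And>n k. k \<le> m \<Longrightarrow> v n k \<in> C" and \<delta>: "\<And>n. d0 \<le> \<delta> n" "\<And>n. \<delta> n \<le> d1"
    and P: "\<And>n. P n \<in> C" and Q: "\<And>n. Q n \<in> C"
    and nearP: "\<And>n i. i \<le> m \<Longrightarrow> \<exists>Y\<in>nonneg_hull ({..m} - {i}) (v n). near (exp (\<delta> n)) (P n) Y"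
    and nearQ: "\<And>n i. i \<le> m \<Longrightarrow> \<exists>Y\<in>nonneg_hull ({..m} - {i}) (v n). near (exp (\<delta> n)) (Q n) Y"
    and far: "\<And>n. \<not> near (real (Suc n) * real (Suc n)) (P n) (Q n)"
    and contra: "\<And>n. \<not> ?concl (v n) (\<delta> n) (P n) (Q n)"
    unfolding bad_def by blast+
  have "\<forall>n. \<exists>c>0. real (Suc n) *\<^sub>R (c *\<^sub>R Q n) - P n \<notin> closure C \<and>
      (real (Suc n) / 2) *\<^sub>R P n - c *\<^sub>R Q n \<notin> closure C"
    using balance_scale[OF P Q _ far] by simp
  then obtain c where c: "\<And>n. 0 < c n"
    and far1: "\<And>n. real (Suc n) *\<^sub>R (c n *\<^sub>R Q n) - P n \<notin> closure C"
    and far2: "\<And>n. (real (Suc n) / 2) *\<^sub>R P n - c n *\<^sub>R Q n \<notin> closure C"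
    by metis
  have cQ: "c n *\<^sub>R Q n \<in> C" for n using c Q by (rule C_scaleR[rotated])
  have "\<forall>n. \<exists>L. automorphism L \<and> L (P n + c n *\<^sub>R Q n) \<in> K" using cocompact C_add[OF P cQ] by blast
  then obtain L where L: "\<And>n. automorphism (L n)" and LK: "\<And>n. L n (P n + c n *\<^sub>R Q n) \<in> K" by metis
  have lin: "linear (L n)" for n using L by (simp add: automorphism_def)
  define p where "p n = L n (P n)" for n
  define q where "q n = L n (c n *\<^sub>R Q n)" for n
  define w where "w n k = (1 / (a \<bullet> L n (v n k))) *\<^sub>R L n (v n k)" for n k
  have vI: "\<And>k. k \<in> {..m} \<Longrightarrow> v n k \<in> C" for n using v by auto
  note norm_im = normalized_image[of "L n" "{..m}" "v n" "w n" for n, OF L vI w_def]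
  have comb: "s *\<^sub>R p n + t *\<^sub>R q n = L n (s *\<^sub>R P n + t *\<^sub>R (c n *\<^sub>R Q n))" for s t n
    by (simp add: p_def q_def linear_add[OF lin] linear_scale[OF lin])
  have transfer: "(\<exists>Y\<in>nonneg_hull J (w n). near T (L n X) Y) \<longleftrightarrow> (\<exists>Y\<in>nonneg_hull J (v n). near T X Y)"
    if "J \<subseteq> {..m}" for J n T X
    using norm_im(3)[of J n] that automorphism_near[OF L] by auto
  have cl: "L n X \<in> closure C \<longleftrightarrow> X \<in> closure C" for n X by (rule automorphism_closure[OF L])
  have "\<exists>n i j t. i \<le> m \<and> j \<le> m \<and> i \<noteq> j \<and> 0 < t \<and>
    (\<exists>Y\<in>nonneg_hull ({..m} - {i, j}) (w n). near (exp (3/2 * \<delta> n)) (t *\<^sub>R p n + q n) Y) \<and>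
    (\<exists>Y\<in>nonneg_hull ({..m} - {i, j}) (w n). near (exp (3/2 * \<delta> n)) (p n + t *\<^sub>R q n) Y) \<and>
    \<not> near S (t *\<^sub>R p n + q n) (p n + t *\<^sub>R q n)"
  proof (rule long_segment_limit[OF _ _ assms(1) \<delta>])
    show "w n k \<in> C" "a \<bullet> w n k = 1" if "k \<le> m" for n k using norm_im(1,2) that by auto
    show "p n \<in> C" "q n \<in> C" for n unfolding p_def q_def using automorphism_C[OF L] P cQ by auto
    show "p n + q n \<in> K" for n using LK[of n] by (simp add: p_def q_def linear_add[OF lin])
    show "\<exists>Y\<in>nonneg_hull ({..m} - {i}) (w n). near (exp (\<delta> n)) (p n) Y" if "i \<le> m" for n i
      unfolding p_def using transfer[of "{..m} - {i}" n] nearP[OF that] by auto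
    show "\<exists>Y\<in>nonneg_hull ({..m} - {i}) (w n). near (exp (\<delta> n)) (q n) Y" if "i \<le> m" for n i
      unfolding q_def using transfer[of "{..m} - {i}" n] near_hull_scale[OF nearQ[OF that] c] by auto
    \<comment> \<open>The gap was established for \<open>Suc n\<close>; adding a multiple of an
      endpoint transfers it to \<open>n\<close>.\<close>
    show "real n *\<^sub>R q n - p n \<notin> closure C" for n
    proof
      assume "real n *\<^sub>R q n - p n \<in> closure C"
      also have "real n *\<^sub>R q n - p n = L n (real n *\<^sub>R (c n *\<^sub>R Q n) - P n)"
        using comb[of "-1" n "real n"] by (simp only: scaleR_minus1_left) (simp add: algebra_simps)
      finally have "real n *\<^sub>R (c n *\<^sub>R Q n) - P n + c n *\<^sub>R Q n \<in> closure C"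
        using cl closure_add[OF _ C_subset_closure[OF cQ]] by blast
      then show False using far1[of n] by (simp add: algebra_simps)
    qed
    show "(real n / 2) *\<^sub>R p n - q n \<notin> closure C" for n
    proof
      assume "(real n / 2) *\<^sub>R p n - q n \<in> closure C"
      also have "(real n / 2) *\<^sub>R p n - q n = L n ((real n / 2) *\<^sub>R P n - c n *\<^sub>R Q n)"
        using comb[of "real n / 2" n "-1"] by simp
      finally have "(real n / 2) *\<^sub>R P n - c n *\<^sub>R Q n + (1/2) *\<^sub>R P n \<in> closure C"
        using cl closure_add[OF _ closure_scaleR[OF C_subset_closure[OF P]]] by auto
      also have "(real n / 2) *\<^sub>R P n - c n *\<^sub>R Q n + (1/2) *\<^sub>R P n = (real (Suc n) / 2) *\<^sub>R P n - c n *\<^sub>R Q n"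
        by (simp add: add_divide_distrib scaleR_add_left)
      finally show False using far2 by blast
    qed
  qed (rule assms(2))
  then obtain n i j t where ijt: "i \<le> m" "j \<le> m" "i \<noteq> j" "0 < t"
    and n1: "\<exists>Y\<in>nonneg_hull ({..m} - {i, j}) (w n). near (exp (3/2 * \<delta> n)) (t *\<^sub>R p n + q n) Y"
    and n2: "\<exists>Y\<in>nonneg_hull ({..m} - {i, j}) (w n). near (exp (3/2 * \<delta> n)) (p n + t *\<^sub>R q n) Y"
    and nn: "\<not> near S (t *\<^sub>R p n + q n) (p n + t *\<^sub>R q n)"
    by blast
  \<comment> \<open>Undoing the normalisation moves the balancing factor \<open>c n\<close> into the
    coefficients, which is why the two scalars of the conclusion differ although one
    \<open>t\<close> served both points.\<close>
  have y: "t *\<^sub>R p n + q n = L n (c n *\<^sub>R ((t / c n) *\<^sub>R P n + Q n))"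
    using comb[of t n 1] c[of n] by (simp add: scaleR_add_right)
  have z: "p n + t *\<^sub>R q n = L n (P n + (t * c n) *\<^sub>R Q n)"
    using comb[of 1 n t] by simp
  have sub: "{..m} - {i, j} \<subseteq> {..m}" by blast
  have "\<exists>Y\<in>nonneg_hull ({..m} - {i, j}) (v n). near (exp (3/2 * \<delta> n)) ((1 / c n) *\<^sub>R (c n *\<^sub>R ((t / c n) *\<^sub>R P n + Q n))) Y"
    by (rule near_hull_scale[OF n1[unfolded y transfer[OF sub]]]) (use c[of n] in simp)
  moreover have "(1 / c n) *\<^sub>R (c n *\<^sub>R ((t / c n) *\<^sub>R P n + Q n)) = (t / c n) *\<^sub>R P n + Q n"
    using c[of n] unfolding scaleR_scaleR by simp
  ultimately have 1: "\<exists>Y\<in>nonneg_hull ({..m} - {i, j}) (v n). near (exp (3/2 * \<delta> n)) ((t / c n) *\<^sub>R P n + Q n) Y"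
    by simp
  have 2: "\<exists>Y\<in>nonneg_hull ({..m} - {i, j}) (v n). near (exp (3/2 * \<delta> n)) (P n + (t * c n) *\<^sub>R Q n) Y"
    using n2[unfolded z transfer[OF sub]] .
  have 3: "\<not> near S ((t / c n) *\<^sub>R P n + Q n) (P n + (t * c n) *\<^sub>R Q n)"
    using nn[unfolded y z automorphism_near[OF L]] near_scale_left[OF _ c[of n]] by blast
  have "0 < t / c n" "0 < t * c n" using ijt(4) c[of n] by auto
  with ijt(1-3) 1 2 3 show False using contra[of n] by blast
qed

end

section \<open>The cone over a properly convex domain\<close>

lemma line_of_proj_pt: "v \<noteq> 0 \<Longrightarrow> line_of (proj_pt v) = span {v}"
  unfolding proj_pt_def by (rule rproj_of_inverse) (simp add: dim_singleton)

lemma proj_pt_cases: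
  obtains v where "v \<noteq> 0" "x = proj_pt v"
proof -
  have x: "subspace (line_of x)" "dim (line_of x) = 1" using line_of[of x] by auto
  obtain Bs where Bs: "Bs \<subseteq> line_of x" "independent Bs" "line_of x \<subseteq> span Bs" "card Bs = 1"
    using basis_exists[of "line_of x"] x(2) by metis
  then obtain v where v: "Bs = {v}" by (auto simp: card_1_singleton_iff)
  then have "v \<noteq> 0" using Bs(2) dependent_zero by blast
  moreover have "line_of x = span {v}"
    using Bs(1,3) v x(1) span_minimal[of Bs "line_of x"] by auto
  then have "x = proj_pt v" using calculation line_of_proj_pt line_of_inject by metis
  ultimately show ?thesis using that by blast
qed

lemma proj_pt_scaleR [simp]: "c \<noteq> 0 \<Longrightarrow> proj_pt (c *\<^sub>R v) = proj_pt v"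
  unfolding proj_pt_def using span_image_scale[of "{v}" "\<lambda>_. c"] by simp

lemma proj_pt_eq:
  assumes "v \<noteq> 0" "w \<noteq> 0" "proj_pt v = proj_pt w"
  shows "\<exists>c. c \<noteq> 0 \<and> w = c *\<^sub>R v"
proof -
  have "w \<in> span {v}" using assms line_of_proj_pt span_base by (metis singletonI)
  then obtain c where "w = c *\<^sub>R v" by (auto simp: span_singleton)
  then show ?thesis using assms(2) by auto
qed

lemma proj_pt_in_affine_chart: "v \<noteq> 0 \<Longrightarrow> proj_pt v \<in> affine_chart a \<longleftrightarrow> a \<bullet> v \<noteq> 0"
  by (auto simp: affine_chart_def line_of_proj_pt span_singleton)

lemma chart_coord_proj_pt:
  assumes "a \<bullet> v \<noteq> 0" shows "chart_coord a (proj_pt v) = (1 / (a \<bullet> v)) *\<^sub>R v"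
proof -
  have "v \<noteq> 0" using assms by auto
  then show ?thesis unfolding chart_coord_def line_of_proj_pt[OF \<open>v \<noteq> 0\<close>]
    using assms by (intro the_equality) (auto simp: span_singleton nonzero_eq_divide_eq)
qed

lemma chart_coord:
  assumes "x \<in> affine_chart a"
  shows "a \<bullet> chart_coord a x = 1" "proj_pt (chart_coord a x) = x"
proof -
  obtain v where v: "v \<noteq> 0" "x = proj_pt v" by (rule proj_pt_cases)
  then have av: "a \<bullet> v \<noteq> 0" using assms proj_pt_in_affine_chart by blast
  then show "a \<bullet> chart_coord a x = 1" "proj_pt (chart_coord a x) = x"
    by (simp_all add: v(2) chart_coord_proj_pt)
qed

lemma pgl_action_proj_pt:
  assumes "invertible M" "v \<noteq> 0"
  shows "pgl_action M (proj_pt v) = proj_pt (M *v v)"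
  unfolding pgl_action_def line_of_proj_pt[OF assms(2)] unfolding proj_pt_def
  using linear_span_image[OF matrix_vector_mul_linear, of M "{v}"] by simp

section \<open>Lifting points, closures and convex hulls\<close>

locale convex_domain =
  fixes \<Omega> :: "('n::finite) rproj set" and a :: "real^'n" and B :: real
  assumes open_\<Omega>: "open \<Omega>" and \<Omega>_nonempty: "\<Omega> \<noteq> {}"
    and chart: "closure \<Omega> \<subseteq> affine_chart a"
    and bound: "\<And>x. x \<in> \<Omega> \<Longrightarrow> norm (chart_coord a x) \<le> B"
    and convex: "convex (chart_coord a ` \<Omega>)"
begin

text \<open>The preimage of the domain in the vector space consists of two opposite sheets;
  positivity of \<open>a\<close> selects one, which is convex.\<close>

definition C :: "(real^'n) set" where
  "C = {X. 0 < a \<bullet> X \<and> proj_pt X \<in> \<Omega>}"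

lemma chart_\<Omega>: "x \<in> \<Omega> \<Longrightarrow> x \<in> affine_chart a"
  using chart closure_subset by blast

lemma chart_coord_in_C: "x \<in> \<Omega> \<Longrightarrow> chart_coord a x \<in> C"
  using chart_coord[OF chart_\<Omega>] by (simp add: C_def)

lemma C_normalize:
  assumes "X \<in> C" shows "(1 / (a \<bullet> X)) *\<^sub>R X \<in> chart_coord a ` \<Omega>"
  using assms chart_coord_proj_pt[of a X] by (intro image_eqI[of _ _ "proj_pt X"]) (auto simp: C_def)

lemma normalized_in_C:
  assumes "X \<in> chart_coord a ` \<Omega>" "0 < t" shows "t *\<^sub>R X \<in> C"
  using assms chart_coord[OF chart_\<Omega>] by (auto simp: C_def)

sublocale proper_cone C a B
proof
  have "C = {v. v \<noteq> 0 \<and> proj_pt v \<in> \<Omega>} \<inter> {v. 0 < a \<bullet> v}" by (auto simp: C_def)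
  moreover have "open {v. 0 < a \<bullet> v}" by (intro open_Collect_less continuous_intros)
  ultimately show "open C" using open_\<Omega> by (auto simp: open_rproj_def)
  show "X + Y \<in> C" if "X \<in> C" "Y \<in> C" for X Y
  proof -
    have pos: "0 < a \<bullet> X" "0 < a \<bullet> Y" using that by (auto simp: C_def)
    define c where "c = a \<bullet> X + a \<bullet> Y"
    have c: "0 < c" using pos by (simp add: c_def)
    have "(a \<bullet> X / c) *\<^sub>R ((1 / (a \<bullet> X)) *\<^sub>R X) + (a \<bullet> Y / c) *\<^sub>R ((1 / (a \<bullet> Y)) *\<^sub>R Y) \<in> chart_coord a ` \<Omega>"
    proof (intro convexD[OF convex] C_normalize that)
      show "0 \<le> a \<bullet> X / c" "0 \<le> a \<bullet> Y / c" using pos c by auto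
      show "a \<bullet> X / c + a \<bullet> Y / c = 1" using c by (simp add: c_def flip: add_divide_distrib)
    qed
    then have "c *\<^sub>R ((a \<bullet> X / c) *\<^sub>R ((1 / (a \<bullet> X)) *\<^sub>R X) + (a \<bullet> Y / c) *\<^sub>R ((1 / (a \<bullet> Y)) *\<^sub>R Y)) \<in> C"
      using c by (rule normalized_in_C)
    then show ?thesis using pos c by (simp add: scaleR_add_right)
  qed
  show "t *\<^sub>R X \<in> C" if "X \<in> C" "0 < t" for X t using that by (simp add: C_def)
  show "0 < a \<bullet> X" if "X \<in> C" for X using that by (simp add: C_def)
  show "norm X \<le> B * (a \<bullet> X)" if X: "X \<in> C" for X
  proof -
    obtain x where "x \<in> \<Omega>" "(1 / (a \<bullet> X)) *\<^sub>R X = chart_coord a x" using C_normalize[OF X] by blast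
    then have "norm ((1 / (a \<bullet> X)) *\<^sub>R X) \<le> B" using bound by metis
    then show ?thesis using X by (simp add: C_def field_simps)
  qed
  show "C \<noteq> {}" using \<Omega>_nonempty chart_coord_in_C by blast
qed

lemma proj_pt_C: "X \<in> C \<Longrightarrow> proj_pt X \<in> \<Omega>"
  by (simp add: C_def)

lemma proj_pt_closure: assumes "X \<in> closure C" "X \<noteq> 0" shows "proj_pt X \<in> closure \<Omega>"
  unfolding closure_iff_nhds_not_empty
proof (intro allI impI)
  fix S U assume "U \<subseteq> S" "open U" "proj_pt X \<in> U"
  define V where "V = {v. v \<noteq> 0 \<and> proj_pt v \<in> U}"
  have "open V" "X \<in> V" using \<open>open U\<close> \<open>proj_pt X \<in> U\<close> assms(2) by (auto simp: V_def open_rproj_def)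
  then have "V \<inter> C \<noteq> {}" using assms(1) by (meson closure_iff_nhds_not_empty order.refl disjoint_iff)
  then show "\<Omega> \<inter> S \<noteq> {}" using \<open>U \<subseteq> S\<close> by (auto simp: V_def C_def)
qed

text \<open>The projective image \<open>W\<close> of the punctured closed cone is closed in the
  quotient topology: the preimage of its complement is the complement of the closed cone and its
  negative. So \<open>W\<close> contains the closure of the domain.\<close>

lemma chart_coord_closure: assumes "x \<in> closure \<Omega>" shows "chart_coord a x \<in> closure C" "chart_coord a x \<noteq> 0"
proof -
  define W where "W = {x. \<exists>v. v \<noteq> 0 \<and> v \<in> closure C \<and> x = proj_pt v}"
  have "{v. v \<noteq> 0 \<and> proj_pt v \<in> - W} = - (closure C \<union> uminus ` closure C)"
  proof (intro equalityI subsetI)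
    fix v assume v: "v \<in> {v. v \<noteq> 0 \<and> proj_pt v \<in> - W}"
    then have "v \<notin> closure C" "- v \<notin> closure C"
      using proj_pt_scaleR[of "-1" v] by (auto simp: W_def)
    then show "v \<in> - (closure C \<union> uminus ` closure C)" by auto
  next
    fix v assume v: "v \<in> - (closure C \<union> uminus ` closure C)"
    then have v0: "v \<noteq> 0" using zero_in_closure by auto
    have "proj_pt v \<notin> W"
    proof
      assume "proj_pt v \<in> W"
      then obtain w where w: "w \<noteq> 0" "w \<in> closure C" "proj_pt v = proj_pt w" by (auto simp: W_def)
      obtain c where c: "c \<noteq> 0" "v = c *\<^sub>R w" using proj_pt_eq[of w v] w v0 by auto
      show False
      proof (cases "c > 0")
        case True
        then show ?thesis using v c closure_scaleR[OF w(2)] by auto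
      next
        case False
        then have "(- c) *\<^sub>R w \<in> closure C" using w(2) by (intro closure_scaleR) auto
        then have "v \<in> uminus ` closure C" using c by (intro image_eqI[of _ _ "(- c) *\<^sub>R w"]) auto
        then show ?thesis using v by blast
      qed
    qed
    then show "v \<in> {v. v \<noteq> 0 \<and> proj_pt v \<in> - W}" using v0 by simp
  qed
  moreover have "closed (uminus ` closure C)" by (simp add: closed_negations)
  ultimately have "open (- W)" unfolding open_rproj_def by (metis closed_Un closed_closure open_Compl)
  then have "closed W" by (simp add: closed_def)
  moreover have "\<Omega> \<subseteq> W"
    using chart_coord_in_C chart_coord(2)[OF chart_\<Omega>] C_subset_closure zero_notin_C unfolding W_def
    by (smt (verit, best) mem_Collect_eq subsetI)
  ultimately have "closure \<Omega> \<subseteq> W" by (rule closure_minimal[rotated])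
  then obtain v where v: "v \<noteq> 0" "v \<in> closure C" "x = proj_pt v" using assms by (auto simp: W_def)
  have "chart_coord a x = (1 / (a \<bullet> v)) *\<^sub>R v"
    using closure_pos[OF v(2,1)] chart_coord_proj_pt[of a v] v(3) by simp
  then show "chart_coord a x \<in> closure C" "chart_coord a x \<noteq> 0"
    using closure_pos[OF v(2,1)] v by (auto intro: closure_scaleR)
qed

lemma lift_\<Omega>: assumes "x \<in> \<Omega>" obtains X where "X \<in> C" "x = proj_pt X"
  using chart_coord_in_C[OF assms] chart_coord(2)[OF chart_\<Omega>[OF assms]] by metis

lemma proj_pt_in_\<Omega>_iff: "0 < a \<bullet> X \<Longrightarrow> proj_pt X \<in> \<Omega> \<longleftrightarrow> X \<in> C"
  by (simp add: C_def)

lemma proj_pt_ideal_bd: "X \<in> closure C \<Longrightarrow> X \<noteq> 0 \<Longrightarrow> proj_pt X \<in> ideal_bd \<Omega> \<longleftrightarrow> X \<notin> C"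
  using proj_pt_closure proj_pt_in_\<Omega>_iff closure_pos by (auto simp: ideal_bd_def)

lemma proj_pt_eq_pos:
  assumes "X \<in> closure C" "Y \<in> closure C" "X \<noteq> 0" "Y \<noteq> 0" "proj_pt X = proj_pt Y"
  shows "\<exists>c>0. Y = c *\<^sub>R X"
proof -
  obtain c where c: "c \<noteq> 0" "Y = c *\<^sub>R X" using proj_pt_eq assms(3-5) by blast
  then have "0 < c * (a \<bullet> X)" using closure_pos[OF assms(2,4)] by simp
  then have "0 < c" using closure_pos[OF assms(1,3)] by (simp add: zero_less_mult_iff)
  then show ?thesis using c by blast
qed

lemma chart_sign:
  assumes "closure \<Omega> \<subseteq> affine_chart b"
  obtains e :: real where "e = 1 \<or> e = -1" "\<And>X. X \<in> closure C \<Longrightarrow> X \<noteq> 0 \<Longrightarrow> 0 < e * (b \<bullet> X)"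
proof -
  have nz: "b \<bullet> X \<noteq> 0" if "X \<in> closure C" "X \<noteq> 0" for X
    using proj_pt_closure[OF that] assms proj_pt_in_affine_chart[OF that(2)] by blast
  obtain Z where Z: "Z \<in> C" using C_nonempty by blast
  have Z0: "Z \<noteq> 0" using Z zero_notin_C by auto
  define e where "e = sgn (b \<bullet> Z)"
  have e: "e = 1 \<or> e = -1" using nz[OF C_subset_closure[OF Z] Z0] by (auto simp: e_def sgn_real_def)
  have eZ: "0 < e * (b \<bullet> Z)" using nz[OF C_subset_closure[OF Z] Z0] by (auto simp: e_def sgn_real_def)
  have "0 < e * (b \<bullet> X)" if X: "X \<in> closure C" "X \<noteq> 0" for X
  proof (rule ccontr)
    assume "\<not> ?thesis"
    moreover have "e * (b \<bullet> X) \<noteq> 0" using nz[OF X] e by auto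
    ultimately have neg: "0 < - (e * (b \<bullet> X))" by linarith
    define Y where "Y = (e * (b \<bullet> Z)) *\<^sub>R X + (- (e * (b \<bullet> X))) *\<^sub>R Z"
    have "Y \<in> C" unfolding Y_def
      by (rule closure_add_C[OF closure_scaleR[OF X(1)] C_scaleR[OF Z neg]]) (use eZ in simp)
    moreover have "b \<bullet> Y = 0" by (simp add: Y_def inner_add_right inner_diff_right)
    ultimately show False using nz[of Y] C_subset_closure zero_notin_C by metis
  qed
  then show ?thesis using that e by blast
qed

text \<open>The projected cone is itself convex in the chart of \<open>a\<close>. Conversely, any
  competitor is convex in some chart \<open>b\<close>, where a nonnegative combination becomes a
  convex one after renormalising.\<close>

lemma CH_eq:
  assumes fin: "finite I" and v: "\<And>k. k \<in> I \<Longrightarrow> v k \<in> closure C" "\<And>k. k \<in> I \<Longrightarrow> v k \<noteq> 0"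
  shows "CH \<Omega> ((\<lambda>k. proj_pt (v k)) ` I) = proj_pt ` (nonneg_hull I v - {0})"
proof (intro equalityI)
  let ?S = "proj_pt ` (nonneg_hull I v - {0})"
  have hcl: "X \<in> closure C" if "X \<in> nonneg_hull I v" for X
    using that v(1) by (rule nonneg_hull_closure)
  have img: "chart_coord a ` ?S = {X \<in> nonneg_hull I v. a \<bullet> X = 1}"
  proof (intro equalityI subsetI)
    fix Y assume "Y \<in> chart_coord a ` ?S"
    then obtain X where X: "X \<in> nonneg_hull I v" "X \<noteq> 0" "Y = chart_coord a (proj_pt X)" by auto
    have pos: "0 < a \<bullet> X" using closure_pos[OF hcl[OF X(1)] X(2)] .
    then have "Y = (1 / (a \<bullet> X)) *\<^sub>R X" using chart_coord_proj_pt[of a X] X(3) by simp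
    then show "Y \<in> {X \<in> nonneg_hull I v. a \<bullet> X = 1}" using pos X(1) by (auto intro: nonneg_hull_scaleR)
  next
    fix X assume X: "X \<in> {X \<in> nonneg_hull I v. a \<bullet> X = 1}"
    then have "X \<noteq> 0" "chart_coord a (proj_pt X) = X" using chart_coord_proj_pt[of a X] by auto
    then show "X \<in> chart_coord a ` ?S" using X
      by (intro image_eqI[of _ _ "proj_pt X"]) auto
  qed
  have "convex (chart_coord a ` ?S)"
    unfolding img
  proof (rule convexI)
    fix x y s t assume *: "x \<in> {X \<in> nonneg_hull I v. a \<bullet> X = 1}" "y \<in> {X \<in> nonneg_hull I v. a \<bullet> X = 1}"
      "0 \<le> s" "0 \<le> t" "s + t = (1::real)"
    then show "s *\<^sub>R x + t *\<^sub>R y \<in> {X \<in> nonneg_hull I v. a \<bullet> X = 1}"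
      by (auto simp: inner_add_right intro!: nonneg_hull_add nonneg_hull_scaleR)
  qed
  moreover have "?S \<subseteq> closure \<Omega>" using proj_pt_closure hcl by auto
  ultimately have "convex_in \<Omega> ?S" unfolding convex_in_def using chart by blast
  moreover have "(\<lambda>k. proj_pt (v k)) ` I \<subseteq> ?S"
  proof
    fix x assume "x \<in> (\<lambda>k. proj_pt (v k)) ` I"
    then obtain k where k: "k \<in> I" "x = proj_pt (v k)" by auto
    then show "x \<in> ?S" using v(2) nonneg_hull_vertex[OF fin k(1), of v]
      by (intro image_eqI[of _ _ "v k"]) auto
  qed
  ultimately show "CH \<Omega> ((\<lambda>k. proj_pt (v k)) ` I) \<subseteq> ?S"
    unfolding CH_def by (intro Inter_lower) simp
next
  show "proj_pt ` (nonneg_hull I v - {0}) \<subseteq> CH \<Omega> ((\<lambda>k. proj_pt (v k)) ` I)"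
    unfolding CH_def
  proof (intro Inter_greatest subsetI)
    fix A x assume "A \<in> {A. convex_in \<Omega> A \<and> (\<lambda>k. proj_pt (v k)) ` I \<subseteq> A}"
      and x: "x \<in> proj_pt ` (nonneg_hull I v - {0})"
    then have A: "convex_in \<Omega> A" "(\<lambda>k. proj_pt (v k)) ` I \<subseteq> A" by auto
    obtain X where X: "X \<in> nonneg_hull I v" "X \<noteq> 0" "x = proj_pt X" using x by auto
    obtain b where b: "closure \<Omega> \<subseteq> affine_chart b" "convex (chart_coord b ` A)" and A\<Omega>: "A \<subseteq> closure \<Omega>"
      using A(1) by (auto simp: convex_in_def)
    obtain e where e: "e = 1 \<or> e = -1" "\<And>X. X \<in> closure C \<Longrightarrow> X \<noteq> 0 \<Longrightarrow> 0 < e * (b \<bullet> X)"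
      using chart_sign[OF b(1)] by blast
    obtain l where l: "\<And>k. k \<in> I \<Longrightarrow> 0 \<le> l k" "X = (\<Sum>k\<in>I. l k *\<^sub>R v k)"
      using X(1) by (rule nonneg_hullE) blast
    have bX: "0 < e * (b \<bullet> X)" using e(2)[OF _ X(2)] nonneg_hull_closure[OF X(1) v(1)] by blast
    have bv: "0 < e * (b \<bullet> v k)" if "k \<in> I" for k using e(2) v that by blast
    \<comment> \<open>These are the weights of the same combination once all vectors are rescaled to
      \<open>b\<close>-height 1.\<close>
    define c where "c k = l k * (b \<bullet> v k) / (b \<bullet> X)" for k
    have "(\<Sum>k\<in>I. c k *\<^sub>R ((1 / (b \<bullet> v k)) *\<^sub>R v k)) \<in> chart_coord b ` A"
    proof (rule convex_sum[OF fin b(2)])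
      have "(\<Sum>k\<in>I. c k) = (\<Sum>k\<in>I. l k * (b \<bullet> v k)) / (b \<bullet> X)" by (simp add: c_def sum_divide_distrib)
      also have "(\<Sum>k\<in>I. l k * (b \<bullet> v k)) = b \<bullet> X" by (simp add: l(2) inner_sum_right)
      finally show "(\<Sum>k\<in>I. c k) = 1" using bX by auto
      show "0 \<le> c k" if "k \<in> I" for k
      proof -
        have "c k = l k * ((e * (b \<bullet> v k)) / (e * (b \<bullet> X)))" using e(1) by (auto simp: c_def)
        moreover have "0 \<le> \<dots>"
          using l(1)[OF that] bv[OF that] bX 
          by (intro mult_nonneg_nonneg[of "l k"] divide_nonneg_nonneg[of "e * _" "e * _"]) linarith+
        ultimately show ?thesis by linarith
      qed
      show "(1 / (b \<bullet> v k)) *\<^sub>R v k \<in> chart_coord b ` A" if "k \<in> I" for k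
      proof -
        have "b \<bullet> v k \<noteq> 0" using bv[OF that] by auto
        then show ?thesis using A(2) that chart_coord_proj_pt[of b "v k"]
          by (intro image_eqI[of _ _ "proj_pt (v k)"]) auto
      qed
    qed
    also have "(\<Sum>k\<in>I. c k *\<^sub>R ((1 / (b \<bullet> v k)) *\<^sub>R v k)) = (\<Sum>k\<in>I. (1 / (b \<bullet> X)) *\<^sub>R (l k *\<^sub>R v k))"
    proof (intro sum.cong refl)
      fix k assume "k \<in> I"
      then have "b \<bullet> v k \<noteq> 0" using bv by force
      then show "c k *\<^sub>R ((1 / (b \<bullet> v k)) *\<^sub>R v k) = (1 / (b \<bullet> X)) *\<^sub>R (l k *\<^sub>R v k)"
        by (simp add: c_def)
    qed
    also have "\<dots> = (1 / (b \<bullet> X)) *\<^sub>R X" by (simp add: l(2) scaleR_sum_right)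
    finally obtain y where y: "y \<in> A" "(1 / (b \<bullet> X)) *\<^sub>R X = chart_coord b y" by blast
    have "proj_pt ((1 / (b \<bullet> X)) *\<^sub>R X) = y"
      using chart_coord(2)[of y b] y A\<Omega> b(1) by auto
    moreover have "b \<bullet> X \<noteq> 0" using bX by auto
    ultimately show "x \<in> A" using y(1) X(3) by simp
  qed
qed

section \<open>The Hilbert metric in terms of the cone\<close>

text \<open>The plane of two boundary rays meets the closed cone in a quadrant. Support functionals
  at the two rays act as coordinates, and the interior combination guarantees that each is positive
  on the other ray.\<close>

lemma positive_comb_in_closure_iff:
  assumes P: "P \<in> closure C" "P \<notin> C" and Q: "Q \<in> closure C" "Q \<notin> C"
    and Z: "c0 *\<^sub>R P + d0 *\<^sub>R Q \<in> C"
  shows "c *\<^sub>R P + d *\<^sub>R Q \<in> closure C \<longleftrightarrow> 0 \<le> c \<and> 0 \<le> d"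
proof
  assume X: "c *\<^sub>R P + d *\<^sub>R Q \<in> closure C"
  obtain f where f: "\<And>X. X \<in> C \<Longrightarrow> 0 < f \<bullet> X" "\<And>X. X \<in> closure C \<Longrightarrow> 0 \<le> f \<bullet> X" "f \<bullet> Q \<le> 0"
    using support_functional[OF Q(2)] by blast
  obtain g where g: "\<And>X. X \<in> C \<Longrightarrow> 0 < g \<bullet> X" "\<And>X. X \<in> closure C \<Longrightarrow> 0 \<le> g \<bullet> X" "g \<bullet> P \<le> 0"
    using support_functional[OF P(2)] by blast
  have "f \<bullet> Q = 0" "g \<bullet> P = 0" using f(2)[OF Q(1)] f(3) g(2)[OF P(1)] g(3) by auto
  moreover have "0 < f \<bullet> P" "0 < g \<bullet> Q"
    using f(1)[OF Z] g(1)[OF Z] f(2)[OF P(1)] g(2)[OF Q(1)] calculation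
    by (auto simp: inner_add_right less_le)
  ultimately show "0 \<le> c \<and> 0 \<le> d"
    using f(2)[OF X] g(2)[OF X] by (auto simp: inner_add_right zero_le_mult_iff)
next
  assume "0 \<le> c \<and> 0 \<le> d"
  then show "c *\<^sub>R P + d *\<^sub>R Q \<in> closure C" using P Q by (intro closure_add closure_scaleR) auto
qed

text \<open>All four points lie in one plane, where the order of the cone reduces to scalar
  inequalities. As the chart \<open>b\<close> is arbitrary, the equivalence also yields the
  independence of the distance from the chart.\<close>

lemma hilbert_endpoints_near:
  assumes ep: "hilbert_endpoints \<Omega> b x y p q" and xy: "x \<in> \<Omega>" "y \<in> \<Omega>" "x \<noteq> y"
    and X: "X \<in> C" "x = proj_pt X" and Y: "Y \<in> C" "y = proj_pt Y"
    and t: "t = 1/2 * ln ((norm (chart_coord b y - chart_coord b p) * norm (chart_coord b x - chart_coord b q)) /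
                      (norm (chart_coord b x - chart_coord b p) * norm (chart_coord b y - chart_coord b q)))"
  shows "near T X Y \<longleftrightarrow> exp (2 * t) \<le> T"
proof -
  have b: "closure \<Omega> \<subseteq> affine_chart b" and pq: "p \<in> ideal_bd \<Omega>" "q \<in> ideal_bd \<Omega>"
    and xseg: "chart_coord b x \<in> closed_segment (chart_coord b p) (chart_coord b y)"
    and yseg: "chart_coord b y \<in> closed_segment (chart_coord b x) (chart_coord b q)"
    using ep by (auto simp: hilbert_endpoints_def)
  obtain e where e: "e = 1 \<or> e = -1" "\<And>X. X \<in> closure C \<Longrightarrow> X \<noteq> 0 \<Longrightarrow> 0 < e * (b \<bullet> X)"
    using chart_sign[OF b] by blast
  \<comment> \<open>The sign places the lifts on the sheet \<open>C\<close> whatever the orientation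
    of \<open>b\<close>, without changing norms of differences.\<close>
  define u where "u z = e *\<^sub>R chart_coord b z" for z
  have lift: "\<exists>c>0. u (proj_pt Z) = c *\<^sub>R Z" if "Z \<in> closure C" "Z \<noteq> 0" for Z
  proof -
    have "b \<bullet> Z \<noteq> 0" using e(2)[OF that] by auto
    then have "u (proj_pt Z) = (e / (b \<bullet> Z)) *\<^sub>R Z" by (simp add: u_def chart_coord_proj_pt)
    moreover have "e / (b \<bullet> Z) = 1 / (e * (b \<bullet> Z))" using e(1) by auto
    then have "0 < e / (b \<bullet> Z)" using e(2)[OF that] by simp
    ultimately show ?thesis by blast
  qed
  have uC: "u z \<in> C" if z: "z \<in> \<Omega>" for z
  proof -
    obtain Z where Z: "Z \<in> C" "z = proj_pt Z" using z by (rule lift_\<Omega>)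
    then show ?thesis using lift[OF C_subset_closure[OF Z(1)]] zero_notin_C C_scaleR by metis
  qed
  have ubd: "u z \<in> closure C \<and> u z \<notin> C" if z: "z \<in> ideal_bd \<Omega>" for z
  proof -
    define Z where "Z = chart_coord a z"
    have Z: "Z \<in> closure C" "Z \<noteq> 0" "z = proj_pt Z"
      using chart_coord_closure[of z] chart_coord(2)[of z a] z chart by (auto simp: Z_def ideal_bd_def)
    have ZC: "Z \<notin> C" using proj_pt_ideal_bd[OF Z(1,2)] z Z(3) by simp
    obtain c where c: "c > 0" "u z = c *\<^sub>R Z" using lift[OF Z(1,2)] Z(3) by blast
    have "c *\<^sub>R Z \<notin> C"
    proof
      assume "c *\<^sub>R Z \<in> C"
      then have "(1 / c) *\<^sub>R (c *\<^sub>R Z) \<in> C" using c(1) by (intro C_scaleR[of "c *\<^sub>R Z"]) auto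
      then show False using c(1) ZC by simp
    qed
    then show ?thesis using c Z(1) closure_scaleR_pos by auto
  qed
  have unorm: "norm (chart_coord b z - chart_coord b z') = norm (u z - u z')" for z z'
    using e(1) by (auto simp: u_def norm_minus_commute)
  obtain \<alpha> where \<alpha>: "0 \<le> \<alpha>" "\<alpha> \<le> 1" "chart_coord b x = (1 - \<alpha>) *\<^sub>R chart_coord b p + \<alpha> *\<^sub>R chart_coord b y"
    using xseg by (auto simp: closed_segment_def)
  obtain \<beta> where \<beta>: "0 \<le> \<beta>" "\<beta> \<le> 1" "chart_coord b y = (1 - \<beta>) *\<^sub>R chart_coord b x + \<beta> *\<^sub>R chart_coord b q"
    using yseg by (auto simp: closed_segment_def)
  have ux: "u x = (1 - \<alpha>) *\<^sub>R u p + \<alpha> *\<^sub>R u y" unfolding u_def \<alpha>(3) by (simp add: scaleR_add_right mult.commute)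
  have uy: "u y = (1 - \<beta>) *\<^sub>R u x + \<beta> *\<^sub>R u q" unfolding u_def \<beta>(3) by (simp add: scaleR_add_right mult.commute)
  have xyC: "u x \<in> C" "u y \<in> C" using uC xy by auto
  have uxy: "u x \<noteq> u y"
  proof
    assume "u x = u y"
    then have "chart_coord b x = chart_coord b y" using e(1) by (auto simp: u_def)
    moreover have "x \<in> affine_chart b" "y \<in> affine_chart b" using b xy closure_subset by blast+
    ultimately show False using chart_coord(2) xy(3) by metis
  qed
  have up: "u p \<in> closure C" "u p \<notin> C" and uq: "u q \<in> closure C" "u q \<notin> C" using ubd pq by auto
  have "\<alpha> \<noteq> 0" using ux up xyC by auto
  moreover have "\<alpha> \<noteq> 1" using ux uxy by auto
  moreover have "\<beta> \<noteq> 0" using uy uxy by auto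
  moreover have "\<beta> \<noteq> 1" using uy uq xyC by auto
  ultimately have ab: "0 < \<alpha>" "\<alpha> < 1" "0 < \<beta>" "\<beta> < 1" using \<alpha> \<beta> by auto
  \<comment> \<open>Solving the two segment equations for \<open>u x\<close> and \<open>u y\<close>
    in terms of the endpoints produces the denominator \<open>k\<close>.\<close>
  define k where "k = 1 - \<alpha> + \<alpha> * \<beta>"
  have k: "0 < k" using ab by (auto simp: k_def add_pos_pos)
  have "u x = (1 - \<alpha>) *\<^sub>R u p + (\<alpha> * (1 - \<beta>)) *\<^sub>R u x + (\<alpha> * \<beta>) *\<^sub>R u q"
    using ux by (subst (asm) uy) (simp add: scaleR_add_right add.assoc)
  then have kx: "k *\<^sub>R u x = (1 - \<alpha>) *\<^sub>R u p + (\<alpha> * \<beta>) *\<^sub>R u q"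
    by (simp add: k_def algebra_simps)
  have "k *\<^sub>R u y = (1 - \<beta>) *\<^sub>R (k *\<^sub>R u x) + (\<beta> * k) *\<^sub>R u q"
    by (subst uy) (simp add: scaleR_add_right mult.commute)
  then have "k *\<^sub>R u y = ((1 - \<alpha>) * (1 - \<beta>)) *\<^sub>R u p + ((1 - \<beta>) * (\<alpha> * \<beta>) + \<beta> * k) *\<^sub>R u q"
    by (simp only: kx) (simp add: algebra_simps)
  moreover have "(1 - \<beta>) * (\<alpha> * \<beta>) + \<beta> * k = \<beta>" by (simp add: k_def algebra_simps)
  ultimately have ky: "k *\<^sub>R u y = ((1 - \<alpha>) * (1 - \<beta>)) *\<^sub>R u p + \<beta> *\<^sub>R u q" by simp
  have "k *\<^sub>R u x \<in> C" using xyC k C_scaleR by blast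
  note iff = positive_comb_in_closure_iff[OF up uq this[unfolded kx]]
  have lo: "k *\<^sub>R u x - s *\<^sub>R (k *\<^sub>R u y) \<in> closure C \<longleftrightarrow> s * (1 - \<beta>) \<le> 1 \<and> s \<le> \<alpha>" for s
  proof -
    have "k *\<^sub>R u x - s *\<^sub>R (k *\<^sub>R u y) = ((1 - \<alpha>) * (1 - s * (1 - \<beta>))) *\<^sub>R u p + (\<beta> * (\<alpha> - s)) *\<^sub>R u q"
      unfolding kx ky by (simp add: algebra_simps)
    then show ?thesis using iff ab by (simp add: zero_le_mult_iff)
  qed
  have hi: "s *\<^sub>R (k *\<^sub>R u y) - k *\<^sub>R u x \<in> closure C \<longleftrightarrow> 1 \<le> s * (1 - \<beta>) \<and> \<alpha> \<le> s" for s
  proof -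
    have "s *\<^sub>R (k *\<^sub>R u y) - k *\<^sub>R u x = ((1 - \<alpha>) * (s * (1 - \<beta>) - 1)) *\<^sub>R u p + (\<beta> * (s - \<alpha>)) *\<^sub>R u q"
      unfolding kx ky by (simp add: algebra_simps)
    then show ?thesis using iff ab by (simp add: zero_le_mult_iff)
  qed
  \<comment> \<open>The largest admissible scalar is \<open>s = \<alpha>\<close>, for which the
    upper inequalities amount to \<open>\<rho> \<le> T\<close>; below, \<rho> turns out to be the
    cross-ratio.\<close>
  define \<rho> where "\<rho> = 1 / (\<alpha> * (1 - \<beta>))"
  have \<rho>: "0 < \<rho>" using ab by (simp add: \<rho>_def)
  obtain cx where cx: "cx > 0" "u x = cx *\<^sub>R X" using lift[of X] X C_subset_closure zero_notin_C by metis
  obtain cy where cy: "cy > 0" "u y = cy *\<^sub>R Y" using lift[of Y] Y C_subset_closure zero_notin_C by metis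
  have "near T X Y \<longleftrightarrow> near T (k *\<^sub>R u x) (k *\<^sub>R u y)"
    unfolding cx cy scaleR_scaleR using k cx cy by (subst near_scale_iff) auto
  also have "\<dots> \<longleftrightarrow> (\<exists>s>0. (s * (1 - \<beta>) \<le> 1 \<and> s \<le> \<alpha>) \<and> (1 \<le> T * s * (1 - \<beta>) \<and> \<alpha> \<le> T * s))"
    unfolding near_def lo hi ..
  also have "\<dots> \<longleftrightarrow> \<rho> \<le> T"
  proof
    assume "\<exists>s>0. (s * (1 - \<beta>) \<le> 1 \<and> s \<le> \<alpha>) \<and> (1 \<le> T * s * (1 - \<beta>) \<and> \<alpha> \<le> T * s)"
    then obtain s where s: "0 < s" "s \<le> \<alpha>" "1 \<le> T * s * (1 - \<beta>)" "\<alpha> \<le> T * s" by blast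
    have "0 < T * s" using s ab by linarith
    then have T: "0 < T" using s(1) by (simp add: zero_less_mult_iff)
    have "T * s * (1 - \<beta>) \<le> T * \<alpha> * (1 - \<beta>)" using s(2) T ab by (intro mult_right_mono mult_left_mono) auto
    then have "1 \<le> T * (\<alpha> * (1 - \<beta>))" using s(3) by (simp add: mult.assoc)
    then show "\<rho> \<le> T" using ab by (simp add: \<rho>_def pos_divide_le_eq)
  next
    assume "\<rho> \<le> T"
    then have 1: "1 \<le> T * (\<alpha> * (1 - \<beta>))" using ab by (simp add: \<rho>_def pos_divide_le_eq)
    have "1 * 1 < \<rho>"
    proof -
      have "\<alpha> * (1 - \<beta>) < 1 * 1" using ab by (intro mult_strict_mono) auto
      then show ?thesis using ab by (simp add: \<rho>_def pos_less_divide_eq)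
    qed
    then have "\<alpha> \<le> T * \<alpha>" using \<open>\<rho> \<le> T\<close> ab by simp
    moreover have "\<alpha> * (1 - \<beta>) \<le> 1" using ab by (simp add: mult_le_one)
    ultimately show "\<exists>s>0. (s * (1 - \<beta>) \<le> 1 \<and> s \<le> \<alpha>) \<and> (1 \<le> T * s * (1 - \<beta>) \<and> \<alpha> \<le> T * s)"
      using 1 ab by (intro exI[of _ \<alpha>]) (auto simp: mult.assoc)
  qed
  also have "\<rho> = exp (2 * t)"
  proof -
    have "u x - u p = \<alpha> *\<^sub>R (u y - u p)" by (subst ux) (simp add: algebra_simps)
    then have 1: "norm (u x - u p) = \<alpha> * norm (u y - u p)" using ab by simp
    have "u y - u q = (1 - \<beta>) *\<^sub>R (u x - u q)" by (subst uy) (simp add: algebra_simps)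
    then have 2: "norm (u y - u q) = (1 - \<beta>) * norm (u x - u q)" using ab by simp
    have "norm (u y - u p) \<noteq> 0" "norm (u x - u q) \<noteq> 0" using up uq xyC by auto
    then have "(norm (u y - u p) * norm (u x - u q)) / (norm (u x - u p) * norm (u y - u q)) = \<rho>"
      unfolding 1 2 \<rho>_def using ab by (simp add: field_simps)
    then have "2 * t = ln \<rho>" by (simp add: t unorm)
    then show ?thesis using \<rho> by (simp only: exp_ln)
  qed
  finally show ?thesis .
qed

text \<open>The parameters for which the affine line stays in the closed cone form a compact set. At
  its extreme values the point cannot lie in the open cone, since the line could then be
  prolonged.\<close>

lemma hilbert_endpoints_exist:
  assumes xy: "x \<in> \<Omega>" "y \<in> \<Omega>" "x \<noteq> y"
  shows "\<exists>p q. hilbert_endpoints \<Omega> a x y p q"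
proof -
  define X Y where "X = chart_coord a x" and "Y = chart_coord a y"
  have XC: "X \<in> C" and YC: "Y \<in> C" using chart_coord_in_C xy by (auto simp: X_def Y_def)
  have aX: "a \<bullet> X = 1" "proj_pt X = x" and aY: "a \<bullet> Y = 1" "proj_pt Y = y"
    using chart_coord[OF chart_\<Omega>[OF xy(1)]] chart_coord[OF chart_\<Omega>[OF xy(2)]] by (auto simp: X_def Y_def)
  have XY: "X \<noteq> Y" using aX aY xy(3) by auto
  define \<phi> where "\<phi> t = X + t *\<^sub>R (Y - X)" for t :: real
  have a\<phi>: "a \<bullet> \<phi> t = 1" for t by (simp add: \<phi>_def inner_add_right inner_diff_right aX aY)
  have \<phi>_comb: "\<phi> ((1 - u) * s + u * t) = (1 - u) *\<^sub>R \<phi> s + u *\<^sub>R \<phi> t" for s t u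
    by (simp add: \<phi>_def algebra_simps)
  have \<phi>_seg: "closed_segment (\<phi> s) (\<phi> t) = \<phi> ` {s..t}" if st: "s \<le> t" for s t
  proof -
    have "\<phi> ` closed_segment s t = closed_segment (\<phi> s) (\<phi> t)"
      unfolding closed_segment_def by (auto simp: \<phi>_comb image_iff) (metis \<phi>_comb)
    then show ?thesis using st by (simp add: closed_segment_eq_real_ivl)
  qed
  define S where "S = \<phi> -` closure C"
  have "closed S" unfolding S_def \<phi>_def by (intro closed_vimage closed_closure continuous_intros)
  moreover have "bounded S"
  proof -
    have "norm t \<le> (B + norm X) / norm (Y - X)" if "t \<in> S" for t
    proof -
      have "norm (\<phi> t) \<le> B" using closure_bound[of "\<phi> t"] that a\<phi>[of t] by (simp add: S_def)
      moreover have "norm (t *\<^sub>R (Y - X)) \<le> norm (\<phi> t) + norm X"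
        using norm_triangle_ineq4[of "\<phi> t" X] by (simp add: \<phi>_def)
      ultimately have "\<bar>t\<bar> * norm (Y - X) \<le> B + norm X" by simp
      then show ?thesis using XY by (simp add: pos_le_divide_eq)
    qed
    then show ?thesis by (auto simp: bounded_iff)
  qed
  ultimately have "compact S" by (simp add: compact_eq_bounded_closed)
  have "\<phi> 0 = X" "\<phi> 1 = Y" by (simp_all add: \<phi>_def)
  then have S01: "0 \<in> S" "1 \<in> S" using XC YC C_subset_closure by (auto simp: S_def)
  obtain t1 where t1: "t1 \<in> S" "\<And>t. t \<in> S \<Longrightarrow> t1 \<le> t"
    using compact_attains_inf[OF \<open>compact S\<close>] S01 by blast
  obtain t2 where t2: "t2 \<in> S" "\<And>t. t \<in> S \<Longrightarrow> t \<le> t2"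
    using compact_attains_sup[OF \<open>compact S\<close>] S01 by blast
  have t01: "t1 \<le> 0" "1 \<le> t2" using t1(2) t2(2) S01 by auto
  define P Q where "P = \<phi> t1" and "Q = \<phi> t2"
  have Pcl: "P \<in> closure C" and Qcl: "Q \<in> closure C" using t1(1) t2(1) by (auto simp: S_def P_def Q_def)
  have PC: "P \<notin> C"
  proof
    assume "P \<in> C"
    then obtain s where s: "s > 0" "P - s *\<^sub>R (Y - X) \<in> C" using C_absorbs by blast
    moreover have "P - s *\<^sub>R (Y - X) = \<phi> (t1 - s)" by (simp add: P_def \<phi>_def algebra_simps)
    ultimately have "t1 - s \<in> S" using C_subset_closure by (simp add: S_def)
    then show False using t1(2) s(1) by fastforce
  qed
  have QC: "Q \<notin> C"
  proof
    assume "Q \<in> C"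
    then obtain s where s: "s > 0" "Q - s *\<^sub>R (X - Y) \<in> C" using C_absorbs by blast
    moreover have "Q - s *\<^sub>R (X - Y) = \<phi> (t2 + s)" by (simp add: Q_def \<phi>_def algebra_simps)
    ultimately have "t2 + s \<in> S" using C_subset_closure by (simp add: S_def)
    then show False using t2(2) s(1) by fastforce
  qed
  have P0: "P \<noteq> 0" and Q0: "Q \<noteq> 0" using a\<phi> by (auto simp: P_def Q_def) (metis inner_zero_right zero_neq_one)+
  have cc: "chart_coord a (proj_pt (\<phi> t)) = \<phi> t" for t using chart_coord_proj_pt[of a "\<phi> t"] a\<phi>[of t] by simp
  have \<phi>0: "\<phi> t \<noteq> 0" for t using a\<phi>[of t] by auto
  have X0: "X \<noteq> 0" "Y \<noteq> 0" using aX(1) aY(1) by auto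
  have line: "span (line_of x \<union> line_of y) = span {X, Y}"
  proof -
    have l: "line_of x = span {X}" "line_of y = span {Y}" using line_of_proj_pt X0 aX(2) aY(2) by metis+
    show ?thesis
    proof (intro subset_antisym)
      have "span {X} \<union> span {Y} \<subseteq> span {X, Y}" by (intro Un_least span_mono) auto
      then show "span (line_of x \<union> line_of y) \<subseteq> span {X, Y}" unfolding l by (intro span_minimal) auto
      show "span {X, Y} \<subseteq> span (line_of x \<union> line_of y)" unfolding l
        by (intro span_mono) (auto intro: span_base)
    qed
  qed
  have img: "chart_coord a ` (proj_line x y \<inter> closure \<Omega>) = \<phi> ` {t1..t2}"
  proof (intro equalityI subsetI)
    fix Z assume "Z \<in> chart_coord a ` (proj_line x y \<inter> closure \<Omega>)"
    then obtain z where z: "z \<in> proj_line x y" "z \<in> closure \<Omega>" "Z = chart_coord a z" by blast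
    have Z: "a \<bullet> Z = 1" "proj_pt Z = z" using chart_coord[OF subsetD[OF chart z(2)]] z(3) by auto
    have "Z \<noteq> 0" using Z(1) by auto
    then have "Z \<in> line_of z" using line_of_proj_pt[of Z] Z(2) by (metis span_base singletonI)
    then have "Z \<in> span {X, Y}" using z(1) line by (auto simp: proj_line_def)
    then obtain c where "Z - c *\<^sub>R X \<in> span {Y}" using span_breakdown_eq by blast
    then obtain d where "Z - c *\<^sub>R X = d *\<^sub>R Y" by (auto simp: span_singleton)
    then have Zcd: "Z = c *\<^sub>R X + d *\<^sub>R Y" by (simp add: algebra_simps)
    then have "c + d = 1" using Z(1) aX aY by (simp add: inner_add_right)
    then have c: "c = 1 - d" by simp
    have "Z = \<phi> d" unfolding Zcd \<phi>_def c by (simp add: algebra_simps)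
    moreover have "Z \<in> closure C" using chart_coord_closure(1)[OF z(2)] z(3) by simp
    ultimately have "d \<in> S" by (simp add: S_def)
    then show "Z \<in> \<phi> ` {t1..t2}" using t1(2) t2(2) \<open>Z = \<phi> d\<close> by auto
  next
    fix Z assume "Z \<in> \<phi> ` {t1..t2}"
    then obtain t where t: "t1 \<le> t" "t \<le> t2" "Z = \<phi> t" by auto
    have "Z \<in> closed_segment P Q" unfolding P_def Q_def using \<phi>_seg[of t1 t2] t t01 by auto
    then have Zcl: "Z \<in> closure C" using closed_segment_subset[OF Pcl Qcl convex_closure_C] by blast
    have "Z \<in> span {X, Y}" unfolding t(3) \<phi>_def
      by (intro span_add span_scale span_diff) (auto intro: span_base)
    then have "span {Z} \<subseteq> span {X, Y}" by (intro span_minimal) auto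
    then have "proj_pt Z \<in> proj_line x y" using line_of_proj_pt[of Z] \<phi>0 t(3) line by (auto simp: proj_line_def)
    moreover have "proj_pt Z \<in> closure \<Omega>" using proj_pt_closure Zcl \<phi>0 t(3) by auto
    ultimately show "Z \<in> chart_coord a ` (proj_line x y \<inter> closure \<Omega>)"
      using cc[of t] t(3) by (intro image_eqI[of _ _ "proj_pt Z"]) auto
  qed
  have "hilbert_endpoints \<Omega> a x y (proj_pt P) (proj_pt Q)"
    unfolding hilbert_endpoints_def
  proof (intro conjI)
    show "proj_pt P \<in> ideal_bd \<Omega>" "proj_pt Q \<in> ideal_bd \<Omega>"
      using proj_pt_ideal_bd Pcl Qcl P0 Q0 PC QC by auto
    have PQ: "chart_coord a (proj_pt P) = \<phi> t1" "chart_coord a (proj_pt Q) = \<phi> t2"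
      unfolding P_def Q_def by (rule cc)+
    show "chart_coord a ` (proj_line x y \<inter> closure \<Omega>)
        = closed_segment (chart_coord a (proj_pt P)) (chart_coord a (proj_pt Q))"
      unfolding PQ img using t01 by (intro \<phi>_seg[symmetric]) auto
    have "\<phi> 0 \<in> closed_segment (\<phi> t1) (\<phi> 1)" using \<phi>_seg[of t1 1] t01 by auto
    then show "chart_coord a x \<in> closed_segment (chart_coord a (proj_pt P)) (chart_coord a y)"
      unfolding PQ X_def[symmetric] Y_def[symmetric] \<open>\<phi> 0 = X\<close> \<open>\<phi> 1 = Y\<close> .
    have "\<phi> 1 \<in> closed_segment (\<phi> 0) (\<phi> t2)" using \<phi>_seg[of 0 t2] t01 by auto
    then show "chart_coord a y \<in> closed_segment (chart_coord a x) (chart_coord a (proj_pt Q))"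
      unfolding PQ X_def[symmetric] Y_def[symmetric] \<open>\<phi> 0 = X\<close> \<open>\<phi> 1 = Y\<close> .
  qed (rule chart)
  then show ?thesis by blast
qed

text \<open>Any two admissible charts yield the same set of factors \<open>T\<close>, hence the same
  number; this makes the definite description in \<open>hilbert_dist\<close> legitimate.\<close>

lemma near_iff_hilbert_dist:
  assumes X: "X \<in> C" and Y: "Y \<in> C"
  shows "near T X Y \<longleftrightarrow> exp (2 * hilbert_dist \<Omega> (proj_pt X) (proj_pt Y)) \<le> T"
proof (cases "proj_pt X = proj_pt Y")
  case True
  obtain c where c: "c > 0" "Y = c *\<^sub>R X"
    using proj_pt_eq_pos[OF C_subset_closure[OF X] C_subset_closure[OF Y]] True X Y zero_notin_C by metis
  have "near T X X" if "1 \<le> T"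
    using closure_scaleR[of X "T - 1"] C_subset_closure[OF X] that
    by (intro nearI[of 1]) (auto simp: zero_in_closure algebra_simps)
  then have "near T X (c *\<^sub>R X)" if "1 \<le> T" using that c near_scale_right by blast
  then show ?thesis using near_factor_ge_1[of T X Y] True Y c(2) by (auto simp: hilbert_dist_def)
next
  case False
  let ?x = "proj_pt X" and ?y = "proj_pt Y"
  let ?val = "\<lambda>b p q. 1/2 * ln ((norm (chart_coord b ?y - chart_coord b p) * norm (chart_coord b ?x - chart_coord b q)) /
                      (norm (chart_coord b ?x - chart_coord b p) * norm (chart_coord b ?y - chart_coord b q)))"
  have xy: "?x \<in> \<Omega>" "?y \<in> \<Omega>" using X Y proj_pt_C by auto
  have char: "near T X Y \<longleftrightarrow> exp (2 * ?val b p q) \<le> T" if "hilbert_endpoints \<Omega> b ?x ?y p q" for b p q T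
    by (rule hilbert_endpoints_near[OF that xy False X refl Y refl refl])
  obtain p q where pq: "hilbert_endpoints \<Omega> a ?x ?y p q"
    using hilbert_endpoints_exist[OF xy False] by blast
  have dist: "hilbert_dist \<Omega> ?x ?y = ?val a p q"
    unfolding hilbert_dist_def if_not_P[OF False]
  proof (rule the_equality)
    show "\<exists>b p' q'. hilbert_endpoints \<Omega> b ?x ?y p' q' \<and> ?val a p q = ?val b p' q'" using pq by blast
    fix t assume "\<exists>b p q. hilbert_endpoints \<Omega> b ?x ?y p q \<and> t = ?val b p q"
    then obtain b p' q' where b: "hilbert_endpoints \<Omega> b ?x ?y p' q'" "t = ?val b p' q'" by blast
    have "exp (2 * t) \<le> T \<longleftrightarrow> exp (2 * ?val a p q) \<le> T" for T
      unfolding b(2) char[OF pq, symmetric] char[OF b(1), symmetric] ..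
    from this[of "exp (2 * t)"] this[of "exp (2 * ?val a p q)"] show "t = ?val a p q" by simp
  qed
  show ?thesis unfolding dist by (rule char[OF pq])
qed

lemma hilbert_dist_nonneg: assumes "x \<in> \<Omega>" "y \<in> \<Omega>" shows "0 \<le> hilbert_dist \<Omega> x y"
proof -
  obtain X where X: "X \<in> C" "x = proj_pt X" using assms(1) by (rule lift_\<Omega>)
  obtain Y where Y: "Y \<in> C" "y = proj_pt Y" using assms(2) by (rule lift_\<Omega>)
  have "1 \<le> exp (2 * hilbert_dist \<Omega> x y)"
    using near_factor_ge_1[OF _ Y(1)] near_iff_hilbert_dist[OF X(1) Y(1)] X Y by blast
  then show ?thesis by simp
qed

section \<open>Lifting automorphisms and cocompactness\<close>

text \<open>A matrix inducing \<open>g\<close> sends \<open>C\<close> into the union of the two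
  sheets. As \<open>C\<close> is connected only one of them occurs, and a change of sign makes it
  \<open>C\<close>.\<close>

lemma Aut_lift:
  assumes "g \<in> Aut \<Omega>"
  shows "\<exists>L. automorphism L \<and> (\<forall>X. X \<noteq> 0 \<longrightarrow> g (proj_pt X) = proj_pt (L X))"
proof -
  obtain M where M: "invertible M" "g = pgl_action M" and g\<Omega>: "g ` \<Omega> = \<Omega>"
    using assms by (auto simp: Aut_def PGL_def)
  have inj: "inj ((*v) M)" using M(1) inj_matrix_vector_mult by blast
  have act: "g (proj_pt X) = proj_pt (M *v X)" if "X \<noteq> 0" for X
    using pgl_action_proj_pt M that by blast
  have nz: "a \<bullet> (M *v X) \<noteq> 0" if "X \<in> C" for X
  proof -
    have X0: "X \<noteq> 0" using that zero_notin_C by auto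
    then have "M *v X \<noteq> 0" using inj by (metis injD matrix_vector_mult_0_right)
    moreover have "proj_pt (M *v X) \<in> \<Omega>" using act[OF X0] g\<Omega> proj_pt_C[OF that] by (metis imageI)
    ultimately show ?thesis using chart_\<Omega> proj_pt_in_affine_chart by blast
  qed
  have conn: "connected ((\<lambda>X. a \<bullet> (M *v X)) ` C)"
    by (intro connected_continuous_image convex_connected convex_C continuous_intros)
  obtain e :: real where e: "e = 1 \<or> e = -1" "\<And>X. X \<in> C \<Longrightarrow> 0 < e * (a \<bullet> (M *v X))"
  proof (cases "\<exists>X\<in>C. 0 < a \<bullet> (M *v X)")
    case True
    then obtain X where X: "X \<in> C" "0 < a \<bullet> (M *v X)" by blast
    have "0 < a \<bullet> (M *v Y)" if Y: "Y \<in> C" for Y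
    proof (rule ccontr)
      assume "\<not> ?thesis"
      then have "0 \<in> (\<lambda>X. a \<bullet> (M *v X)) ` C"
        using connectedD_interval[OF conn, of "a \<bullet> (M *v Y)" "a \<bullet> (M *v X)" 0] X Y by auto
      then show False using nz by auto
    qed
    then show ?thesis by (intro that[of 1]) auto
  next
    case False
    then have "a \<bullet> (M *v X) < 0" if "X \<in> C" for X using nz that by (meson not_less_iff_gr_or_eq)
    then show ?thesis by (intro that[of "-1"]) auto
  qed
  define L where "L X = e *\<^sub>R (M *v X)" for X
  have linL: "linear L" unfolding L_def by (intro linear_compose_scale_right matrix_vector_mul_linear)
  have injL: "inj L" using inj e(1) by (auto simp: L_def inj_def)
  have actL: "g (proj_pt X) = proj_pt (L X)" if "X \<noteq> 0" for X
    using act[OF that] e(1) proj_pt_scaleR[of "-1" "M *v X"] by (auto simp: L_def)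
  have LC: "L X \<in> C" if "X \<in> C" for X
  proof -
    have "X \<noteq> 0" using that zero_notin_C by auto
    then have "proj_pt (L X) \<in> \<Omega>" using actL g\<Omega> proj_pt_C[OF that] by (metis imageI)
    then show ?thesis using e(2)[OF that] by (simp add: C_def L_def)
  qed
  have "C \<subseteq> L ` C"
  proof
    fix Y assume Y: "Y \<in> C"
    then obtain x where x: "x \<in> \<Omega>" "proj_pt Y = g x" using g\<Omega> proj_pt_C by blast
    obtain X where X: "X \<in> C" "x = proj_pt X" using x(1) by (rule lift_\<Omega>)
    have X0: "X \<noteq> 0" using X zero_notin_C by auto
    have "proj_pt (L X) = proj_pt Y" using x X actL[OF X0] by simp
    then obtain c where c: "c > 0" "Y = c *\<^sub>R L X"
      using proj_pt_eq_pos C_subset_closure LC[OF X(1)] Y zero_notin_C by metis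
    then have "Y = L (c *\<^sub>R X)" using linear_scale[OF linL] by simp
    then show "Y \<in> L ` C" using C_scaleR X c by blast
  qed
  then have "automorphism L" unfolding automorphism_def using linL injL LC by auto
  then show ?thesis using actL by blast
qed

lemma automorphism_inverse:
  assumes "automorphism L" obtains L' where "automorphism L'" "\<And>X. L' (L X) = X"
proof -
  have L: "linear L" "inj L" "L ` C = C" using assms by (auto simp: automorphism_def)
  obtain L' where L': "linear L'" "\<And>x. L' (L x) = x" "\<And>x. L (L' x) = x"
    using linear_injective_isomorphism[OF L(1,2)] by blast
  have "inj L'" using L'(3) by (metis injI)
  moreover have "L' ` L ` C = C" by (simp add: image_image L'(2))
  then have "L' ` C = C" by (simp add: L(3))
  ultimately show ?thesis using that L' by (auto simp: automorphism_def)
qed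

lemma automorphism_scale: assumes "automorphism L" "0 < c" shows "automorphism (\<lambda>X. c *\<^sub>R L X)"
proof -
  have "(\<lambda>X. c *\<^sub>R X) ` C = C"
  proof (intro equalityI subsetI)
    fix Y assume "Y \<in> C"
    then have "(1/c) *\<^sub>R Y \<in> C" "Y = c *\<^sub>R ((1/c) *\<^sub>R Y)" using assms(2) C_scaleR by auto
    then show "Y \<in> (\<lambda>X. c *\<^sub>R X) ` C" by blast
  qed (use assms(2) C_scaleR in auto)
  moreover have "(\<lambda>X. c *\<^sub>R L X) ` C = (\<lambda>X. c *\<^sub>R X) ` (L ` C)" by (simp add: image_image)
  ultimately have "(\<lambda>X. c *\<^sub>R L X) ` C = C" using assms(1) by (simp add: automorphism_def)
  moreover have "linear (\<lambda>X. c *\<^sub>R L X)"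
    using assms(1) by (auto simp: automorphism_def intro: linear_compose_scale_right)
  moreover have "inj (\<lambda>X. c *\<^sub>R L X)" using assms by (auto simp: automorphism_def inj_def)
  ultimately show ?thesis by (simp add: automorphism_def)
qed

lemma quasi_homogeneous_cocompact:
  assumes "quasi_homogeneous \<Omega>"
  obtains K where "cocompact_cone C a B K"
proof -
  obtain K where K: "compact K" "K \<subseteq> \<Omega>" "(\<Union>g\<in>Aut \<Omega>. g ` K) = \<Omega>"
    using assms by (auto simp: quasi_homogeneous_def)
  have cont: "continuous_on \<Omega> (chart_coord a)"
    unfolding continuous_on_open_vimage[OF open_\<Omega>]
  proof (intro allI impI)
    fix U :: "(real^'n) set" assume U: "open U"
    have "{v. v \<noteq> 0 \<and> proj_pt v \<in> chart_coord a -` U \<inter> \<Omega>}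
        = {v. v \<noteq> 0 \<and> proj_pt v \<in> \<Omega>} \<inter> (\<lambda>v. (1 / (a \<bullet> v)) *\<^sub>R v) -` U"
    proof -
      have "chart_coord a (proj_pt v) = (1 / (a \<bullet> v)) *\<^sub>R v" if "v \<noteq> 0" "proj_pt v \<in> \<Omega>" for v
        using chart_coord_proj_pt chart_\<Omega>[OF that(2)] proj_pt_in_affine_chart[OF that(1)] by blast
      then show ?thesis by auto
    qed
    moreover have "open ({v. v \<noteq> 0 \<and> proj_pt v \<in> \<Omega>} \<inter> (\<lambda>v. (1 / (a \<bullet> v)) *\<^sub>R v) -` U)"
    proof (rule continuous_open_preimage[OF _ _ U])
      show "open {v. v \<noteq> 0 \<and> proj_pt v \<in> \<Omega>}" using open_\<Omega> by (simp add: open_rproj_def)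
      show "continuous_on {v. v \<noteq> 0 \<and> proj_pt v \<in> \<Omega>} (\<lambda>v. (1 / (a \<bullet> v)) *\<^sub>R v)"
        using chart_\<Omega> proj_pt_in_affine_chart by (intro continuous_intros) auto
    qed
    ultimately show "open (chart_coord a -` U \<inter> \<Omega>)" by (simp add: open_rproj_def)
  qed
  define K' where "K' = chart_coord a ` K"
  have "compact K'" unfolding K'_def
    using compact_continuous_image[OF continuous_on_subset[OF cont K(2)] K(1)] .
  moreover have "K' \<subseteq> C" using chart_coord_in_C K(2) by (auto simp: K'_def)
  moreover have "\<exists>L. automorphism L \<and> L X \<in> K'" if X: "X \<in> C" for X
  proof -
    obtain g x where g: "g \<in> Aut \<Omega>" "x \<in> K" "proj_pt X = g x"
      using K(3) proj_pt_C[OF X] by blast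
    obtain L where L: "automorphism L" "\<And>X. X \<noteq> 0 \<Longrightarrow> g (proj_pt X) = proj_pt (L X)"
      using Aut_lift[OF g(1)] by blast
    define Z where "Z = chart_coord a x"
    have x\<Omega>: "x \<in> \<Omega>" using g(2) K(2) by blast
    have Z: "Z \<in> C" "proj_pt Z = x" using chart_coord_in_C[OF x\<Omega>] chart_coord(2)[OF chart_\<Omega>[OF x\<Omega>]] by (auto simp: Z_def)
    have LZ: "L Z \<in> C" using automorphism_C[OF L(1)] Z by blast
    have "proj_pt (L Z) = proj_pt X" using L(2)[of Z] Z g(3) zero_notin_C by force
    \<comment> \<open>The projective action matches only rays; the leftover factor is absorbed
      because positive multiples of automorphisms are automorphisms of the cone.\<close>
    then obtain c where c: "c > 0" "X = c *\<^sub>R L Z"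
      using proj_pt_eq_pos C_subset_closure LZ X zero_notin_C by metis
    obtain L' where L': "automorphism L'" "\<And>Y. L' (c *\<^sub>R L Y) = Y"
      using automorphism_inverse[OF automorphism_scale[OF L(1) c(1)]] by blast
    then have "L' X = Z" using c by simp
    then show ?thesis using L'(1) g(2) by (auto simp: K'_def Z_def)
  qed
  ultimately have "cocompact_cone C a B K'"
    by unfold_locales auto
  then show ?thesis by (rule that)
qed

end

section \<open>Centroids of generic tuples\<close>

lemma hilbert_dist_le_diam:
  assumes "y \<in> A" "z \<in> A" shows "ennreal (hilbert_dist \<Omega> y z) \<le> hilbert_diam \<Omega> A"
  unfolding hilbert_diam_def by (rule SUP_upper2[OF assms(1)], rule SUP_upper2[OF assms(2)]) simp

text \<open>Adjoining a single face of codimension two to the family of all facets violates the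
  cardinality condition in the definition of genericity.\<close>

lemma generic_tuple_dist_le:
  assumes gen: "generic_tuple \<Omega> \<delta> D r x" and D: "0 \<le> D"
    and ij: "i \<le> r + 1" "j \<le> r + 1" "i \<noteq> j" and ne: "{0..r+1} - {i, j} \<noteq> {}"
    and facets: "\<And>k. k \<le> r + 1 \<Longrightarrow> {y, z} \<subseteq> nbhd \<Omega> \<delta> (CH \<Omega> (x ` ({0..r+1} - {k})))"
    and face: "{y, z} \<subseteq> nbhd \<Omega> \<delta> (CH \<Omega> (x ` ({0..r+1} - {i, j})))"
  shows "hilbert_dist \<Omega> y z \<le> D"
proof (rule ccontr)
  assume "\<not> ?thesis"
  then have less: "ennreal D < ennreal (hilbert_dist \<Omega> y z)" using D by (simp add: ennreal_less_iff)
  \<comment> \<open>The facets make the intersection of all index sets empty, and index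
    \<open>r + 2\<close> holds the face with only \<open>r\<close> vertices.\<close>
  define I where "I k = (if k \<le> r + 1 then {0..r+1} - {k} else {0..r+1} - {i, j})" for k
  have "\<forall>k\<in>{0..r+2}. I k \<noteq> {} \<and> I k \<subset> {0..r+1}"
  proof
    fix k
    have "i \<in> {0..r+1}" "j \<in> {0..r+1}" using ij by simp_all
    then have "{0..r+1} - {k} \<noteq> {}" "{0..r+1} - {i, j} \<subset> {0..r+1}" using ij(3) by blast+
    moreover have "{0..r+1} - {k} \<subset> {0..r+1}" if "k \<le> r + 1"
    proof -
      have "k \<in> {0..r+1}" using that by simp
      then show ?thesis by blast
    qed
    ultimately show "I k \<noteq> {} \<and> I k \<subset> {0..r+1}" using ne unfolding I_def by presburger
  qed
  moreover have "(\<Inter>k\<in>{0..r+2}. I k) = {}"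
  proof (rule ccontr)
    assume "\<not> ?thesis"
    then obtain k where "\<forall>l\<in>{0..r+2}. k \<in> I l" by blast
    then have k: "k \<in> I l" if "l \<le> r + 2" for l using that by simp
    have "k \<le> r + 1" using k[of 0] by (auto simp: I_def)
    then show False using k[of k] by (simp add: I_def)
  qed
  moreover have "ennreal D < hilbert_diam \<Omega> (\<Inter>k\<in>{0..r+2}. nbhd \<Omega> \<delta> (CH \<Omega> (x ` I k)))"
  proof (rule less_le_trans[OF less], rule hilbert_dist_le_diam)
    have "{y, z} \<subseteq> nbhd \<Omega> \<delta> (CH \<Omega> (x ` I k))" for k using facets face by (cases "k \<le> r + 1") (auto simp: I_def)
    then show "y \<in> (\<Inter>k\<in>{0..r+2}. nbhd \<Omega> \<delta> (CH \<Omega> (x ` I k)))" "z \<in> (\<Inter>k\<in>{0..r+2}. nbhd \<Omega> \<delta> (CH \<Omega> (x ` I k)))"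
      by auto
  qed
  ultimately have "\<forall>k\<in>{0..r+2}. card (I k) = r + 1" using gen unfolding generic_tuple_def by blast
  then have "card (I (r + 2)) = r + 1" by simp
  moreover have "card (I (r + 2)) = r" using ij by (simp add: I_def card_Diff_subset)
  ultimately show False by simp
qed

context convex_domain
begin

lemma CH_subset_\<Omega>:
  assumes "finite J" "\<And>k. k \<in> J \<Longrightarrow> v k \<in> C"
  shows "CH \<Omega> ((\<lambda>k. proj_pt (v k)) ` J) = proj_pt ` (nonneg_hull J v - {0})"
    "CH \<Omega> ((\<lambda>k. proj_pt (v k)) ` J) \<subseteq> \<Omega>"
proof -
  have "v k \<noteq> 0" if "k \<in> J" for k using assms(2)[OF that] zero_notin_C by metis
  then show eq: "CH \<Omega> ((\<lambda>k. proj_pt (v k)) ` J) = proj_pt ` (nonneg_hull J v - {0})"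
    using assms C_subset_closure by (intro CH_eq) auto
  show "CH \<Omega> ((\<lambda>k. proj_pt (v k)) ` J) \<subseteq> \<Omega>"
    unfolding eq using nonneg_hull_C[of _ J v, OF _ assms] proj_pt_C by blast
qed

lemma nbhd_CH_iff:
  assumes "finite J" "\<And>k. k \<in> J \<Longrightarrow> v k \<in> C" "J \<noteq> {}" "0 < \<delta>" "X \<in> C"
  shows "proj_pt X \<in> nbhd \<Omega> \<delta> (CH \<Omega> ((\<lambda>k. proj_pt (v k)) ` J)) \<longleftrightarrow>
    (\<exists>Y\<in>nonneg_hull J v - {0}. hilbert_dist \<Omega> (proj_pt X) (proj_pt Y) < \<delta>)"
proof -
  let ?H = "CH \<Omega> ((\<lambda>k. proj_pt (v k)) ` J)"
  have H: "?H = proj_pt ` (nonneg_hull J v - {0})" using assms(1,2) by (rule CH_subset_\<Omega>(1))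
  have H\<Omega>: "?H \<subseteq> \<Omega>" using assms(1,2) by (rule CH_subset_\<Omega>(2))
  obtain k where k: "k \<in> J" using assms(3) by blast
  have "v k \<in> nonneg_hull J v - {0}" using nonneg_hull_vertex[OF assms(1) k, of v] assms(2)[OF k] zero_notin_C by auto
  then have "proj_pt (v k) \<in> ?H" unfolding H by (rule imageI)
  then have "?H \<noteq> {}" by blast
  moreover have "bdd_below ((\<lambda>c. hilbert_dist \<Omega> (proj_pt X) c) ` ?H)"
    using hilbert_dist_nonneg[OF proj_pt_C[OF assms(5)]] H\<Omega>
    by (intro bdd_belowI2[of _ 0]) blast
  ultimately have "(INF c\<in>?H. hilbert_dist \<Omega> (proj_pt X) c) < \<delta> \<longleftrightarrow> (\<exists>c\<in>?H. hilbert_dist \<Omega> (proj_pt X) c < \<delta>)"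
    by (rule cINF_less_iff)
  then show ?thesis
    using assms(4) proj_pt_C[OF assms(5)] unfolding nbhd_def H by auto
qed

lemma nbhd_imp_near:
  assumes "finite J" "\<And>k. k \<in> J \<Longrightarrow> v k \<in> C" "J \<noteq> {}" "0 < \<delta>" "X \<in> C"
    and "proj_pt X \<in> nbhd \<Omega> \<delta> (CH \<Omega> ((\<lambda>k. proj_pt (v k)) ` J))"
  shows "\<exists>Y\<in>nonneg_hull J v. near (exp (2 * \<delta>)) X Y"
proof -
  obtain Y where Y: "Y \<in> nonneg_hull J v" "Y \<noteq> 0" "hilbert_dist \<Omega> (proj_pt X) (proj_pt Y) < \<delta>"
    using assms(6) nbhd_CH_iff[of J v, OF assms(1-5)] by blast
  have "Y \<in> C" using nonneg_hull_C[OF Y(1) assms(1,2) Y(2)] .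
  then have "near (exp (2 * \<delta>)) X Y" using near_iff_hilbert_dist[OF assms(5)] Y(3) by simp
  then show ?thesis using Y(1) by blast
qed

text \<open>The open neighbourhood requires a strict bound on \<open>T\<close>. Nonemptiness of
  \<open>J\<close> comes for free, since the hull of the empty family is the origin, which is near
  no point of \<open>C\<close>.\<close>

lemma near_imp_nbhd:
  assumes "finite J" "\<And>k. k \<in> J \<Longrightarrow> v k \<in> C" "0 < \<delta>" "X \<in> C"
    and Y: "Y \<in> nonneg_hull J v" "near T X Y" and T: "0 < T" "T < exp (2 * \<delta>)"
  shows "J \<noteq> {}" "proj_pt X \<in> nbhd \<Omega> \<delta> (CH \<Omega> ((\<lambda>k. proj_pt (v k)) ` J))"
proof -
  have YC: "Y \<in> C" using near_imp_C[OF Y(2) assms(4) T(1)] .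
  then have Y0: "Y \<noteq> 0" using zero_notin_C by auto
  then show J: "J \<noteq> {}" using Y(1) by (auto simp: nonneg_hull_def)
  have "exp (2 * hilbert_dist \<Omega> (proj_pt X) (proj_pt Y)) < exp (2 * \<delta>)"
    using near_iff_hilbert_dist[OF assms(4) YC, of T] Y(2) T(2) by linarith
  then have "hilbert_dist \<Omega> (proj_pt X) (proj_pt Y) < \<delta>" by simp
  then show "proj_pt X \<in> nbhd \<Omega> \<delta> (CH \<Omega> ((\<lambda>k. proj_pt (v k)) ` J))"
    using nbhd_CH_iff[of J v, OF assms(1,2) J assms(3,4)] Y(1) Y0 by blast
qed

text \<open>Boundedness makes the supremum in \<open>r_PES\<close> an upper bound for the
  dimensions.\<close>

lemma PES_dim_bound: "is_PES \<Omega> k S \<Longrightarrow> k \<le> CARD('n)"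
proof -
  assume "is_PES \<Omega> k S"
  then obtain v where "nondegenerate_simplex \<Omega> k v" unfolding is_PES_def by blast
  then have "dim (span (\<Union>i\<in>{0..k}. line_of (v i))) = k + 1"
    unfolding nondegenerate_simplex_def by blast
  then show ?thesis using dim_subset_UNIV_cart[of "span (\<Union>i\<in>{0..k}. line_of (v i))"] by simp
qed

text \<open>If all facets avoided \<open>C\<close>, a linear relation among the vertices could be
  used to push the point of \<open>C\<close> onto a facet. So the vertices are independent and span
  a properly embedded simplex of dimension \<open>m\<close>, beyond the rank.\<close>

lemma simplex_meets_facet:
  fixes m :: nat
  assumes m: "r_PES \<Omega> < m"
    and V: "\<And>k. k \<le> m \<Longrightarrow> V k \<in> closure C \<and> V k \<noteq> 0"
    and meets: "nonneg_hull {..m} V \<inter> C \<noteq> {}"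
  shows "\<exists>i\<le>m. nonneg_hull ({..m} - {i}) V \<inter> C \<noteq> {}"
proof (rule ccontr)
  assume "\<not> ?thesis"
  then have facets: "\<And>i. i \<le> m \<Longrightarrow> nonneg_hull ({..m} - {i}) V \<inter> C = {}" by blast
  obtain Z where Z: "Z \<in> nonneg_hull {..m} V" "Z \<in> C" using meets by blast
  obtain l where l: "\<And>k. k \<in> {..m} \<Longrightarrow> 0 \<le> l k" "Z = (\<Sum>k\<le>m. l k *\<^sub>R V k)"
    using Z(1) by (rule nonneg_hullE) blast
  have indep: "u k = 0" if u: "(\<Sum>k\<le>m. u k *\<^sub>R V k) = 0" and k: "k \<le> m" for u k
  proof (rule ccontr)
    assume "u k \<noteq> 0"
    then obtain i l' where i: "i \<le> m" "\<And>k. k \<in> {..m} - {i} \<Longrightarrow> 0 \<le> l' k" "(\<Sum>k\<in>{..m} - {i}. l' k *\<^sub>R V k) = Z"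
      using nonneg_comb_drop_vertex[of "{..m}" l u V k] l u k by auto
    then show False using facets[OF i(1)] Z(2) nonneg_hullI[of "{..m} - {i}" l' V] by auto
  qed
  have inj: "inj_on V {..m}"
  proof (rule inj_onI)
    fix i j assume ij: "i \<in> {..m}" "j \<in> {..m}" "V i = V j"
    show "i = j"
    proof (rule ccontr)
      assume "i \<noteq> j"
      define u where "u k = (if k = i then 1 else 0) - (if k = j then 1 else (0::real))" for k
      have "(\<Sum>k\<le>m. u k *\<^sub>R V k) = (\<Sum>k\<le>m. (if k = i then V k else 0)) - (\<Sum>k\<le>m. (if k = j then V k else 0))"
        unfolding sum_subtractf[symmetric] by (intro sum.cong) (auto simp: u_def)
      also have "\<dots> = 0" using ij by simp
      finally show False using indep[of u i] ij \<open>i \<noteq> j\<close> by (simp add: u_def)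
    qed
  qed
  have ind: "independent (V ` {..m})"
  proof
    assume "dependent (V ` {..m})"
    then obtain u w where u: "w \<in> V ` {..m}" "u w \<noteq> 0" "(\<Sum>w\<in>V ` {..m}. u w *\<^sub>R w) = 0"
      by (auto simp: dependent_finite)
    then obtain k where k: "k \<le> m" "w = V k" by auto
    have "(\<Sum>k\<le>m. u (V k) *\<^sub>R V k) = 0" using u(3) by (simp add: sum.reindex[OF inj])
    then show False using indep[of "\<lambda>k. u (V k)" k] k u(2) by simp
  qed
  define v where "v k = proj_pt (V k)" for k
  have bd: "V k \<notin> C" if k: "k \<le> m" for k
  proof -
    have "\<exists>i\<le>m. i \<noteq> k"
    proof (cases "k = 0")
      case True
      then show ?thesis using m by (intro exI[of _ m]) auto
    qed auto
    then obtain i where "i \<le> m" "i \<noteq> k" by blast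
    then show ?thesis using facets[of i] nonneg_hull_vertex[of "{..m} - {i}" k V] k by auto
  qed
  have CHJ: "CH \<Omega> (v ` J) = proj_pt ` (nonneg_hull J V - {0})" if "J \<subseteq> {..m}" for J
    unfolding v_def using that V finite_subset[OF that] by (intro CH_eq) auto
  have "span (\<Union>k\<in>{0..m}. line_of (v k)) = span (V ` {..m})"
  proof (rule subset_antisym)
    have "line_of (v k) \<subseteq> span (V ` {..m})" if "k \<le> m" for k
      using V[OF that] that by (auto simp: v_def line_of_proj_pt intro!: span_mono[THEN subsetD, of "{V k}"])
    then show "span (\<Union>k\<in>{0..m}. line_of (v k)) \<subseteq> span (V ` {..m})" by (intro span_minimal UN_least) auto
    have "V k \<in> line_of (v k)" if "k \<le> m" for k
      using V[OF that] by (auto simp: v_def line_of_proj_pt intro: span_base)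
    then show "span (V ` {..m}) \<subseteq> span (\<Union>k\<in>{0..m}. line_of (v k))" by (intro span_mono) auto
  qed
  then have "dim (span (\<Union>k\<in>{0..m}. line_of (v k))) = m + 1"
    using dim_eq_card_independent[OF ind] card_image[OF inj] by simp
  then have nondeg: "nondegenerate_simplex \<Omega> m v"
    unfolding nondegenerate_simplex_def using m proj_pt_closure V by (auto simp: v_def)
  have "is_PES \<Omega> m (CH \<Omega> (v ` {0..m}))"
    unfolding is_PES_def
  proof (intro exI[of _ v] conjI nondeg refl ballI)
    show "v i \<in> ideal_bd \<Omega>" if "i \<in> {0..m}" for i
      using that V bd proj_pt_ideal_bd by (auto simp: v_def)
    have "Z \<noteq> 0" using Z(2) zero_notin_C by auto
    then have "proj_pt Z \<in> CH \<Omega> (v ` {0..m})" using CHJ[of "{..m}"] Z(1) by (simp add: atLeast0AtMost)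
    then show "CH \<Omega> (v ` {0..m}) \<inter> \<Omega> \<noteq> {}" using proj_pt_C[OF Z(2)] by blast
    show "CH \<Omega> (v ` ({0..m} - {i})) \<subseteq> ideal_bd \<Omega>" if i: "i \<in> {0..m}" for i
    proof
      fix y assume "y \<in> CH \<Omega> (v ` ({0..m} - {i}))"
      then obtain Y where Y: "Y \<in> nonneg_hull ({..m} - {i}) V" "Y \<noteq> 0" "y = proj_pt Y"
        using CHJ[of "{..m} - {i}"] by (auto simp: atLeast0AtMost)
      have "Y \<in> closure C" using Y(1) by (rule nonneg_hull_closure) (use V in auto)
      moreover have "Y \<notin> C" using Y(1) facets[of i] i by auto
      ultimately show "y \<in> ideal_bd \<Omega>" using proj_pt_ideal_bd Y by simp
    qed
  qed
  then have "m \<le> r_PES \<Omega>" unfolding r_PES_def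
    using PES_dim_bound by (intro cSup_upper) (auto simp: bdd_above_def)
  then show False using m by simp
qed

end

theorem proposition1p9:
  fixes \<Omega> :: "('n::finite) rproj set" and r :: nat
  assumes "properly_convex_domain \<Omega>"
    and "quasi_homogeneous \<Omega>"
    and "r \<ge> r_PES \<Omega>"
  shows "\<exists>(\<delta>0::real) (\<Psi> :: real \<Rightarrow> real \<Rightarrow> real).
           \<delta>0 > 0 \<and>
           (\<forall>\<delta>\<ge>\<delta>0. \<forall>D\<ge>\<delta>0. \<Psi> \<delta> D \<ge> 0) \<and>
           (\<forall>D\<ge>\<delta>0. mono_on {\<delta>0..} (\<lambda>\<delta>. \<Psi> \<delta> D)) \<and>
           (\<forall>\<delta>\<ge>\<delta>0. mono_on {\<delta>0..} (\<lambda>D. \<Psi> \<delta> D)) \<and>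
           (\<forall>\<delta>\<ge>\<delta>0. \<forall>D\<ge>\<delta>0. \<forall>x. generic_tuple \<Omega> \<delta> D r x \<longrightarrow>
              centroid \<Omega> (\<delta>/2) (r + 1) x \<noteq> {} \<and>
              hilbert_diam \<Omega> (centroid \<Omega> (\<delta>/2) (r + 1) x) \<le> ennreal (\<Psi> \<delta> D))"
proof -
  obtain a where a: "closure \<Omega> \<subseteq> affine_chart a" "bounded (chart_coord a ` \<Omega>)" "convex (chart_coord a ` \<Omega>)"
    and \<Omega>: "open \<Omega>" "\<Omega> \<noteq> {}"
    using assms(1) by (auto simp: properly_convex_domain_def)
  obtain B where B: "\<And>x. x \<in> \<Omega> \<Longrightarrow> norm (chart_coord a x) \<le> B"
    using a(2) by (auto simp: bounded_iff)
  interpret convex_domain \<Omega> a B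
    using a \<Omega> B by unfold_locales auto
  obtain K where "cocompact_cone C a B K" using quasi_homogeneous_cocompact[OF assms(2)] by blast
  then interpret cocompact_cone C a B K .
  have rm: "r_PES \<Omega> < r + 1" using assms(3) by simp
  obtain T where T: "\<And>v X. (\<forall>k\<le>r + 1. v k \<in> C) \<Longrightarrow> X \<in> nonneg_hull {..r + 1} v \<Longrightarrow> X \<in> C \<Longrightarrow>
      \<exists>i\<le>r + 1. \<exists>Y\<in>nonneg_hull ({..r + 1} - {i}) v. near T X Y"
    using near_some_facet[of "r + 1", OF simplex_meets_facet[OF rm]] by blast
  define T0 where "T0 = max T 1"
  \<comment> \<open>The summand 1 turns \<open>T0 \<le> exp \<delta>\<close> into a strict
    inequality, as the open neighbourhood of radius \<delta>/2 demands.\<close>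
  define \<delta>0 where "\<delta>0 = ln T0 + 1"
  have T0: "1 \<le> T0" "T \<le> T0" by (auto simp: T0_def)
  have \<delta>0: "0 < \<delta>0" using ln_ge_zero[OF T0(1)] by (simp add: \<delta>0_def)
  define lift where "lift x k = chart_coord a (x k)" for x :: "nat \<Rightarrow> 'n rproj" and k
  have lift: "lift x k \<in> C" "proj_pt (lift x k) = x k" if "generic_tuple \<Omega> \<delta> D r x" "k \<le> r + 1" for \<delta> D x k
  proof -
    have "x k \<in> \<Omega>" using that by (simp add: generic_tuple_def)
    then show "lift x k \<in> C" "proj_pt (lift x k) = x k"
      using chart_coord_in_C chart_coord(2)[OF chart_\<Omega>] by (auto simp: lift_def)
  qed
  have img: "x ` ({0..r + 1} - J) = (\<lambda>k. proj_pt (lift x k)) ` ({..r + 1} - J)"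
    if "generic_tuple \<Omega> \<delta> D r x" for \<delta> D x J
    using lift(2)[OF that] by (auto simp: atLeast0AtMost intro!: image_cong)
  have centroid_nonempty: "centroid \<Omega> (\<delta>/2) (r + 1) x \<noteq> {}"
    if \<delta>: "\<delta>0 \<le> \<delta>" and gen: "generic_tuple \<Omega> \<delta> D r x" for \<delta> D x
  proof -
    have v: "\<And>k. k \<le> r + 1 \<Longrightarrow> lift x k \<in> C" using lift(1)[OF gen] .
    have cover: "\<exists>i\<le>r + 1. \<exists>Y\<in>nonneg_hull ({..r + 1} - {i}) (lift x). near T0 X Y"
      if X: "X \<in> nonneg_hull {..r + 1} (lift x)" "X \<in> C" for X
    proof -
      obtain i Y where i: "i \<le> r + 1" "Y \<in> nonneg_hull ({..r + 1} - {i}) (lift x)" "near T X Y"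
        using T[of "lift x", OF _ X] v by blast
      have "Y \<in> closure C" using i(2) by (rule nonneg_hull_closure) (use v C_subset_closure in auto)
      then have "near T0 X Y" using near_mono[OF i(3) _ T0(2)] by blast
      then show ?thesis using i by blast
    qed
    obtain X where X: "X \<in> C" "\<And>i. i \<le> r + 1 \<Longrightarrow> \<exists>Y\<in>nonneg_hull ({..r + 1} - {i}) (lift x). near T0 X Y"
      using common_near_point[of "r + 1" "lift x" T0, OF v T0(1) cover] by blast
    have "exp (ln T0) < exp \<delta>" using \<delta> by (simp add: \<delta>0_def del: exp_ln)
    then have T0\<delta>: "T0 < exp (2 * (\<delta>/2))" using T0(1) by simp
    have "proj_pt X \<in> nbhd \<Omega> (\<delta>/2) (CH \<Omega> (x ` ({0..r + 1} - {i})))" if i: "i \<le> r + 1" for i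
    proof -
      obtain Y where Y: "Y \<in> nonneg_hull ({..r + 1} - {i}) (lift x)" "near T0 X Y" using X(2)[OF i] by blast
      show ?thesis unfolding img[OF gen]
        by (rule near_imp_nbhd(2)[OF _ _ _ X(1) Y]) (use v \<delta> \<delta>0 T0(1) T0\<delta> in auto)
    qed
    then have "proj_pt X \<in> centroid \<Omega> (\<delta>/2) (r + 1) x" by (auto simp: centroid_def)
    then show ?thesis by blast
  qed
  \<comment> \<open>All smaller parameters are included so that the sets grow with \<delta> and
    \<open>D\<close>; the element 0 keeps them nonempty and the supremum nonnegative.\<close>
  define dists where "dists \<delta> D = insert 0 {hilbert_dist \<Omega> p q | p q x \<delta>' D'.
      \<delta>0 \<le> \<delta>' \<and> \<delta>' \<le> \<delta> \<and> \<delta>0 \<le> D' \<and> D' \<le> D \<and> generic_tuple \<Omega> \<delta>' D' r x \<and>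
      p \<in> centroid \<Omega> (\<delta>'/2) (r + 1) x \<and> q \<in> centroid \<Omega> (\<delta>'/2) (r + 1) x}" for \<delta> D
  define \<Psi> where "\<Psi> \<delta> D = Sup (dists \<delta> D)" for \<delta> D
  have bdd: "bdd_above (dists \<delta> D)" for \<delta> D
  proof -
    \<comment> \<open>This separation contradicts genericity for every \<open>D' \<le> D\<close>,
      and the upper bound \<delta> on the radii makes one \<open>N\<close> serve all \<delta>' in
      question.\<close>
    have "0 < exp (2 * D)" by simp
    from long_segment_near_edge_opposite_face[OF \<delta>0 this, of "r + 1" \<delta>] obtain N where N:
      "\<forall>v \<delta>' P Q. (\<forall>k\<le>r + 1. v k \<in> C) \<longrightarrow> \<delta>0 \<le> \<delta>' \<longrightarrow> \<delta>' \<le> \<delta> \<longrightarrow> P \<in> C \<longrightarrow> Q \<in> C \<longrightarrow>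
        (\<forall>i\<le>r + 1. \<exists>Y\<in>nonneg_hull ({..r + 1} - {i}) v. near (exp \<delta>') P Y) \<longrightarrow>
        (\<forall>i\<le>r + 1. \<exists>Y\<in>nonneg_hull ({..r + 1} - {i}) v. near (exp \<delta>') Q Y) \<longrightarrow> \<not> near N P Q \<longrightarrow>
        (\<exists>i j s t. i \<le> r + 1 \<and> j \<le> r + 1 \<and> i \<noteq> j \<and> 0 < s \<and> 0 < t \<and>
          (\<exists>Y\<in>nonneg_hull ({..r + 1} - {i, j}) v. near (exp (3/2 * \<delta>')) (s *\<^sub>R P + Q) Y) \<and>
          (\<exists>Y\<in>nonneg_hull ({..r + 1} - {i, j}) v. near (exp (3/2 * \<delta>')) (P + t *\<^sub>R Q) Y) \<and>
          \<not> near (exp (2 * D)) (s *\<^sub>R P + Q) (P + t *\<^sub>R Q))"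
      by (rule exE)
    have "hilbert_dist \<Omega> p q \<le> N"
      if \<delta>': "\<delta>0 \<le> \<delta>'" "\<delta>' \<le> \<delta>" and D': "\<delta>0 \<le> D'" "D' \<le> D" and gen: "generic_tuple \<Omega> \<delta>' D' r x"
        and pq: "p \<in> centroid \<Omega> (\<delta>'/2) (r + 1) x" "q \<in> centroid \<Omega> (\<delta>'/2) (r + 1) x"
      for p q x \<delta>' D'
    proof -
      have v: "\<And>k. k \<le> r + 1 \<Longrightarrow> lift x k \<in> C" using lift(1)[OF gen] .
      have pos: "0 < \<delta>'" using \<delta>' \<delta>0 by linarith
      have "z \<in> \<Omega>" if "z \<in> centroid \<Omega> (\<delta>'/2) (r + 1) x" for z
        using that pos by (auto simp: centroid_def nbhd_def)
      with pq have pq\<Omega>: "p \<in> \<Omega>" "q \<in> \<Omega>" by blast+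
      obtain P where P: "P \<in> C" "p = proj_pt P" using pq\<Omega>(1) by (rule lift_\<Omega>)
      obtain Q where Q: "Q \<in> C" "q = proj_pt Q" using pq\<Omega>(2) by (rule lift_\<Omega>)
      have near_facet: "\<exists>Y\<in>nonneg_hull ({..r + 1} - {i}) (lift x). near (exp \<delta>') Z Y"
        if Z: "Z \<in> C" "proj_pt Z \<in> centroid \<Omega> (\<delta>'/2) (r + 1) x" and i: "i \<le> r + 1" for Z i
      proof -
        have ne: "{..r + 1} - {i} \<noteq> {}"
          by (metis Diff_iff atMost_iff empty_iff insert_iff le_add2 zero_le zero_neq_one)
        have "proj_pt Z \<in> nbhd \<Omega> (\<delta>'/2) (CH \<Omega> ((\<lambda>k. proj_pt (lift x k)) ` ({..r + 1} - {i})))"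
          using Z(2) i unfolding centroid_def img[OF gen, symmetric] by auto
        from nbhd_imp_near[OF _ _ ne _ Z(1) this] show ?thesis using v pos by auto
      qed
      have PF: "\<forall>i\<le>r + 1. \<exists>Y\<in>nonneg_hull ({..r + 1} - {i}) (lift x). near (exp \<delta>') P Y"
        and QF: "\<forall>i\<le>r + 1. \<exists>Y\<in>nonneg_hull ({..r + 1} - {i}) (lift x). near (exp \<delta>') Q Y"
        using near_facet P Q pq by blast+
      have "near N P Q"
      proof (rule ccontr)
        assume "\<not> near N P Q"
        have "\<forall>k\<le>r + 1. lift x k \<in> C" using v by blast
        from N[THEN spec, THEN spec, THEN spec, THEN spec, THEN mp, THEN mp, THEN mp, THEN mp, THEN mp,
            THEN mp, THEN mp, THEN mp, OF this \<delta>' P(1) Q(1) PF QF \<open>\<not> near N P Q\<close>]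
        obtain i j s t where ij: "i \<le> r + 1" "j \<le> r + 1" "i \<noteq> j" and st: "0 < s" "0 < t"
          and ny: "\<exists>Y\<in>nonneg_hull ({..r + 1} - {i, j}) (lift x). near (exp (3/2 * \<delta>')) (s *\<^sub>R P + Q) Y"
          and nz: "\<exists>Y\<in>nonneg_hull ({..r + 1} - {i, j}) (lift x). near (exp (3/2 * \<delta>')) (P + t *\<^sub>R Q) Y"
          and far: "\<not> near (exp (2 * D)) (s *\<^sub>R P + Q) (P + t *\<^sub>R Q)"
          by blast
        define y z where "y = s *\<^sub>R P + Q" and "z = P + t *\<^sub>R Q"
        have yz: "y \<in> C" "z \<in> C" unfolding y_def z_def using P Q st by (auto intro: C_add C_scaleR)
        have facet: "proj_pt Z \<in> nbhd \<Omega> \<delta>' (CH \<Omega> (x ` ({0..r + 1} - {k})))"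
          if Z: "Z \<in> C" and ex: "\<exists>Y\<in>nonneg_hull ({..r + 1} - {k}) (lift x). near (exp \<delta>') Z Y" for Z k
        proof -
          obtain Y where Y: "Y \<in> nonneg_hull ({..r + 1} - {k}) (lift x)" "near (exp \<delta>') Z Y"
            using ex by blast
          show ?thesis unfolding img[OF gen]
            by (rule near_imp_nbhd(2)[OF _ _ _ Z Y]) (use v pos in auto)
        qed
        have face: "proj_pt Z \<in> nbhd \<Omega> \<delta>' (CH \<Omega> (x ` ({0..r + 1} - {i, j})))" "{0..r + 1} - {i, j} \<noteq> {}"
          if Z: "Z \<in> C" and ex: "\<exists>Y\<in>nonneg_hull ({..r + 1} - {i, j}) (lift x). near (exp (3/2 * \<delta>')) Z Y" for Z
        proof -
          obtain Y where Y: "Y \<in> nonneg_hull ({..r + 1} - {i, j}) (lift x)" "near (exp (3/2 * \<delta>')) Z Y"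
            using ex by blast
          show "proj_pt Z \<in> nbhd \<Omega> \<delta>' (CH \<Omega> (x ` ({0..r + 1} - {i, j})))" unfolding img[OF gen]
            by (rule near_imp_nbhd(2)[OF _ _ _ Z Y]) (use v pos in auto)
          \<comment> \<open>For \<open>r = 0\<close> the face opposite the edge has no vertices; the
            nearness just obtained excludes that case.\<close>
          have "{..r + 1} - {i, j} \<noteq> {}"
            by (rule near_imp_nbhd(1)[OF _ _ _ Z Y, of \<delta>']) (use v pos in auto)
          then show "{0..r + 1} - {i, j} \<noteq> {}" by (simp add: atLeast0AtMost)
        qed
        have "hilbert_dist \<Omega> (proj_pt y) (proj_pt z) \<le> D'"
        proof (rule generic_tuple_dist_le[OF gen _ ij])
          show "{0..r + 1} - {i, j} \<noteq> {}" using face(2)[OF yz(1)] ny unfolding y_def by blast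
          show "{proj_pt y, proj_pt z} \<subseteq> nbhd \<Omega> \<delta>' (CH \<Omega> (x ` ({0..r + 1} - {k})))" if k: "k \<le> r + 1" for k
          proof -
            have Pk: "\<exists>Y\<in>nonneg_hull ({..r + 1} - {k}) (lift x). near (exp \<delta>') P Y"
              and Qk: "\<exists>Y\<in>nonneg_hull ({..r + 1} - {k}) (lift x). near (exp \<delta>') Q Y"
              using PF QF k by blast+
            show ?thesis
              using facet[OF yz(1)] facet[OF yz(2)] near_hull_add[OF near_hull_scale[OF Pk st(1)] Qk]
                near_hull_add[OF Pk near_hull_scale[OF Qk st(2)]]
              unfolding y_def z_def by blast
          qed
          show "{proj_pt y, proj_pt z} \<subseteq> nbhd \<Omega> \<delta>' (CH \<Omega> (x ` ({0..r + 1} - {i, j})))"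
            using face(1)[OF yz(1)] face(1)[OF yz(2)] ny nz
            unfolding y_def z_def by blast
        qed (use D' \<delta>0 in linarith)
        moreover have "D < hilbert_dist \<Omega> (proj_pt y) (proj_pt z)"
          using far near_iff_hilbert_dist[OF yz, of "exp (2 * D)"] unfolding y_def z_def by simp
        ultimately show False using D' by linarith
      qed
      \<comment> \<open>The factor bounds the exponential of twice the distance;
        \<open>1 + z \<le> exp z\<close> gives \<open>N\<close> itself as a crude bound for the
        distance.\<close>
      then have "exp (2 * hilbert_dist \<Omega> p q) \<le> N" using near_iff_hilbert_dist[OF P(1) Q(1)] P Q by simp
      then show ?thesis
        using exp_ge_add_one_self[of "2 * hilbert_dist \<Omega> p q"] hilbert_dist_nonneg[OF pq\<Omega>] by linarith
    qed
    then show ?thesis by (intro bdd_aboveI[of _ "max 0 N"]) (fastforce simp: dists_def)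
  qed
  have mono: "\<Psi> \<delta> D \<le> \<Psi> \<delta>' D'" if "\<delta> \<le> \<delta>'" "D \<le> D'" for \<delta> D \<delta>' D'
    unfolding \<Psi>_def
  proof (rule cSup_subset_mono[OF _ bdd])
    show "dists \<delta> D \<noteq> {}" by (simp add: dists_def)
    show "dists \<delta> D \<subseteq> dists \<delta>' D'" unfolding dists_def
      by (intro insert_mono Collect_mono impI; elim exE conjE; intro exI conjI; (assumption | use that in linarith))
  qed
  have diam: "hilbert_diam \<Omega> (centroid \<Omega> (\<delta>/2) (r + 1) x) \<le> ennreal (\<Psi> \<delta> D)"
    if "\<delta>0 \<le> \<delta>" "\<delta>0 \<le> D" "generic_tuple \<Omega> \<delta> D r x" for \<delta> D x
    unfolding hilbert_diam_def
  proof (intro SUP_least ennreal_leI)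
    fix p q assume "p \<in> centroid \<Omega> (\<delta>/2) (r + 1) x" "q \<in> centroid \<Omega> (\<delta>/2) (r + 1) x"
    then have "hilbert_dist \<Omega> p q \<in> dists \<delta> D" unfolding dists_def using that by blast
    then show "hilbert_dist \<Omega> p q \<le> \<Psi> \<delta> D" unfolding \<Psi>_def using bdd by (rule cSup_upper)
  qed
  have "0 \<le> \<Psi> \<delta> D" for \<delta> D
    unfolding \<Psi>_def using bdd by (intro cSup_upper) (auto simp: dists_def)
  then show ?thesis
    using \<delta>0 mono centroid_nonempty diam
    by (intro exI[of _ \<delta>0] exI[of _ \<Psi>]) (auto simp: mono_on_def)
qed

end
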